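(* Let $\Gamma$ be the graph of an Ammann--Beenker tiling of $\mathbb{R}^2$ (as defined in the context). Then the integrated density of states $k_\Gamma:\mathbb{R}\to[0,1]$ of $\Gamma$ is discontinuous, i.e. it is not a continuous function.
   Context: **Graphs, Laplacian, IDS.** The graph $\Gamma=(\mathcal{V},\mathcal{E})$ of a tiling of $\mathbb{R}^2$ by polygons has one vertex per tile; two vertices are joined ($u\sim v$) iff the corresponding (distinct) tiles share at least one edge. The Laplacian on $\ell^2(\mathcal{V})$ is $[\Delta_\Gamma\psi](v)=\sum_{u\sim v}(\psi(v)-\psi(u))$; the same formula defines the Laplacian of a finite graph. Let $\mathcal{V}_n\subseteq\mathcal{V}$ be the finite set of tiles meeting the closed ball of radius $n$ about the origin, $\Gamma_n$ the subgraph induced on $\mathcal{V}_n$, $\Delta_n$ its Laplacian, and $\nu_n(B)=\frac{1}{\#\mathcal{V}_n}\mathrm{Tr}\,\chi_B(\Delta_n)$ for Borel $B\subseteq\mathbb{R}$. For the tilings below it is known that $\nu_n$ converges weak-$*$ to a probability measure $\nu_\Gamma$ (the density of states measure), independent of the choice of suitable exhaustion. The integrated density of states is $k_\Gamma(E)=\nu_\Gamma((-\infty,E])$. **Ammann--Beenker tilings.** Let $s=1+\sqrt2$. Consider rhombi $R(A,B,C,D)$ with side length 1 and angle $45^\circ$ at $A$ and $C$ (vertices in cyclic order), and half-squares $T(V,S,W)$: right isosceles triangles with right angle at $S$ and legs $|VS|=|SW|=1$, with ordered vertices; both orientations are allowed. The substitution enlarges by the factor $s$ and dissects as follows (written before enlarging).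 $R(A,B,C,D)$, with $u=(B-A)/s$ and $v=(D-A)/s$, becomes the rhombi $R(A,A+u,A+u+v,A+v)$, $R(C,C-u,C-u-v,C-v)$, $R(B,A+u+v,D,C-u-v)$ and the half-squares $T(B,A+u+v,A+u)$, $T(D,A+u+v,A+v)$, $T(B,C-u-v,C-v)$, $T(D,C-u-v,C-u)$. $T(V,S,W)$, with $p=(S-V)/s$, $q=(W-S)/s$, $r=(p+q)/\sqrt2$ and $c=V+p+q+r$, becomes the rhombi $R(V,V+p,V+p+r,V+r)$, $R(S,S+q,c,V+p+r)$ and the half-squares $T(c,V+p+r,V+r)$, $T(S,V+p+r,V+p)$, $T(W,c,S+q)$. A tiling of $\mathbb{R}^2$ by such rhombi and half-squares is associated with this substitution if each of its finite patches occurs, up to rotation and translation, in some iterate of the substitution applied to a single tile. In such a tiling each half-square $T(V,S,W)$ shares its hypotenuse $VW$ with its mirror image in the hypotenuse; replacing each such pair by its union (a unit square) gives a tiling by rhombi and squares, called an Ammann--Beenker tiling. *)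

theory Defs
  imports "HOL-Probability.Probability"
begin

text \<open>
  The plane \<open>\<real>\<^sup>2\<close> is \<^typ>\<open>complex\<close>. A tile carries its vertices in order, so \<open>set_tile\<close> is its
  vertex set and \<open>map_tile\<close> transports it along a map of the plane.
\<close>

datatype 'p tile = Rhombus 'p 'p 'p 'p | Half_Square 'p 'p 'p

definition region :: "complex tile \<Rightarrow> complex set" where
  "region t = convex hull (set_tile t)"

fun prototile :: "complex tile \<Rightarrow> bool" where
  "prototile (Rhombus A B C D) \<longleftrightarrow>
     C - B = D - A \<and> dist A B = 1 \<and> dist A D = 1 \<and> (B - A) \<bullet> (D - A) = cos (pi / 4)"
| "prototile (Half_Square V S W) \<longleftrightarrow>
     dist V S = 1 \<and> dist S W = 1 \<and> (V - S) \<bullet> (W - S) = 0"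

text \<open>
  The order of the vertices of a half-square is part of the tile, whereas a rhombus can be written
  in four ways, starting at either acute vertex and running in either direction.
\<close>

fun same_tile :: "'p tile \<Rightarrow> 'p tile \<Rightarrow> bool" where
  "same_tile (Rhombus A B C D) (Rhombus A' B' C' D') \<longleftrightarrow> {A, C} = {A', C'} \<and> {B, D} = {B', D'}"
| "same_tile (Half_Square V S W) (Half_Square V' S' W') \<longleftrightarrow> V = V' \<and> S = S' \<and> W = W'"
| "same_tile _ _ \<longleftrightarrow> False"

definition silver :: real where
  "silver = 1 + sqrt 2"

fun dissect :: "complex tile \<Rightarrow> complex tile set" where
  "dissect (Rhombus A B C D) =
     (let u = (B - A) /\<^sub>R silver; v = (D - A) /\<^sub>R silver in
      {Rhombus A (A + u) (A + u + v) (A + v),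
       Rhombus C (C - u) (C - u - v) (C - v),
       Rhombus B (A + u + v) D (C - u - v),
       Half_Square B (A + u + v) (A + u),
       Half_Square D (A + u + v) (A + v),
       Half_Square B (C - u - v) (C - v),
       Half_Square D (C - u - v) (C - u)})"
| "dissect (Half_Square V S W) =
     (let p = (S - V) /\<^sub>R silver; q = (W - S) /\<^sub>R silver; r = (p + q) /\<^sub>R sqrt 2;
          c = V + p + q + r in
      {Rhombus V (V + p) (V + p + r) (V + r),
       Rhombus S (S + q) c (V + p + r),
       Half_Square c (V + p + r) (V + r),
       Half_Square S (V + p + r) (V + p),
       Half_Square W c (S + q)})"

definition substitute :: "complex tile set \<Rightarrow> complex tile set" where
  "substitute P = (\<Union>t\<in>P. map_tile (\<lambda>z. silver *\<^sub>R z) ` dissect t)"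

definition is_tiling :: "complex tile set \<Rightarrow> bool" where
  "is_tiling \<T> \<longleftrightarrow>
     (\<forall>t\<in>\<T>. prototile t) \<and>
     (\<Union>t\<in>\<T>. region t) = UNIV \<and>
     pairwise (\<lambda>t t'. interior (region t) \<inter> interior (region t') = {}) \<T>"

definition occurs_in :: "complex tile set \<Rightarrow> complex tile set \<Rightarrow> bool" where
  "occurs_in P Q \<longleftrightarrow>
     (\<exists>a b. cmod a = 1 \<and> (\<forall>t\<in>P. \<exists>t'\<in>Q. same_tile (map_tile (\<lambda>z. a * z + b) t) t'))"

definition associated_with_substitution :: "complex tile set \<Rightarrow> bool" where
  "associated_with_substitution \<T> \<longleftrightarrow>
     (\<forall>P. P \<subseteq> \<T> \<and> finite P \<longrightarrow>
        (\<exists>t n. prototile t \<and> occurs_in P ((substitute ^^ n) {t})))"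

text \<open>Reflection in the line through two distinct points \<open>V\<close> and \<open>W\<close>.\<close>

definition mirror :: "complex \<Rightarrow> complex \<Rightarrow> complex \<Rightarrow> complex" where
  "mirror V W z = V + (W - V) * cnj ((z - V) / (W - V))"

text \<open>From here on, a tile is just the closed region it occupies.\<close>

definition glue_half_squares :: "complex tile set \<Rightarrow> complex set set" where
  "glue_half_squares \<T> =
     {region (Rhombus A B C D) | A B C D. Rhombus A B C D \<in> \<T>} \<union>
     {region (Half_Square V S W) \<union> region (Half_Square V (mirror V W S) W) | V S W.
        Half_Square V S W \<in> \<T> \<and> Half_Square V (mirror V W S) W \<in> \<T>}"

definition ammann_beenker_tiling :: "complex set set \<Rightarrow> bool" where
  "ammann_beenker_tiling X \<longleftrightarrow>
     (\<exists>\<T>. is_tiling \<T> \<and> associated_with_substitution \<T> \<and> X = glue_half_squares \<T>)"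

definition tile_adjacent :: "complex set \<Rightarrow> complex set \<Rightarrow> bool" where
  "tile_adjacent u v \<longleftrightarrow> u \<noteq> v \<and> (\<exists>e. e edge_of u \<and> e edge_of v)"

text \<open>
  Spectral theory of a finite graph with vertex set \<open>V\<close> and adjacency relation \<open>adj\<close>. The space
  \<open>\<ell>\<^sup>2(V)\<close> consists of the complex functions that vanish outside \<open>V\<close>; only edges with both ends
  in \<open>V\<close> count, so restricting \<open>V\<close> means passing to the induced subgraph.
\<close>

definition ell2 :: "'v set \<Rightarrow> ('v \<Rightarrow> complex) set" where
  "ell2 V = {\<psi>. \<forall>v. v \<notin> V \<longrightarrow> \<psi> v = 0}"

definition ell2_inner :: "'v set \<Rightarrow> ('v \<Rightarrow> complex) \<Rightarrow> ('v \<Rightarrow> complex) \<Rightarrow> complex" where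
  "ell2_inner V \<phi> \<psi> = (\<Sum>v\<in>V. \<phi> v * cnj (\<psi> v))"

definition laplacian :: "'v set \<Rightarrow> ('v \<Rightarrow> 'v \<Rightarrow> bool) \<Rightarrow> ('v \<Rightarrow> complex) \<Rightarrow> 'v \<Rightarrow> complex" where
  "laplacian V adj \<psi> v = (if v \<in> V then \<Sum>u | u \<in> V \<and> adj u v. \<psi> v - \<psi> u else 0)"

definition eigenspace ::
    "'v set \<Rightarrow> (('v \<Rightarrow> complex) \<Rightarrow> 'v \<Rightarrow> complex) \<Rightarrow> real \<Rightarrow> ('v \<Rightarrow> complex) set" where
  "eigenspace V H E = {\<psi> \<in> ell2 V. H \<psi> = (\<lambda>v. of_real E * \<psi> v)}"

definition spectrum :: "'v set \<Rightarrow> (('v \<Rightarrow> complex) \<Rightarrow> 'v \<Rightarrow> complex) \<Rightarrow> real set" where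
  "spectrum V H = {E. \<exists>\<psi> \<in> eigenspace V H E. \<exists>v. \<psi> v \<noteq> 0}"

definition orth_proj ::
    "'v set \<Rightarrow> ('v \<Rightarrow> complex) set \<Rightarrow> ('v \<Rightarrow> complex) \<Rightarrow> 'v \<Rightarrow> complex" where
  "orth_proj V U \<psi> =
     (THE \<phi>. \<phi> \<in> U \<and> (\<forall>\<eta>\<in>U. ell2_inner V (\<lambda>v. \<psi> v - \<phi> v) \<eta> = 0))"

text \<open>The operator \<open>\<chi>\<^sub>B(H)\<close> for \<open>H\<close> self-adjoint on \<open>\<ell>\<^sup>2(V)\<close>, \<open>V\<close> finite.\<close>

definition spectral_proj ::
    "'v set \<Rightarrow> (('v \<Rightarrow> complex) \<Rightarrow> 'v \<Rightarrow> complex) \<Rightarrow> real set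
      \<Rightarrow> ('v \<Rightarrow> complex) \<Rightarrow> 'v \<Rightarrow> complex" where
  "spectral_proj V H B \<psi> v =
     (\<Sum>E \<in> spectrum V H \<inter> B. orth_proj V (eigenspace V H E) \<psi> v)"

definition ell2_trace :: "'v set \<Rightarrow> (('v \<Rightarrow> complex) \<Rightarrow> 'v \<Rightarrow> complex) \<Rightarrow> complex" where
  "ell2_trace V H = (\<Sum>v\<in>V. H (indicator {v}) v)"

definition spectral_measure :: "'v set \<Rightarrow> ('v \<Rightarrow> 'v \<Rightarrow> bool) \<Rightarrow> real measure" where
  "spectral_measure V adj =
     measure_of UNIV (sets borel)
       (\<lambda>B. ennreal (Re (ell2_trace V (spectral_proj V (laplacian V adj) B)) / real (card V)))"

definition tiles_meeting_ball :: "complex set set \<Rightarrow> nat \<Rightarrow> complex set set" where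
  "tiles_meeting_ball X n = {v \<in> X. v \<inter> cball 0 (real n) \<noteq> {}}"

text \<open>
  Weak-* convergence of finite measures on the line, tested against \<open>C\<^sub>0(\<real>)\<close>.
\<close>

definition weak_star_limit :: "(nat \<Rightarrow> real measure) \<Rightarrow> real measure \<Rightarrow> bool" where
  "weak_star_limit \<mu> \<nu> \<longleftrightarrow>
     (\<forall>f :: real \<Rightarrow> real. continuous_on UNIV f \<and> (f \<longlongrightarrow> 0) at_infinity \<longrightarrow>
        (\<lambda>n. \<integral>x. f x \<partial>\<mu> n) \<longlonglongrightarrow> (\<integral>x. f x \<partial>\<nu>))"

text \<open>
  The measure \<open>\<nu>\<close> is the density of states measure of the graph of the tiling \<open>X\<close>. Its integrated
  density of states is the library's \<open>cdf \<nu> = (\<lambda>E. measure \<nu> {..E})\<close>.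
\<close>

definition density_of_states_measure :: "complex set set \<Rightarrow> real measure \<Rightarrow> bool" where
  "density_of_states_measure X \<nu> \<longleftrightarrow>
     real_distribution \<nu> \<and>
     weak_star_limit (\<lambda>n. spectral_measure (tiles_meeting_ball X n) tile_adjacent) \<nu>"

end

(*
  Around every vertex at which eight rhombi meet with their acute angles there is a locally supported
  eigenfunction. After a substitution step the gaps between consecutive rhombi of such a star are
  filled by eight squares, so each neighbour of a rhombus of the star is one of the two adjacent
  rhombi or one of the two adjacent squares. The function that is alternately 1 and -1 on the eight
  rhombi therefore satisfies the eigenvalue equation with E = 4 + 2 = 6: the two values next to each
  square cancel.

  The third iterate of a rhombus contains such a star, hence so does the fourth iterate of any tile.
  As the substitution dissects tiles, every ball of a fixed radius in the tiling contains all tiles of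
  some fourth iterate, hence a star. A grid of such balls gives c n^2 eigenfunctions with disjoint
  supports in the ball of radius n, while that ball meets at most C n^2 tiles. So nu_n({6}) is bounded
  below, and this mass at 6 survives in the weak-* limit.
*)
theory Submission
  imports Defs
begin

section \<open>Spectral measures of finite graphs\<close>

text \<open>\<open>associated_with_substitution\<close> only says that a finite patch occurs in an
  iterate of some order \<open>n\<close>, so the fourth iterate near a point \<open>g\<close> has to
  be extracted. The patch around \<open>g\<close> is taken with radius 1000, too large for an
  iterate of order at most 3; hence \<open>n\<close> \<ge> 4, and the tile over \<open>g\<close>
  comes from the fourth iterate of a single tile, of diameter at most 162. Each tile of that iterate
  overlaps the image of a tile of the patch and, interiors within an iterate being disjoint, is that
  image. Thus the tiling supplies the covering, and the substitution supplies containment and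
  disjointness.

  The neighbours of a rhombus of a star are found without classifying vertex configurations: each of
  its edges has a known tile on either side, and a third tile with that edge would overlap one of
  the two.

  The traces in \<open>spectral_measure\<close> are evaluated by maximal orthonormal systems in the
  eigenspaces. The mass at 6 reaches the limit through test functions: a narrow tent at 6 bounds an
  increment of the distribution function from below.\<close>

definition orthonormal_in :: "'v set \<Rightarrow> ('v \<Rightarrow> complex) set \<Rightarrow> bool" where
  "orthonormal_in V S \<longleftrightarrow>
     (\<forall>\<phi>\<in>S. \<forall>\<psi>\<in>S. ell2_inner V \<phi> \<psi> = (if \<phi> = \<psi> then 1 else 0))"

definition lin_closed :: "('v \<Rightarrow> complex) set \<Rightarrow> bool" where
  "lin_closed U \<longleftrightarrow> (\<lambda>_. 0) \<in> U \<and>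
     (\<forall>a. \<forall>\<phi>\<in>U. \<forall>\<psi>\<in>U. (\<lambda>v. \<phi> v + a * \<psi> v) \<in> U)"

lemma lin_closed_sum:
  assumes "lin_closed U" "finite S" "S \<subseteq> U"
  shows "(\<lambda>v. \<Sum>\<phi>\<in>S. c \<phi> * \<phi> v) \<in> U"
  using assms(2,3)
proof (induction S rule: finite_induct)
  case empty
  then show ?case using assms(1) by (simp add: lin_closed_def)
next
  case (insert \<phi> S)
  have eq: "(\<lambda>v. \<Sum>\<phi>\<in>insert \<phi> S. c \<phi> * \<phi> v) = (\<lambda>v. (\<Sum>\<phi>\<in>S. c \<phi> * \<phi> v) + c \<phi> * \<phi> v)"
    using insert(1,2) by (simp add: fun_eq_iff)
  from insert have "(\<lambda>v. \<Sum>\<phi>\<in>S. c \<phi> * \<phi> v) \<in> U" "\<phi> \<in> U" by auto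
  then show ?case unfolding eq using assms(1) by (simp add: lin_closed_def)
qed

lemma lin_closed_scale:
  assumes "lin_closed U" "\<phi> \<in> U"
  shows "(\<lambda>v. a * \<phi> v) \<in> U"
  using lin_closed_sum[OF assms(1), of "{\<phi>}" "\<lambda>_. a"] assms(2) by simp

lemma lin_closed_diff:
  assumes "lin_closed U" "\<phi> \<in> U" "\<psi> \<in> U"
  shows "(\<lambda>v. \<phi> v - \<psi> v) \<in> U"
proof -
  have "(\<lambda>v. \<phi> v + (-1) * \<psi> v) \<in> U"
    using assms unfolding lin_closed_def by blast
  then show ?thesis by simp
qed

section \<open>Inner products and orthonormal systems in finite-dimensional
  \<open>ell2\<close>\<close>

lemma ell2_inner_diff_left:
  "ell2_inner V (\<lambda>v. \<phi> v - \<psi> v) \<eta> = ell2_inner V \<phi> \<eta> - ell2_inner V \<psi> \<eta>"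
  by (simp add: ell2_inner_def left_diff_distrib sum_subtractf)

lemma ell2_inner_sum_left:
  "ell2_inner V (\<lambda>v. \<Sum>i\<in>I. c i * f i v) \<eta> = (\<Sum>i\<in>I. c i * ell2_inner V (f i) \<eta>)"
  unfolding ell2_inner_def
  by (simp add: sum_distrib_left sum_distrib_right mult.assoc) (rule sum.swap)

lemma ell2_inner_scale_left: "ell2_inner V (\<lambda>v. a * \<phi> v) \<eta> = a * ell2_inner V \<phi> \<eta>"
  by (simp add: ell2_inner_def sum_distrib_left mult.assoc)

lemma ell2_inner_commute: "ell2_inner V \<phi> \<psi> = cnj (ell2_inner V \<psi> \<phi>)"
  by (simp add: ell2_inner_def mult.commute)

lemma ell2_inner_self: "ell2_inner V \<phi> \<phi> = of_real (\<Sum>v\<in>V. (cmod (\<phi> v))\<^sup>2)"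
  by (simp add: ell2_inner_def complex_norm_square del: of_real_power)

lemma ell2_inner_indicator:
  assumes "finite V" "v \<in> V"
  shows "ell2_inner V (indicator {v}) \<phi> = cnj (\<phi> v)"
  using assms by (simp add: ell2_inner_def indicator_def if_distrib sum.delta cong: if_cong)

lemma ell2_eq_zero:
  assumes "finite V" "\<phi> \<in> ell2 V" "ell2_inner V \<phi> \<phi> = 0"
  shows "\<phi> = (\<lambda>_. 0)"
proof -
  have "(\<Sum>v\<in>V. (cmod (\<phi> v))\<^sup>2) = 0"
    using assms(3) unfolding ell2_inner_self by (simp only: of_real_eq_0_iff)
  then have "\<forall>v\<in>V. \<phi> v = 0"
    using assms(1) by (simp add: sum_nonneg_eq_0_iff)
  then show ?thesis using assms(2) by (auto simp: ell2_def)
qed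

lemma ell2_normalize:
  assumes "finite V" "\<phi> \<in> ell2 V" "\<phi> v \<noteq> 0"
  obtains a where "ell2_inner V (\<lambda>v. a * \<phi> v) (\<lambda>v. a * \<phi> v) = 1"
proof -
  define r where "r = (\<Sum>v\<in>V. (cmod (\<phi> v))\<^sup>2)"
  have "r \<noteq> 0"
    using ell2_eq_zero[OF assms(1,2)] assms(3) unfolding ell2_inner_self r_def by (auto simp only: of_real_0)
  moreover have "r \<ge> 0" unfolding r_def by (simp add: sum_nonneg)
  ultimately have r: "r > 0" by simp
  have "ell2_inner V (\<lambda>v. of_real (1 / sqrt r) * \<phi> v) (\<lambda>v. of_real (1 / sqrt r) * \<phi> v)
      = of_real ((1 / sqrt r)\<^sup>2 * r)"
    unfolding ell2_inner_self r_def
    by (simp add: norm_mult power_mult_distrib norm_divide sum_distrib_left power_divide sum_divide_distrib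
        del: of_real_power of_real_mult of_real_divide)
  also have "\<dots> = 1" using r by (simp add: power_divide)
  finally show ?thesis by (rule that)
qed

lemma orthonormal_expansion:
  assumes "finite S" "orthonormal_in V S" "\<eta> \<in> S"
  shows "ell2_inner V (\<lambda>v. \<psi> v - (\<Sum>\<phi>\<in>S. ell2_inner V \<psi> \<phi> * \<phi> v)) \<eta> = 0"
proof -
  have "(\<Sum>\<phi>\<in>S. ell2_inner V \<psi> \<phi> * ell2_inner V \<phi> \<eta>)
      = (\<Sum>\<phi>\<in>S. if \<phi> = \<eta> then ell2_inner V \<psi> \<phi> else 0)"
    using assms by (intro sum.cong) (auto simp: orthonormal_in_def)
  then show ?thesis
    using assms by (simp add: ell2_inner_diff_left ell2_inner_sum_left)
qed

lemma bessel:
  assumes "finite S" "orthonormal_in V S"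
  shows "(\<Sum>\<phi>\<in>S. (cmod (ell2_inner V \<psi> \<phi>))\<^sup>2) \<le> Re (ell2_inner V \<psi> \<psi>)"
proof -
  define c where "c \<phi> = ell2_inner V \<psi> \<phi>" for \<phi>
  define \<zeta> where "\<zeta> = (\<lambda>v. \<psi> v - (\<Sum>\<phi>\<in>S. c \<phi> * \<phi> v))"
  have inner: "ell2_inner V \<zeta> \<eta> = ell2_inner V \<psi> \<eta> - (\<Sum>\<phi>\<in>S. c \<phi> * ell2_inner V \<phi> \<eta>)" for \<eta>
    unfolding \<zeta>_def by (simp only: ell2_inner_diff_left ell2_inner_sum_left)
  have orth: "ell2_inner V \<phi> \<zeta> = 0" if "\<phi> \<in> S" for \<phi>
    using orthonormal_expansion[OF assms that, of \<psi>] ell2_inner_commute[of V \<phi> \<zeta>]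
    unfolding \<zeta>_def c_def by simp
  \<comment> \<open>The remainder \<zeta> is orthogonal to \<open>S\<close>, so in its squared norm
    one factor \<zeta> may be replaced by \<psi>.\<close>
  have "ell2_inner V \<zeta> \<zeta> = cnj (ell2_inner V \<zeta> \<psi>)"
    using inner[of \<zeta>] orth ell2_inner_commute[of V \<psi> \<zeta>] by simp
  also have "ell2_inner V \<zeta> \<psi> = ell2_inner V \<psi> \<psi> - (\<Sum>\<phi>\<in>S. c \<phi> * ell2_inner V \<phi> \<psi>)"
    by (rule inner)
  also have "(\<Sum>\<phi>\<in>S. c \<phi> * ell2_inner V \<phi> \<psi>) = of_real (\<Sum>\<phi>\<in>S. (cmod (c \<phi>))\<^sup>2)"
    unfolding of_real_sum c_def
    by (intro sum.cong refl)
      (metis complex_norm_square ell2_inner_commute of_real_power)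
  finally have "ell2_inner V \<zeta> \<zeta> = cnj (ell2_inner V \<psi> \<psi> - of_real (\<Sum>\<phi>\<in>S. (cmod (c \<phi>))\<^sup>2))" .
  moreover have "Re (ell2_inner V \<zeta> \<zeta>) \<ge> 0"
    by (simp add: ell2_inner_self sum_nonneg del: of_real_sum)
  ultimately show ?thesis by (simp add: c_def)
qed

lemma sum_orthonormal:
  assumes "orthonormal_in V S"
  shows "(\<Sum>v\<in>V. \<Sum>\<phi>\<in>S. (cmod (\<phi> v))\<^sup>2) = real (card S)"
proof -
  have "(\<Sum>v\<in>V. (cmod (\<phi> v))\<^sup>2) = 1" if "\<phi> \<in> S" for \<phi>
    using assms that ell2_inner_self[of V \<phi>] unfolding orthonormal_in_def
    by (metis of_real_eq_1_iff)
  then show ?thesis by (subst sum.swap) simp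
qed

text \<open>Bessel's inequality for the point mass at \<open>v\<close> bounds the sum of the squared
  values at \<open>v\<close> by 1, and summing over \<open>V\<close> counts the system. Finiteness
  is part of the conclusion, hence the detour through finite subsets.\<close>

lemma orthonormal_card_le:
  assumes V: "finite V" and S: "orthonormal_in V S"
  shows "finite S" "card S \<le> card V"
proof -
  have *: "card F \<le> card V" if "finite F" "F \<subseteq> S" for F
  proof -
    have F: "orthonormal_in V F" using S that unfolding orthonormal_in_def by blast
    have "real (card F) = (\<Sum>v\<in>V. \<Sum>\<phi>\<in>F. (cmod (\<phi> v))\<^sup>2)"
      using sum_orthonormal[OF F] by simp
    also have "\<dots> \<le> (\<Sum>v\<in>V. 1)"
    proof (rule sum_mono)
      fix v assume v: "v \<in> V"
      have "(\<Sum>\<phi>\<in>F. (cmod (\<phi> v))\<^sup>2) = (\<Sum>\<phi>\<in>F. (cmod (ell2_inner V (indicator {v}) \<phi>))\<^sup>2)"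
        using V v by (simp add: ell2_inner_indicator)
      also have "\<dots> \<le> Re (ell2_inner V (indicator {v}) (indicator {v}))"
        by (rule bessel[OF that(1) F])
      also have "\<dots> = 1" using V v by (simp add: ell2_inner_indicator)
      finally show "(\<Sum>\<phi>\<in>F. (cmod (\<phi> v))\<^sup>2) \<le> 1" .
    qed
    finally show ?thesis by simp
  qed
  then have "finite S \<and> card S \<le> card V"
    by (intro finite_if_finite_subsets_card_bdd)
  then show "finite S" "card S \<le> card V" by auto
qed

text \<open>Among the orthonormal systems in \<open>U\<close> that contain \<open>S\<^sub>0\<close>
  one has maximal size, since \<open>card V\<close> is a bound. Its Fourier sums are the
  projections, which also shows that the definite description in \<open>orth_proj\<close> is met,
  and the trace is the size of the system, that is, the dimension of \<open>U\<close>.\<close>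

lemma trace_orth_proj:
  assumes V: "finite V" and U: "lin_closed U" "U \<subseteq> ell2 V"
    and S\<^sub>0: "orthonormal_in V S\<^sub>0" "S\<^sub>0 \<subseteq> U"
  obtains n where "card S\<^sub>0 \<le> n" "(\<Sum>v\<in>V. orth_proj V U (indicator {v}) v) = of_nat n"
proof -
  let ?P = "\<lambda>S. orthonormal_in V S \<and> S\<^sub>0 \<subseteq> S \<and> S \<subseteq> U"
  have "?P S\<^sub>0" using S\<^sub>0 by blast
  moreover have "\<forall>T. ?P T \<longrightarrow> card T < Suc (card V)"
    using orthonormal_card_le(2)[OF V] by (auto simp: less_Suc_eq_le)
  ultimately have am: "?P (arg_max card ?P) \<and> (\<forall>T. ?P T \<longrightarrow> card T \<le> card (arg_max card ?P))"
    by (rule arg_max_nat_lemma)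
  define S where "S = arg_max card ?P"
  have S: "orthonormal_in V S" "S\<^sub>0 \<subseteq> S" "S \<subseteq> U"
    using am[THEN conjunct1] unfolding S_def by (iprover dest: conjunct1 conjunct2)+
  have max: "card T \<le> card S" if "?P T" for T
    using am[THEN conjunct2] that unfolding S_def by (iprover dest: spec mp)
  have fin: "finite S" using orthonormal_card_le[OF V S(1)] by simp
  define Q where "Q \<psi> = (\<lambda>v. \<Sum>\<phi>\<in>S. ell2_inner V \<psi> \<phi> * \<phi> v)" for \<psi>
  have QU: "Q \<psi> \<in> U" for \<psi> unfolding Q_def by (rule lin_closed_sum[OF U(1) fin S(3)])
  have QS: "ell2_inner V (\<lambda>v. \<psi> v - Q \<psi> v) \<phi> = 0" if "\<phi> \<in> S" for \<phi> \<psi>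
    unfolding Q_def by (rule orthonormal_expansion[OF fin S(1) that])
  \<comment> \<open>A nonzero remainder of \<eta> would, once normalised, enlarge the
    system.\<close>
  have Qid: "Q \<eta> = \<eta>" if \<eta>: "\<eta> \<in> U" for \<eta>
  proof (rule ccontr)
    assume "Q \<eta> \<noteq> \<eta>"
    define \<zeta> where "\<zeta> = (\<lambda>v. \<eta> v - Q \<eta> v)"
    have \<zeta>U: "\<zeta> \<in> U" unfolding \<zeta>_def by (rule lin_closed_diff[OF U(1) \<eta> QU])
    obtain v where "\<zeta> v \<noteq> 0" using \<open>Q \<eta> \<noteq> \<eta>\<close> by (force simp: \<zeta>_def)
    then obtain a where a: "ell2_inner V (\<lambda>v. a * \<zeta> v) (\<lambda>v. a * \<zeta> v) = 1"
      using ell2_normalize[OF V] \<zeta>U U(2) by blast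
    define \<xi> where "\<xi> = (\<lambda>v. a * \<zeta> v)"
    have \<xi>: "ell2_inner V \<xi> \<xi> = 1" using a by (simp add: \<xi>_def)
    have \<xi>0: "ell2_inner V \<xi> \<phi> = 0" if "\<phi> \<in> S" for \<phi>
      using QS[OF that, of \<eta>] unfolding \<xi>_def ell2_inner_scale_left \<zeta>_def by simp
    then have \<xi>0': "ell2_inner V \<phi> \<xi> = 0" if "\<phi> \<in> S" for \<phi>
      using that ell2_inner_commute[of V \<phi> \<xi>] by simp
    have "\<xi> \<notin> S" using \<xi> \<xi>0 by force
    moreover have "?P (insert \<xi> S)"
    proof -
      have "orthonormal_in V (insert \<xi> S)"
        using S(1) \<xi> \<xi>0 \<xi>0' \<open>\<xi> \<notin> S\<close> unfolding orthonormal_in_def by auto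
      moreover have "\<xi> \<in> U" unfolding \<xi>_def by (rule lin_closed_scale[OF U(1) \<zeta>U])
      ultimately show ?thesis using S by auto
    qed
    ultimately show False using max[of "insert \<xi> S"] fin by simp
  qed
  have P: "orth_proj V U \<psi> = Q \<psi>" for \<psi>
    unfolding orth_proj_def
  proof (rule the_equality)
    have perp: "ell2_inner V (\<lambda>v. \<psi> v - Q \<psi> v) \<eta> = 0" if "\<eta> \<in> U" for \<eta>
    proof -
      define \<zeta> where "\<zeta> = (\<lambda>v. \<psi> v - Q \<psi> v)"
      have "ell2_inner V \<eta> \<zeta> = ell2_inner V (Q \<eta>) \<zeta>" using Qid[OF that] by simp
      also have "\<dots> = (\<Sum>\<phi>\<in>S. ell2_inner V \<eta> \<phi> * ell2_inner V \<phi> \<zeta>)"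
        unfolding Q_def by (rule ell2_inner_sum_left)
      also have "\<dots> = 0"
        using QS[of _ \<psi>] ell2_inner_commute[of V _ \<zeta>] by (intro sum.neutral) (simp add: \<zeta>_def)
      finally show ?thesis using ell2_inner_commute[of V \<zeta> \<eta>] by (simp add: \<zeta>_def)
    qed
    then show Q': "Q \<psi> \<in> U \<and> (\<forall>\<eta>\<in>U. ell2_inner V (\<lambda>v. \<psi> v - Q \<psi> v) \<eta> = 0)" using QU by blast
    fix \<phi> assume \<phi>: "\<phi> \<in> U \<and> (\<forall>\<eta>\<in>U. ell2_inner V (\<lambda>v. \<psi> v - \<phi> v) \<eta> = 0)"
    let ?d = "\<lambda>v. \<phi> v - Q \<psi> v"
    have d: "?d \<in> U" using lin_closed_diff[OF U(1)] \<phi> QU by blast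
    have "ell2_inner V ?d ?d
        = ell2_inner V (\<lambda>v. \<psi> v - Q \<psi> v) ?d - ell2_inner V (\<lambda>v. \<psi> v - \<phi> v) ?d"
      unfolding ell2_inner_diff_left by simp
    also have "\<dots> = 0" using perp[OF d] \<phi> d by simp
    finally have "?d = (\<lambda>_. 0)" using ell2_eq_zero[OF V] d U(2) by blast
    then show "\<phi> = Q \<psi>" by (metis (no_types) eq_iff_diff_eq_0 ext)
  qed
  \<comment> \<open>The Fourier coefficients of a point mass are conjugate values, so the diagonal
    entries of the projection are sums of squared moduli.\<close>
  have "(\<Sum>v\<in>V. orth_proj V U (indicator {v}) v)
      = (\<Sum>v\<in>V. \<Sum>\<phi>\<in>S. of_real ((cmod (\<phi> v))\<^sup>2))"
    unfolding P Q_def using V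
    by (intro sum.cong refl) (simp add: ell2_inner_indicator complex_norm_square mult.commute del: of_real_power)
  also have "\<dots> = of_real (\<Sum>v\<in>V. \<Sum>\<phi>\<in>S. (cmod (\<phi> v))\<^sup>2)" by simp
  also have "\<dots> = of_nat (card S)" unfolding sum_orthonormal[OF S(1)] by simp
  finally show ?thesis using that[of "card S"] S(2) fin by (simp add: card_mono)
qed

section \<open>The Laplacian of a finite graph and its spectral measure\<close>

lemma lin_closed_eigenspace: "lin_closed (eigenspace V (laplacian V adj) E)"
proof -
  have "laplacian V adj (\<lambda>v. \<phi> v + a * \<psi> v)
      = (\<lambda>v. laplacian V adj \<phi> v + a * laplacian V adj \<psi> v)" for \<phi> \<psi> a
    by (rule ext)
      (simp add: laplacian_def sum_distrib_left sum.distrib[symmetric] algebra_simps)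
  then show ?thesis
    unfolding lin_closed_def eigenspace_def ell2_def
    by (simp add: algebra_simps) (auto simp: laplacian_def)
qed

text \<open>As double sums over \<open>V\<close>, both sides have the same diagonal part, and
  symmetry of \<open>adj\<close> exchanges the mixed parts.\<close>

lemma laplacian_self_adjoint:
  assumes V: "finite V" and sym: "\<And>u v. adj u v \<Longrightarrow> adj v u"
  shows "ell2_inner V (laplacian V adj \<phi>) \<psi> = ell2_inner V \<phi> (laplacian V adj \<psi>)"
proof -
  have 1: "ell2_inner V (laplacian V adj \<phi>) \<psi>
     = (\<Sum>v\<in>V. \<Sum>u\<in>V. if adj u v then (\<phi> v - \<phi> u) * cnj (\<psi> v) else 0)"
    unfolding ell2_inner_def laplacian_def
    using V by (intro sum.cong refl) (simp add: sum.inter_filter[symmetric] sum_distrib_right if_distrib[of "\<lambda>z. z * _"] cong: if_cong)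
  have 2: "ell2_inner V \<phi> (laplacian V adj \<psi>)
     = (\<Sum>v\<in>V. \<Sum>u\<in>V. if adj u v then \<phi> v * (cnj (\<psi> v) - cnj (\<psi> u)) else 0)"
    unfolding ell2_inner_def laplacian_def
    using V by (intro sum.cong refl) (simp add: sum.inter_filter[symmetric] sum_distrib_left if_distrib[of "\<lambda>z. _ * z"] if_distrib[of cnj] cong: if_cong)
  have 3: "(\<Sum>v\<in>V. \<Sum>u\<in>V. if adj u v then \<phi> u * cnj (\<psi> v) else 0)
     = (\<Sum>v\<in>V. \<Sum>u\<in>V. if adj u v then \<phi> v * cnj (\<psi> u) else 0)"
    by (subst sum.swap) (intro sum.cong refl if_cong, auto dest: sym)
  have "ell2_inner V (laplacian V adj \<phi>) \<psi> =
     (\<Sum>v\<in>V. \<Sum>u\<in>V. if adj u v then \<phi> v * cnj (\<psi> v) else 0)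
     - (\<Sum>v\<in>V. \<Sum>u\<in>V. if adj u v then \<phi> u * cnj (\<psi> v) else 0)"
    unfolding 1 by (simp add: sum_subtractf[symmetric]) (intro sum.cong refl, simp add: left_diff_distrib)
  also have "\<dots> = ell2_inner V \<phi> (laplacian V adj \<psi>)"
    unfolding 2 3 by (simp add: sum_subtractf[symmetric]) (intro sum.cong refl, simp add: right_diff_distrib)
  finally show ?thesis .
qed

text \<open>Unit eigenfunctions for distinct eigenvalues form an orthonormal system. Finiteness
  matters because a sum over an infinite set, as in \<open>spectral_proj\<close>, would take the
  default value 0.\<close>

lemma finite_spectrum:
  assumes V: "finite V" and sym: "\<And>u v. adj u v \<Longrightarrow> adj v u"
  shows "finite (spectrum V (laplacian V adj))"
proof -
  let ?H = "laplacian V adj"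
  have "\<exists>\<phi>\<in>eigenspace V ?H E. ell2_inner V \<phi> \<phi> = 1" if E: "E \<in> spectrum V ?H" for E
  proof -
    obtain \<phi> v where \<phi>: "\<phi> \<in> eigenspace V ?H E" "\<phi> v \<noteq> 0"
      using E by (auto simp: spectrum_def)
    then have "\<phi> \<in> ell2 V" by (simp add: eigenspace_def)
    then obtain a where "ell2_inner V (\<lambda>v. a * \<phi> v) (\<lambda>v. a * \<phi> v) = 1"
      using ell2_normalize[OF V] \<phi>(2) by blast
    then show ?thesis using lin_closed_scale[OF lin_closed_eigenspace \<phi>(1)] by blast
  qed
  then obtain f where f: "\<And>E. E \<in> spectrum V ?H \<Longrightarrow> f E \<in> eigenspace V ?H E"
      "\<And>E. E \<in> spectrum V ?H \<Longrightarrow> ell2_inner V (f E) (f E) = 1" by metis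
  have orth: "ell2_inner V (f E) (f F) = 0"
    if "E \<in> spectrum V ?H" "F \<in> spectrum V ?H" "E \<noteq> F" for E F
  proof -
    have "of_real E * ell2_inner V (f E) (f F) = ell2_inner V (?H (f E)) (f F)"
      using f(1)[OF that(1)] by (simp add: eigenspace_def ell2_inner_scale_left)
    also have "\<dots> = ell2_inner V (f E) (?H (f F))" by (rule laplacian_self_adjoint[OF V sym])
    also have "\<dots> = of_real F * ell2_inner V (f E) (f F)"
      using f(1)[OF that(2)]
      by (simp add: eigenspace_def ell2_inner_def sum_distrib_left mult.left_commute)
    finally show ?thesis using that(3) by simp
  qed
  have inj: "inj_on f (spectrum V ?H)"
    by (rule inj_onI) (metis f(2) orth zero_neq_one)
  have "orthonormal_in V (f ` spectrum V ?H)"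
    unfolding orthonormal_in_def using f(2) orth inj by (auto simp: inj_on_def)
  then have "finite (f ` spectrum V ?H)" using orthonormal_card_le(1)[OF V] by blast
  then show ?thesis using inj by (rule finite_imageD)
qed

text \<open>The measure is discrete and gives each eigenvalue its multiplicity divided by
  \<open>card V\<close>. The integral is a finite sum of nonnegative terms, of which the one at
  \<open>E\<close> already suffices.\<close>

lemma spectral_measure_integral_ge:
  fixes f :: "real \<Rightarrow> real"
  assumes V: "finite V" and sym: "\<And>u v. adj u v \<Longrightarrow> adj v u"
    and S: "orthonormal_in V S" "S \<subseteq> eigenspace V (laplacian V adj) E"
    and f: "f \<in> borel_measurable borel" "\<And>x. f x \<ge> 0"
  shows "f E * real (card S) / real (card V) \<le> (\<integral>x. f x \<partial>spectral_measure V adj)"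
proof -
  let ?H = "laplacian V adj"
  define \<Sigma> where "\<Sigma> = spectrum V ?H"
  have fin: "finite \<Sigma>" unfolding \<Sigma>_def by (rule finite_spectrum[OF V sym])
  have "\<exists>n. \<forall>F. (\<Sum>v\<in>V. orth_proj V (eigenspace V ?H F) (indicator {v}) v) = of_nat (n F)
      \<and> (F = E \<longrightarrow> card S \<le> n F)"
  proof (intro choice allI)
    fix F
    have "orthonormal_in V (if F = E then S else {})" "(if F = E then S else {}) \<subseteq> eigenspace V ?H F"
      using S by (auto simp: orthonormal_in_def)
    moreover have "eigenspace V ?H F \<subseteq> ell2 V" by (auto simp: eigenspace_def)
    ultimately obtain n where "card (if F = E then S else {}) \<le> n"
        "(\<Sum>v\<in>V. orth_proj V (eigenspace V ?H F) (indicator {v}) v) = of_nat n"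
      using trace_orth_proj[OF V lin_closed_eigenspace] by blast
    then show "\<exists>n. (\<Sum>v\<in>V. orth_proj V (eigenspace V ?H F) (indicator {v}) v) = of_nat n
        \<and> (F = E \<longrightarrow> card S \<le> n)" by auto
  qed
  then obtain n where n: "\<And>F. (\<Sum>v\<in>V. orth_proj V (eigenspace V ?H F) (indicator {v}) v) = of_nat (n F)"
    and nE: "card S \<le> n E" by auto
  define g where "g F = real (n F) / real (card V)" for F
  \<comment> \<open>The push-forward along the identity replaces the power set of \<Sigma> by the
    Borel sets of the line as the underlying sigma-algebra.\<close>
  define N where "N = distr (point_measure \<Sigma> (\<lambda>F. ennreal (g F))) borel (\<lambda>x. x)"
  have meas: "(\<lambda>x. x) \<in> measurable (point_measure \<Sigma> (\<lambda>F. ennreal (g F))) borel"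
    by (simp add: measurable_point_measure_eq1)
  have "spectral_measure V adj = measure_of UNIV (sets borel) (emeasure N)"
    unfolding spectral_measure_def
  proof (rule measure_of_eq)
    fix B :: "real set" assume "B \<in> sigma_sets UNIV (sets borel)"
    then have B: "B \<in> sets borel" by (metis sets.sigma_sets_eq space_borel)
    have "ell2_trace V (spectral_proj V ?H B)
        = (\<Sum>F\<in>\<Sigma> \<inter> B. \<Sum>v\<in>V. orth_proj V (eigenspace V ?H F) (indicator {v}) v)"
      unfolding ell2_trace_def spectral_proj_def \<Sigma>_def by (rule sum.swap)
    then have "Re (ell2_trace V (spectral_proj V ?H B)) / real (card V) = (\<Sum>F\<in>\<Sigma> \<inter> B. g F)"
      unfolding n g_def by (simp add: sum_divide_distrib)
    moreover have "emeasure N B = (\<Sum>F\<in>\<Sigma> \<inter> B. ennreal (g F))"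
      unfolding N_def using B meas fin
      by (simp add: emeasure_distr space_point_measure Int_commute emeasure_point_measure_finite)
    ultimately show "ennreal (Re (ell2_trace V (spectral_proj V ?H B)) / real (card V)) = emeasure N B"
      by (simp add: g_def)
  qed simp
  also have "\<dots> = N" using measure_of_of_measure[of N] by (simp add: N_def)
  finally have "(\<integral>x. f x \<partial>spectral_measure V adj) = (\<integral>x. f x \<partial>N)" by simp
  also have "\<dots> = (\<Sum>F\<in>\<Sigma>. g F * f F)"
    unfolding N_def using meas f(1) fin
    by (simp add: integral_distr lebesgue_integral_point_measure_finite g_def)
  finally have eq: "(\<integral>x. f x \<partial>spectral_measure V adj) = (\<Sum>F\<in>\<Sigma>. g F * f F)" .
  have nn: "g F * f F \<ge> 0" for F using f(2) by (simp add: g_def)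
  show ?thesis
  proof (cases "E \<in> \<Sigma>")
    case True
    have "f E * real (card S) / real (card V) \<le> g E * f E"
      using nE f(2)[of E] unfolding g_def by (simp add: divide_right_mono mult_left_mono mult.commute)
    also have "\<dots> \<le> (\<Sum>F\<in>\<Sigma>. g F * f F)" by (rule member_le_sum[OF True nn fin])
    finally show ?thesis using eq by simp
  next
    case False
    \<comment> \<open>Members of an orthonormal system are nonzero, so any of them would make
      \<open>E\<close> an eigenvalue.\<close>
    have "S = {}"
    proof (rule ccontr)
      assume "S \<noteq> {}"
      then obtain \<phi> where \<phi>: "\<phi> \<in> S" by blast
      then have "ell2_inner V \<phi> \<phi> = 1" using S(1) by (simp add: orthonormal_in_def)
      then have "\<exists>v. \<phi> v \<noteq> 0" by (rule contrapos_pp) (simp add: ell2_inner_def)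
      then show False using False S(2) \<phi> by (auto simp: \<Sigma>_def spectrum_def)
    qed
    then show ?thesis using eq nn by (simp add: sum_nonneg)
  qed
qed

section \<open>Parallelograms and their edges\<close>

text \<open>The determinant of the pair \<open>b\<close>, \<open>c\<close>, a signed area. Its sign
  tells on which side of \<open>b\<close> the vector \<open>c\<close> lies.\<close>

definition cross2 :: "complex \<Rightarrow> complex \<Rightarrow> real" where
  "cross2 b c = Im (cnj b * c)"

text \<open>Rhombi and squares are treated alike through a corner and two edge vectors. One set has
  several such descriptions, and the later arguments choose the one that starts with a given
  edge.\<close>

definition pgram :: "complex \<Rightarrow> complex \<Rightarrow> complex \<Rightarrow> complex set" where
  "pgram a b c = {a + x *\<^sub>R b + y *\<^sub>R c | x y. 0 \<le> x \<and> x \<le> 1 \<and> 0 \<le> y \<and> y \<le> 1}"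

lemma cross2_simps [simp]:
  "cross2 (a + b) c = cross2 a c + cross2 b c" "cross2 c (a + b) = cross2 c a + cross2 c b"
  "cross2 (a - b) c = cross2 a c - cross2 b c" "cross2 c (a - b) = cross2 c a - cross2 c b"
  "cross2 (- a) c = - cross2 a c" "cross2 c (- a) = - cross2 c a"
  "cross2 (x *\<^sub>R a) c = x * cross2 a c" "cross2 c (x *\<^sub>R a) = x * cross2 c a"
  "cross2 a a = 0" "cross2 0 a = 0" "cross2 a 0 = 0"
  by (simp_all add: cross2_def algebra_simps)

lemma cross2_commute: "cross2 b a = - cross2 a b"
  by (simp add: cross2_def algebra_simps)

lemma abs_cross2_le: "\<bar>cross2 a b\<bar> \<le> cmod a * cmod b"
  using abs_Im_le_cmod[of "cnj a * b"] by (simp add: cross2_def norm_mult)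

text \<open>Cramer's rule.\<close>

lemma cross2_coords:
  assumes "cross2 b c \<noteq> 0"
  shows "z = (cross2 z c / cross2 b c) *\<^sub>R b + (cross2 b z / cross2 b c) *\<^sub>R c"
proof -
  have "cross2 b c *\<^sub>R z = cross2 z c *\<^sub>R b + cross2 b z *\<^sub>R c"
    by (simp add: cross2_def complex_eq_iff algebra_simps)
  then have "(1 / cross2 b c) *\<^sub>R (cross2 b c *\<^sub>R z)
      = (1 / cross2 b c) *\<^sub>R (cross2 z c *\<^sub>R b + cross2 b z *\<^sub>R c)" by simp
  then show ?thesis using assms by (simp add: scaleR_add_right)
qed

lemma pgram_cross2:
  assumes "cross2 b c \<noteq> 0"
  shows "pgram a b c = {z. cross2 (z - a) c / cross2 b c \<in> {0..1} \<and> cross2 b (z - a) / cross2 b c \<in> {0..1}}"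
proof -
  have "z \<in> pgram a b c" if "cross2 (z - a) c / cross2 b c \<in> {0..1}" "cross2 b (z - a) / cross2 b c \<in> {0..1}" for z
  proof -
    have "z = a + (cross2 (z - a) c / cross2 b c) *\<^sub>R b + (cross2 b (z - a) / cross2 b c) *\<^sub>R c"
      using cross2_coords[OF assms, of "z - a"] by (simp add: algebra_simps)
    then show ?thesis unfolding pgram_def using that by (metis (mono_tags, lifting) atLeastAtMost_iff mem_Collect_eq)
  qed
  moreover have "cross2 (z - a) c / cross2 b c \<in> {0..1} \<and> cross2 b (z - a) / cross2 b c \<in> {0..1}"
    if z: "z \<in> pgram a b c" for z
    using z assms unfolding pgram_def by (auto simp: algebra_simps)
  ultimately show ?thesis by blast
qed

text \<open>Besides the link to \<open>region\<close>, this reduces a change of corner or of the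
  order of the edge vectors to a permutation of four vertices.\<close>

lemma pgram_hull: "pgram a b c = convex hull {a, a + b, a + b + c, a + c}" (is "_ = ?H")
proof
  show "?H \<subseteq> pgram a b c"
  proof (rule hull_minimal)
    have "\<exists>x y. a = a + x *\<^sub>R b + y *\<^sub>R c \<and> 0 \<le> x \<and> x \<le> 1 \<and> 0 \<le> y \<and> y \<le> 1"
      by (rule exI[of _ 0], rule exI[of _ 0]) simp
    moreover have "\<exists>x y. a + b = a + x *\<^sub>R b + y *\<^sub>R c \<and> 0 \<le> x \<and> x \<le> 1 \<and> 0 \<le> y \<and> y \<le> 1"
      by (rule exI[of _ 1], rule exI[of _ 0]) simp
    moreover have "\<exists>x y. a + c = a + x *\<^sub>R b + y *\<^sub>R c \<and> 0 \<le> x \<and> x \<le> 1 \<and> 0 \<le> y \<and> y \<le> 1"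
      by (rule exI[of _ 0], rule exI[of _ 1]) simp
    moreover have "\<exists>x y. a + b + c = a + x *\<^sub>R b + y *\<^sub>R c \<and> 0 \<le> x \<and> x \<le> 1 \<and> 0 \<le> y \<and> y \<le> 1"
      by (rule exI[of _ 1], rule exI[of _ 1]) simp
    ultimately show "{a, a + b, a + b + c, a + c} \<subseteq> pgram a b c"
      unfolding pgram_def by blast
    show "convex (pgram a b c)"
    proof (rule convexI)
      fix p q and u v :: real
      assume p: "p \<in> pgram a b c" and q: "q \<in> pgram a b c" and uv: "0 \<le> u" "0 \<le> v" "u + v = 1"
      obtain x y where p': "p = a + x *\<^sub>R b + y *\<^sub>R c" "0 \<le> x" "x \<le> 1" "0 \<le> y" "y \<le> 1"
        using p unfolding pgram_def by blast
      obtain x' y' where q': "q = a + x' *\<^sub>R b + y' *\<^sub>R c" "0 \<le> x'" "x' \<le> 1" "0 \<le> y'" "y' \<le> 1"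
        using q unfolding pgram_def by blast
      have "u *\<^sub>R p + v *\<^sub>R q = (u + v) *\<^sub>R a + (u * x + v * x') *\<^sub>R b + (u * y + v * y') *\<^sub>R c"
        unfolding p' q' by (simp add: algebra_simps)
      then have "u *\<^sub>R p + v *\<^sub>R q = a + (u * x + v * x') *\<^sub>R b + (u * y + v * y') *\<^sub>R c"
        using uv by simp
      moreover have "u * x + v * x' \<le> 1" "u * y + v * y' \<le> 1"
        using uv p' q' by (auto intro: convex_bound_le)
      ultimately show "u *\<^sub>R p + v *\<^sub>R q \<in> pgram a b c"
        unfolding pgram_def using uv p' q'
        by (intro CollectI exI[of _ "u * x + v * x'"] exI[of _ "u * y + v * y'"]) simp
    qed
  qed
  show "pgram a b c \<subseteq> ?H"
  proof
    fix z assume "z \<in> pgram a b c"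
    then obtain x y where z: "z = a + x *\<^sub>R b + y *\<^sub>R c" "0 \<le> x" "x \<le> 1" "0 \<le> y" "y \<le> 1"
      unfolding pgram_def by blast
    have cv: "convex ?H" by (rule convex_convex_hull)
    have in_H: "a \<in> ?H" "a + b \<in> ?H" "a + b + c \<in> ?H" "a + c \<in> ?H"
      by (simp_all add: hull_inc)
    have 1: "(1 - x) *\<^sub>R a + x *\<^sub>R (a + b) \<in> ?H" using cv in_H z by (intro convexD) auto
    have 2: "(1 - x) *\<^sub>R (a + c) + x *\<^sub>R (a + b + c) \<in> ?H" using cv in_H z by (intro convexD) auto
    have "(1 - y) *\<^sub>R ((1 - x) *\<^sub>R a + x *\<^sub>R (a + b)) + y *\<^sub>R ((1 - x) *\<^sub>R (a + c) + x *\<^sub>R (a + b + c)) \<in> ?H"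
      using z by (intro convexD[OF cv 1 2]) auto
    also have "(1 - y) *\<^sub>R ((1 - x) *\<^sub>R a + x *\<^sub>R (a + b)) + y *\<^sub>R ((1 - x) *\<^sub>R (a + c) + x *\<^sub>R (a + b + c)) = z"
      unfolding z by (simp add: algebra_simps)
    finally show "z \<in> ?H" .
  qed
qed

lemma pgram_swap: "pgram a b c = pgram a c b"
  unfolding pgram_hull by (simp add: insert_commute add_ac)

lemma pgram_rebase: "pgram a b c = pgram (a + b) (- b) c"
  unfolding pgram_hull by (simp add: insert_commute add_ac)

lemma open_pgram_subset_interior:
  assumes "cross2 b c \<noteq> 0" "0 < x" "x < 1" "0 < y" "y < 1"
  shows "a + x *\<^sub>R b + y *\<^sub>R c \<in> interior (pgram a b c)"
proof (rule interiorI)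
  let ?U = "{z. 0 < cross2 (z - a) c / cross2 b c \<and> cross2 (z - a) c / cross2 b c < 1 \<and>
      0 < cross2 b (z - a) / cross2 b c \<and> cross2 b (z - a) / cross2 b c < 1}"
  show "open ?U"
    unfolding cross2_def
    by (intro open_Collect_conj open_Collect_less continuous_intros) (use assms(1) in \<open>auto simp: cross2_def\<close>)
  show "?U \<subseteq> pgram a b c" unfolding pgram_cross2[OF assms(1)] by auto
  show "a + x *\<^sub>R b + y *\<^sub>R c \<in> ?U" using assms by (simp add: algebra_simps)
qed

text \<open>Since \<open>c\<close> lies on the same side of \<open>d\<close> as \<open>b\<close>, it
  has a positive \<open>b\<close>-coordinate. Moving the midpoint of the common edge slightly along
  \<open>c\<close> therefore leads into both interiors.\<close>

lemma pgram_same_side_overlap: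
  assumes "cross2 d b * cross2 d c > 0"
  shows "interior (pgram p d b) \<inter> interior (pgram p d c) \<noteq> {}"
proof -
  have b: "cross2 d b \<noteq> 0" and c: "cross2 d c \<noteq> 0" using assms by auto
  define \<alpha> where "\<alpha> = cross2 c b / cross2 d b"
  define \<beta> where "\<beta> = cross2 d c / cross2 d b"
  have c_eq: "c = \<alpha> *\<^sub>R d + \<beta> *\<^sub>R b" unfolding \<alpha>_def \<beta>_def by (rule cross2_coords[OF b])
  have \<beta>: "\<beta> > 0" unfolding \<beta>_def using assms by (metis zero_less_divide_iff zero_less_mult_iff)
  \<comment> \<open>Chosen so that t, t|\<alpha>| and t\<beta> add up to 1/2. Both coordinates of
    the moved midpoint then stay strictly between 0 and 1 in either basis.\<close>
  define t where "t = 1 / (2 * (1 + \<bar>\<alpha>\<bar> + \<beta>))"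
  have pos: "1 + \<bar>\<alpha>\<bar> + \<beta> > 0" using \<beta> by linarith
  have t: "0 < t" unfolding t_def using pos by simp
  have tsum: "t + t * \<bar>\<alpha>\<bar> + t * \<beta> = 1/2"
  proof -
    have "t + t * \<bar>\<alpha>\<bar> + t * \<beta> = t * (1 + \<bar>\<alpha>\<bar> + \<beta>)" by (simp add: distrib_left)
    also have "\<dots> = 1/2" unfolding t_def using pos by simp
    finally show ?thesis .
  qed
  have "0 \<le> t * \<bar>\<alpha>\<bar>" "0 < t * \<beta>" using t \<beta> by simp_all
  moreover have "\<bar>t * \<alpha>\<bar> = t * \<bar>\<alpha>\<bar>" using t by (simp add: abs_mult)
  ultimately have bounds: "t < 1" "\<bar>t * \<alpha>\<bar> < 1/2" "t * \<beta> < 1" "0 < t * \<beta>" using tsum t by linarith+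
  have "p + (1/2) *\<^sub>R d + t *\<^sub>R c \<in> interior (pgram p d c)"
    by (rule open_pgram_subset_interior[OF c]) (use t bounds in auto)
  moreover have "p + (1/2) *\<^sub>R d + t *\<^sub>R c = p + (1/2 + t * \<alpha>) *\<^sub>R d + (t * \<beta>) *\<^sub>R b"
    by (subst c_eq) (simp add: algebra_simps)
  moreover have "p + (1/2 + t * \<alpha>) *\<^sub>R d + (t * \<beta>) *\<^sub>R b \<in> interior (pgram p d b)"
    by (rule open_pgram_subset_interior[OF b]) (use bounds in linarith)+
  ultimately show ?thesis by auto
qed

section \<open>Edges of parallelograms as one-dimensional faces\<close>

lemma closed_segment_edge_of_pgram:
  assumes "cross2 b c \<noteq> 0"
  shows "closed_segment a (a + b) edge_of pgram a b c"
  unfolding edge_of_def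
proof
  have seg: "closed_segment a (a + b) = pgram a b c \<inter> {z. cross2 b z / cross2 b c = cross2 b a / cross2 b c}"
  proof (intro set_eqI iffI)
    fix z assume "z \<in> closed_segment a (a + b)"
    then obtain x where z: "z = a + x *\<^sub>R b" "0 \<le> x" "x \<le> 1"
      by (auto simp: closed_segment_def algebra_simps)
    then show "z \<in> pgram a b c \<inter> {z. cross2 b z / cross2 b c = cross2 b a / cross2 b c}"
      unfolding pgram_cross2[OF assms] using assms by (simp add: algebra_simps)
  next
    fix z assume *: "z \<in> pgram a b c \<inter> {z. cross2 b z / cross2 b c = cross2 b a / cross2 b c}"
    then have z0: "cross2 b z = cross2 b a" using assms by simp
    obtain x y where z: "z = a + x *\<^sub>R b + y *\<^sub>R c" "0 \<le> x" "x \<le> 1"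
      using * unfolding pgram_def by blast
    with z0 have "y = 0" using assms by simp
    then have "z = (1 - x) *\<^sub>R a + x *\<^sub>R (a + b)" using z by (simp add: algebra_simps)
    then show "z \<in> closed_segment a (a + b)" using z by (auto simp: closed_segment_def)
  qed
  \<comment> \<open>The vector \<open>b\<close> turned by a right angle. Division by the signed area
    makes this normal point into the parallelogram for either orientation.\<close>
  define n where "n = (1 / cross2 b c) *\<^sub>R (\<i> * b)"
  have n: "n \<bullet> z = cross2 b z / cross2 b c" for z
    by (simp add: n_def inner_complex_def cross2_def algebra_simps diff_divide_distrib)
  have "(pgram a b c \<inter> {z. n \<bullet> z = cross2 b a / cross2 b c}) face_of pgram a b c"
  proof (rule face_of_Int_supporting_hyperplane_ge)
    show "convex (pgram a b c)" unfolding pgram_hull by (rule convex_convex_hull)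
    fix z assume "z \<in> pgram a b c"
    then show "n \<bullet> z \<ge> cross2 b a / cross2 b c"
      unfolding pgram_cross2[OF assms] n by (simp add: diff_divide_distrib)
  qed
  then show "closed_segment a (a + b) face_of pgram a b c" unfolding seg n .
  have "b \<noteq> 0" using assms by auto
  then show "aff_dim (closed_segment a (a + b)) = 1"
    by (simp add: segment_convex_hull aff_dim_convex_hull)
qed

lemma subset_quad_no_diagonal:
  assumes "S \<subseteq> {p, q, r, s}" "\<not> (p \<in> S \<and> r \<in> S)" "\<not> (q \<in> S \<and> s \<in> S)"
    and ne: "S \<noteq> {}" "\<And>x. S \<noteq> {x}"
  shows "S = {p, q} \<or> S = {p, s} \<or> S = {q, r} \<or> S = {s, r}"
proof -
  have "\<exists>x y. x \<in> {p, r} \<and> y \<in> {q, s} \<and> S \<subseteq> {x, y}"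
    using assms(1-3) by (cases "p \<in> S"; cases "q \<in> S") blast+
  then obtain x y where xy: "x \<in> {p, r}" "y \<in> {q, s}" "S \<subseteq> {x, y}" by blast
  then have "S = {x, y}" using ne by blast
  then show ?thesis using xy(1,2) by blast
qed

text \<open>A face is spanned by some of the vertices. If it contained both ends of a diagonal it
  would contain the centre, which is also inside the other diagonal, hence all four vertices; then
  it would be two-dimensional.\<close>

lemma edge_of_pgram_cases:
  assumes nz: "cross2 b c \<noteq> 0" and e: "e edge_of pgram a b c"
  shows "e \<in> {closed_segment a (a + b), closed_segment a (a + c),
     closed_segment (a + b) (a + b + c), closed_segment (a + c) (a + b + c)}"
proof -
  let ?S = "{a, a + b, a + b + c, a + c}"
  have face: "e face_of pgram a b c" and dim: "aff_dim e = 1"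
    using e by (auto simp: edge_of_def)
  have "e face_of convex hull ?S" using face by (simp add: pgram_hull)
  moreover have "compact ?S" by (simp add: finite_imp_compact)
  ultimately obtain S where S: "S \<subseteq> ?S" "e = convex hull S" using face_of_convex_hull_subset by metis
  have not_all: "\<not> ?S \<subseteq> e"
  proof
    assume "?S \<subseteq> e"
    then have "pgram a b c \<subseteq> e"
      unfolding pgram_hull by (rule hull_minimal) (use S in simp)
    then have "e = pgram a b c" using face face_of_imp_subset by blast
    moreover have "interior (pgram a b c) \<noteq> {}"
      using open_pgram_subset_interior[OF nz, of "1/2" "1/2" a] by auto
    ultimately show False using dim aff_dim_nonempty_interior by fastforce
  qed
  have in_P: "?S \<subseteq> pgram a b c" unfolding pgram_hull by (rule hull_subset)
  have bc: "b \<noteq> c" "b \<noteq> - c" using nz by auto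
  have mid: "midpoint a (a + b + c) = midpoint (a + b) (a + c)"
    by (simp add: midpoint_def algebra_simps)
  have conv: "convex e" using S by simp
  have diag: "\<not> (p \<in> e \<and> q \<in> e)"
    if pq: "(p, q, r, s) \<in> {(a, a + b + c, a + b, a + c), (a + b, a + c, a, a + b + c)}" for p q r s
  proof
    assume pqe: "p \<in> e \<and> q \<in> e"
    have m: "midpoint p q = midpoint r s" using pq mid by auto
    have "midpoint p q \<in> closed_segment p q" by simp
    then have "midpoint p q \<in> e" using pqe conv closed_segment_subset by blast
    moreover have "midpoint r s \<in> open_segment r s"
    proof -
      have "r \<noteq> s" using pq bc
        by (auto simp: add_eq_0_iff2 add.assoc[symmetric])
      then show ?thesis by simp
    qed
    moreover have "r \<in> pgram a b c" "s \<in> pgram a b c" using pq in_P by auto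
    ultimately have "r \<in> e \<and> s \<in> e" using face m unfolding face_of_def by metis
    then show False using pqe pq not_all by auto
  qed
  have d1: "\<not> (a \<in> S \<and> a + b + c \<in> S)" and d2: "\<not> (a + b \<in> S \<and> a + c \<in> S)"
    using diag[of a "a + b + c" "a + b" "a + c"] diag[of "a + b" "a + c" a "a + b + c"]
      hull_inc[of _ S convex] unfolding S(2) by auto
  have "S \<noteq> {}" using dim S(2) by auto
  moreover have "S \<noteq> {x}" for x using dim S(2) by auto
  ultimately have "S = {a, a + b} \<or> S = {a, a + c} \<or> S = {a + b, a + b + c} \<or> S = {a + c, a + b + c}"
    using subset_quad_no_diagonal[OF S(1) d1 d2] by blast
  then show ?thesis using S(2) by (auto simp: segment_convex_hull)
qed

lemma closed_segment_eqD:
  fixes p q r s :: complex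
  assumes "closed_segment p q = closed_segment r s"
  shows "p = r \<and> q = s \<or> p = s \<and> q = r"
proof -
  have "x = p \<or> x = q \<longleftrightarrow> x = r \<or> x = s" for x
    using assms extreme_point_of_segment by metis
  then show ?thesis by metis
qed

text \<open>With the edge as first side, the sign of \<open>cross2 d c'\<close> tells on which side
  of it the parallelogram lies. A segment does not know its direction, so both matchings of the end
  points have to be treated.\<close>

lemma edge_of_pgram_rebase:
  assumes nz: "cross2 b c \<noteq> 0" and e: "closed_segment p (p + d) edge_of pgram a b c"
  obtains c' where "pgram a b c = pgram p d c'" "cross2 d c' \<noteq> 0"
proof -
  have "\<exists>c'. pgram a b c = pgram r (s - r) c' \<and> cross2 (s - r) c' \<noteq> 0"
    if "(r, s) \<in> {(a, a + b), (a, a + c), (a + b, a + b + c), (a + c, a + b + c)}" for r s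
  proof -
    have 1: "pgram a b c = pgram (a + b) c (- b)" using pgram_rebase pgram_swap by metis
    have 2: "pgram a b c = pgram (a + c) b (- c)" using pgram_rebase pgram_swap by metis
    from that consider "r = a \<and> s = a + b" | "r = a \<and> s = a + c"
      | "r = a + b \<and> s = a + b + c" | "r = a + c \<and> s = a + b + c" by auto
    then show ?thesis
    proof cases
      case 1 then show ?thesis using nz by auto
    next
      case 2 then show ?thesis using nz pgram_swap[of a b c] cross2_commute[of c b]
        by (intro exI[of _ b]) simp
    next
      case 3 then show ?thesis using nz 1 cross2_commute[of c b]
        by (intro exI[of _ "- b"]) simp
    next
      case 4 then show ?thesis using nz 2
        by (intro exI[of _ "- c"]) (simp add: algebra_simps)
    qed
  qed
  moreover obtain r s where rs: "(r, s) \<in> {(a, a + b), (a, a + c), (a + b, a + b + c), (a + c, a + b + c)}"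
    and seg: "closed_segment p (p + d) = closed_segment r s"
    using edge_of_pgram_cases[OF nz e] by auto
  ultimately obtain c' where c': "pgram a b c = pgram r (s - r) c'" "cross2 (s - r) c' \<noteq> 0" by blast
  from closed_segment_eqD[OF seg] show ?thesis
  proof
    assume "p = r \<and> p + d = s"
    then show ?thesis using c' that[of c'] by auto
  next
    assume *: "p = s \<and> p + d = r"
    then have d: "s - r = - d" by (auto simp: algebra_simps)
    have "pgram r (s - r) c' = pgram (r + (s - r)) (- (s - r)) c'" by (rule pgram_rebase)
    also have "r + (s - r) = p" using * by simp
    also have "- (s - r) = d" using d by simp
    finally show ?thesis using c' that[of c'] d by simp
  qed
qed

text \<open>As \<open>c\<^sub>1\<close> and \<open>c\<^sub>2\<close> point to opposite sides of the
  edge, the third parallelogram lies on the side of one of them. In a tiling this leaves room for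
  only two tiles along an edge.\<close>

lemma edge_of_third_pgram:
  assumes nz: "cross2 b c \<noteq> 0" and e: "closed_segment p (p + d) edge_of pgram a b c"
    and sides: "cross2 d c\<^sub>1 * cross2 d c\<^sub>2 < 0"
  shows "interior (pgram a b c) \<inter> interior (pgram p d c\<^sub>1) \<noteq> {} \<or>
    interior (pgram a b c) \<inter> interior (pgram p d c\<^sub>2) \<noteq> {}"
proof -
  obtain c' where c': "pgram a b c = pgram p d c'" "cross2 d c' \<noteq> 0"
    using edge_of_pgram_rebase[OF nz e] .
  have "cross2 d c' * cross2 d c\<^sub>1 > 0 \<or> cross2 d c' * cross2 d c\<^sub>2 > 0"
    using sides c'(2) by (auto simp: mult_less_0_iff zero_less_mult_iff)
  then show ?thesis unfolding c'(1) using pgram_same_side_overlap by blast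
qed

section \<open>The substitution\<close>

text \<open>In these affine coordinates tiles of one kind have the same pieces in every position and
  in both orientations.\<close>

definition place :: "complex \<Rightarrow> complex \<Rightarrow> complex \<Rightarrow> real \<times> real \<Rightarrow> complex" where
  "place p b c = (\<lambda>(x, y). p + x *\<^sub>R b + y *\<^sub>R c)"

text \<open>The pieces of an enlarged tile, in affine coordinates: the origin is the first vertex, and
  the basis consists of the two edge vectors of the original tile.\<close>

definition rhombus_pieces :: "(real \<times> real) tile set" where
  "rhombus_pieces =
    {Rhombus (0, 0) (1, 0) (1, 1) (0, 1),
     Rhombus (1 + sqrt 2, 1 + sqrt 2) (sqrt 2, 1 + sqrt 2) (sqrt 2, sqrt 2) (1 + sqrt 2, sqrt 2),
     Rhombus (1 + sqrt 2, 0) (1, 1) (0, 1 + sqrt 2) (sqrt 2, sqrt 2),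
     Half_Square (1 + sqrt 2, 0) (1, 1) (1, 0),
     Half_Square (0, 1 + sqrt 2) (1, 1) (0, 1),
     Half_Square (1 + sqrt 2, 0) (sqrt 2, sqrt 2) (1 + sqrt 2, sqrt 2),
     Half_Square (0, 1 + sqrt 2) (sqrt 2, sqrt 2) (sqrt 2, 1 + sqrt 2)}"

definition half_square_pieces :: "(real \<times> real) tile set" where
  "half_square_pieces =
    {Rhombus (0, 0) (1, 0) (1 + sqrt 2 / 2, sqrt 2 / 2) (sqrt 2 / 2, sqrt 2 / 2),
     Rhombus (1 + sqrt 2, 0) (1 + sqrt 2, 1) (1 + sqrt 2 / 2, 1 + sqrt 2 / 2) (1 + sqrt 2 / 2, sqrt 2 / 2),
     Half_Square (1 + sqrt 2 / 2, 1 + sqrt 2 / 2) (1 + sqrt 2 / 2, sqrt 2 / 2) (sqrt 2 / 2, sqrt 2 / 2),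
     Half_Square (1 + sqrt 2, 0) (1 + sqrt 2 / 2, sqrt 2 / 2) (1, 0),
     Half_Square (1 + sqrt 2, 1 + sqrt 2) (1 + sqrt 2 / 2, 1 + sqrt 2 / 2) (1 + sqrt 2, 1)}"

definition inflate :: "complex tile \<Rightarrow> complex tile set" where
  "inflate t = map_tile (\<lambda>z. silver *\<^sub>R z) ` dissect t"

lemma silver_pos: "silver > 0"
  unfolding silver_def by (smt (verit) real_sqrt_ge_zero)

lemma silver_less_3: "silver < 3"
  unfolding silver_def using real_less_lsqrt[of 2 2] by simp

lemma scale_silver: "silver *\<^sub>R (z /\<^sub>R silver) = z" for z :: complex
  using silver_pos by simp

lemma sqrt2_bounds: "1 < sqrt 2" "sqrt 2 < 2" "sqrt 2 * sqrt 2 = 2"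
  using real_less_lsqrt[of 2 2] by simp_all

lemma inflate_rhombus:
  "inflate (Rhombus A (A + b) (A + b + c) (A + c)) = map_tile (place (silver *\<^sub>R A) b c) ` rhombus_pieces"
  unfolding inflate_def rhombus_pieces_def place_def
  by (simp only: dissect.simps Let_def image_insert image_empty tile.map add_diff_cancel_left'
        scaleR_add_right scaleR_diff_right scale_silver)
    (simp add: silver_def algebra_simps)

lemma inflate_half_square:
  "inflate (Half_Square V (V + b) (V + b + c)) = map_tile (place (silver *\<^sub>R V) b c) ` half_square_pieces"
proof -
  have "inverse (sqrt 2) = sqrt 2 / 2" using sqrt2_bounds by (simp add: field_simps)
  moreover have "silver *\<^sub>R ((z /\<^sub>R silver) /\<^sub>R sqrt 2) = (silver *\<^sub>R (z /\<^sub>R silver)) /\<^sub>R sqrt 2" for z :: complex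
    by (rule scaleR_left_commute)
  ultimately have r: "silver *\<^sub>R ((z /\<^sub>R silver) /\<^sub>R sqrt 2) = (sqrt 2 / 2) *\<^sub>R z" for z :: complex
    by (simp only: scale_silver)
  show ?thesis
    unfolding inflate_def half_square_pieces_def place_def
    by (simp only: dissect.simps Let_def image_insert image_empty tile.map add_diff_cancel_left'
          scaleR_add_right scale_silver r)
      (simp add: silver_def algebra_simps)
qed

lemma prototile_cases:
  assumes "prototile t"
  obtains (rhombus) A b c where "t = Rhombus A (A + b) (A + b + c) (A + c)"
      "b \<bullet> b = 1" "c \<bullet> c = 1" "b \<bullet> c = sqrt 2 / 2"
  | (half_square) V b c where "t = Half_Square V (V + b) (V + b + c)"
      "b \<bullet> b = 1" "c \<bullet> c = 1" "b \<bullet> c = 0"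
proof (cases t)
  case (Rhombus A B C D)
  then have *: "C - B = D - A" "dist A B = 1" "dist A D = 1" "(B - A) \<bullet> (D - A) = cos (pi / 4)"
    using assms by auto
  show thesis
  proof (rule rhombus[of A "B - A" "D - A"])
    show "t = Rhombus A (A + (B - A)) (A + (B - A) + (D - A)) (A + (D - A))"
      using Rhombus *(1) by (simp add: algebra_simps)
    show "(B - A) \<bullet> (B - A) = 1" "(D - A) \<bullet> (D - A) = 1" "(B - A) \<bullet> (D - A) = sqrt 2 / 2"
      using * by (simp_all add: dist_norm norm_minus_commute dot_square_norm cos_45)
  qed
next
  case (Half_Square V S W)
  then have *: "dist V S = 1" "dist S W = 1" "(V - S) \<bullet> (W - S) = 0"
    using assms by auto
  show thesis
  proof (rule half_square[of V "S - V" "W - S"])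
    show "t = Half_Square V (V + (S - V)) (V + (S - V) + (W - S))"
      using Half_Square by (simp add: algebra_simps)
    show "(S - V) \<bullet> (S - V) = 1" "(W - S) \<bullet> (W - S) = 1" "(S - V) \<bullet> (W - S) = 0"
      using * by (simp_all add: dist_norm norm_minus_commute dot_square_norm inner_diff_left)
  qed
qed

text \<open>Lagrange's identity: the Gram determinant is the squared area.\<close>

lemma cross2_squared: "(cross2 b c)\<^sup>2 = (b \<bullet> b) * (c \<bullet> c) - (b \<bullet> c)\<^sup>2"
  by (simp add: cross2_def inner_complex_def power2_eq_square algebra_simps)

text \<open>The squared area is 1/2 for a rhombus and 1 for the parallelogram spanned by the legs of
  a half-square; 1/2 is a convenient rational bound for both areas.\<close>

lemma cross2_prototile:
  assumes "b \<bullet> b = 1" "c \<bullet> c = 1" "b \<bullet> c = sqrt 2 / 2 \<or> b \<bullet> c = 0"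
  shows "\<bar>cross2 b c\<bar> \<ge> 1/2"
proof -
  have "(cross2 b c)\<^sup>2 \<ge> (1/2)\<^sup>2"
    using assms(3) unfolding cross2_squared assms(1,2) by (elim disjE; simp only:) (simp_all add: power_divide)
  then show ?thesis using abs_le_square_iff[of "1/2" "cross2 b c"] by simp
qed

text \<open>A separating line in affine coordinates, so that one check serves all positions of the
  tile. Testing vertices is enough because half-planes are convex.\<close>

definition separated :: "(real \<times> real) tile \<Rightarrow> (real \<times> real) tile \<Rightarrow> bool" where
  "separated t t' \<longleftrightarrow> (\<exists>\<alpha> \<beta> \<gamma>. (\<alpha>, \<beta>) \<noteq> (0, 0) \<and>
     (\<forall>(x, y)\<in>set_tile t. \<alpha> * x + \<beta> * y \<le> \<gamma>) \<and> (\<forall>(x, y)\<in>set_tile t'. \<gamma> \<le> \<alpha> * x + \<beta> * y))"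

lemma separatedI:
  assumes "(\<alpha>, \<beta>) \<noteq> (0, 0)" "\<forall>(x, y)\<in>set_tile t. \<alpha> * x + \<beta> * y \<le> \<gamma>"
    "\<forall>(x, y)\<in>set_tile t'. \<gamma> \<le> \<alpha> * x + \<beta> * y"
  shows "separated t t'"
  unfolding separated_def using assms by blast

lemma separated_sym:
  assumes "separated t t'" shows "separated t' t"
proof -
  obtain \<alpha> \<beta> \<gamma> where "(\<alpha>, \<beta>) \<noteq> (0, 0)" "\<forall>(x, y)\<in>set_tile t. \<alpha> * x + \<beta> * y \<le> \<gamma>"
    "\<forall>(x, y)\<in>set_tile t'. \<gamma> \<le> \<alpha> * x + \<beta> * y"
    using assms unfolding separated_def by blast
  then show ?thesis by (intro separatedI[of "- \<alpha>" "- \<beta>" _ "- \<gamma>"]) auto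
qed

lemma pairwise_separated_insert:
  assumes "\<forall>t'\<in>K. separated t t'" "pairwise separated K"
  shows "pairwise separated (insert t K)"
  using assms by (auto simp: pairwise_insert intro: separated_sym)

lemma region_map_tile:
  "region (map_tile f t) = convex hull (f ` set_tile t)"
  by (simp add: region_def tile.set_map)

lemma separated_interior:
  assumes nz: "cross2 b c \<noteq> 0" and sep: "separated t t'"
  shows "interior (region (map_tile (place p b c) t)) \<inter> interior (region (map_tile (place p b c) t')) = {}"
proof -
  obtain \<alpha> \<beta> \<gamma> where abg: "(\<alpha>, \<beta>) \<noteq> (0, 0)" "\<forall>(x, y)\<in>set_tile t. \<alpha> * x + \<beta> * y \<le> \<gamma>"
    "\<forall>(x, y)\<in>set_tile t'. \<gamma> \<le> \<alpha> * x + \<beta> * y"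
    using sep unfolding separated_def by blast
  \<comment> \<open>The vector whose inner products with \<open>b\<close> and \<open>c\<close> are
    \<alpha> and \<beta>; it turns the functional on coordinates into one on the plane.\<close>
  define n where "n = (\<beta> / cross2 b c) *\<^sub>R (\<i> * b) - (\<alpha> / cross2 b c) *\<^sub>R (\<i> * c)"
  have n: "n \<bullet> z = (\<alpha> * cross2 z c + \<beta> * cross2 b z) / cross2 b c" for z
    by (simp add: n_def inner_complex_def cross2_def algebra_simps add_divide_distrib diff_divide_distrib)
  have "n \<bullet> b = \<alpha>" "n \<bullet> c = \<beta>" unfolding n using nz by simp_all
  then have place: "n \<bullet> place p b c xy = n \<bullet> p + (\<alpha> * fst xy + \<beta> * snd xy)" for xy
    by (simp add: place_def case_prod_beta inner_add_right algebra_simps)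
  have "n \<noteq> 0" using abg(1) \<open>n \<bullet> b = \<alpha>\<close> \<open>n \<bullet> c = \<beta>\<close> by auto
  define g where "g = n \<bullet> p + \<gamma>"
  have "region (map_tile (place p b c) t) \<subseteq> {z. n \<bullet> z \<le> g}"
    unfolding region_map_tile
    by (rule hull_minimal) (use abg place in \<open>auto simp: g_def convex_halfspace_le\<close>)
  then have 1: "interior (region (map_tile (place p b c) t)) \<subseteq> {z. n \<bullet> z < g}"
    using interior_mono interior_halfspace_le[OF \<open>n \<noteq> 0\<close>] by metis
  have "region (map_tile (place p b c) t') \<subseteq> {z. n \<bullet> z \<ge> g}"
    unfolding region_map_tile
    by (rule hull_minimal) (use abg place in \<open>auto simp: g_def convex_halfspace_ge\<close>)
  then have 2: "interior (region (map_tile (place p b c) t')) \<subseteq> {z. n \<bullet> z > g}"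
    using interior_mono interior_halfspace_ge[OF \<open>n \<noteq> 0\<close>] by metis
  show ?thesis using 1 2 by force
qed

text \<open>Writing sqrt 2 as \<open>h + h\<close> turns the computations with coordinates into
  polynomial arithmetic in one variable, with rational bounds and a rule for its square.\<close>

lemma half_sqrt2:
  obtains h :: real where "sqrt 2 = h + h" "1/2 < h" "h < 1" "h * h = 1/2"
  by (rule that[of "sqrt 2 / 2"]) (use sqrt2_bounds in auto)

text \<open>Every separating line, here and for the half-square, carries an edge of one of the two
  pieces.\<close>

lemma rhombus_pieces_separated: "pairwise separated rhombus_pieces"
proof -
  obtain h where h: "sqrt 2 = h + h" "1/2 < h" "h < 1" "h * h = 1/2"
    by (rule half_sqrt2)
  let ?t1 = "Rhombus (0, 0) (1, 0) (1, 1) (0, 1)"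
  let ?t2 = "Rhombus (1 + sqrt 2, 1 + sqrt 2) (sqrt 2, 1 + sqrt 2) (sqrt 2, sqrt 2) (1 + sqrt 2, sqrt 2)"
  let ?t3 = "Rhombus (1 + sqrt 2, 0) (1, 1) (0, 1 + sqrt 2) (sqrt 2, sqrt 2)"
  let ?t4 = "Half_Square (1 + sqrt 2, 0) (1, 1) (1, 0)"
  let ?t5 = "Half_Square (0, 1 + sqrt 2) (1, 1) (0, 1)"
  let ?t6 = "Half_Square (1 + sqrt 2, 0) (sqrt 2, sqrt 2) (1 + sqrt 2, sqrt 2)"
  let ?t7 = "Half_Square (0, 1 + sqrt 2) (sqrt 2, sqrt 2) (sqrt 2, 1 + sqrt 2)"
  have "separated ?t1 ?t2" by (rule separatedI[of 1 0 _ 1]) (unfold h(1), use h in \<open>auto simp: algebra_simps\<close>)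
  moreover
  have "separated ?t1 ?t3" by (rule separatedI[of 1 "sqrt 2" _ "1 + sqrt 2"]) (unfold h(1), use h in \<open>auto simp: algebra_simps\<close>)
  moreover
  have "separated ?t1 ?t4" by (rule separatedI[of 1 0 _ 1]) (unfold h(1), use h in \<open>auto simp: algebra_simps\<close>)
  moreover
  have "separated ?t1 ?t5" by (rule separatedI[of 0 1 _ 1]) (unfold h(1), use h in \<open>auto simp: algebra_simps\<close>)
  moreover
  have "separated ?t1 ?t6" by (rule separatedI[of 1 0 _ 1]) (unfold h(1), use h in \<open>auto simp: algebra_simps\<close>)
  moreover
  have "separated ?t1 ?t7" by (rule separatedI[of 0 1 _ 1]) (unfold h(1), use h in \<open>auto simp: algebra_simps\<close>)
  moreover
  have "separated ?t2 ?t3" by (rule separatedI[of "-1" "-sqrt 2" _ "-2 - sqrt 2"]) (unfold h(1), use h in \<open>auto simp: algebra_simps\<close>)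
  moreover
  have "separated ?t2 ?t4" by (rule separatedI[of 0 "-1" _ "-sqrt 2"]) (unfold h(1), use h in \<open>auto simp: algebra_simps\<close>)
  moreover
  have "separated ?t2 ?t5" by (rule separatedI[of "-1" 0 _ "-sqrt 2"]) (unfold h(1), use h in \<open>auto simp: algebra_simps\<close>)
  moreover
  have "separated ?t2 ?t6" by (rule separatedI[of 0 "-1" _ "-sqrt 2"]) (unfold h(1), use h in \<open>auto simp: algebra_simps\<close>)
  moreover
  have "separated ?t2 ?t7" by (rule separatedI[of "-1" 0 _ "-sqrt 2"]) (unfold h(1), use h in \<open>auto simp: algebra_simps\<close>)
  moreover
  have "separated ?t3 ?t4" by (rule separatedI[of "-1" "-sqrt 2" _ "-1 - sqrt 2"]) (unfold h(1), use h in \<open>auto simp: algebra_simps\<close>)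
  moreover
  have "separated ?t3 ?t5" by (rule separatedI[of "-sqrt 2" "-1" _ "-1 - sqrt 2"]) (unfold h(1), use h in \<open>auto simp: algebra_simps\<close>)
  moreover
  have "separated ?t3 ?t6" by (rule separatedI[of "sqrt 2" 1 _ "2 + sqrt 2"]) (unfold h(1), use h in \<open>auto simp: algebra_simps\<close>)
  moreover
  have "separated ?t3 ?t7" by (rule separatedI[of 1 "sqrt 2" _ "2 + sqrt 2"]) (unfold h(1), use h in \<open>auto simp: algebra_simps\<close>)
  moreover
  have "separated ?t4 ?t5" by (rule separatedI[of 0 1 _ 1]) (unfold h(1), use h in \<open>auto simp: algebra_simps\<close>)
  moreover
  have "separated ?t4 ?t6" by (rule separatedI[of 1 "sqrt 2" _ "1 + sqrt 2"]) (unfold h(1), use h in \<open>auto simp: algebra_simps\<close>)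
  moreover
  have "separated ?t4 ?t7" by (rule separatedI[of 1 "sqrt 2" _ "1 + sqrt 2"]) (unfold h(1), use h in \<open>auto simp: algebra_simps\<close>)
  moreover
  have "separated ?t5 ?t6" by (rule separatedI[of "sqrt 2" 1 _ "1 + sqrt 2"]) (unfold h(1), use h in \<open>auto simp: algebra_simps\<close>)
  moreover
  have "separated ?t5 ?t7" by (rule separatedI[of "sqrt 2" 1 _ "1 + sqrt 2"]) (unfold h(1), use h in \<open>auto simp: algebra_simps\<close>)
  moreover
  have "separated ?t6 ?t7" by (rule separatedI[of 0 1 _ "sqrt 2"]) (unfold h(1), use h in \<open>auto simp: algebra_simps\<close>)
  moreover

  ultimately show ?thesis
    unfolding rhombus_pieces_def by (intro pairwise_separated_insert) simp_all
qed

lemma half_square_pieces_separated: "pairwise separated half_square_pieces"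
proof -
  obtain h where h: "sqrt 2 = h + h" "1/2 < h" "h < 1" "h * h = 1/2"
    by (rule half_sqrt2)
  let ?t1 = "Rhombus (0, 0) (1, 0) (1 + sqrt 2 / 2, sqrt 2 / 2) (sqrt 2 / 2, sqrt 2 / 2)"
  let ?t2 = "Rhombus (1 + sqrt 2, 0) (1 + sqrt 2, 1) (1 + sqrt 2 / 2, 1 + sqrt 2 / 2) (1 + sqrt 2 / 2, sqrt 2 / 2)"
  let ?t3 = "Half_Square (1 + sqrt 2 / 2, 1 + sqrt 2 / 2) (1 + sqrt 2 / 2, sqrt 2 / 2) (sqrt 2 / 2, sqrt 2 / 2)"
  let ?t4 = "Half_Square (1 + sqrt 2, 0) (1 + sqrt 2 / 2, sqrt 2 / 2) (1, 0)"
  let ?t5 = "Half_Square (1 + sqrt 2, 1 + sqrt 2) (1 + sqrt 2 / 2, 1 + sqrt 2 / 2) (1 + sqrt 2, 1)"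
  have "separated ?t1 ?t2" by (rule separatedI[of 1 0 _ "1 + sqrt 2 / 2"]) (unfold h(1), use h in \<open>auto simp: algebra_simps\<close>)
  moreover
  have "separated ?t1 ?t3" by (rule separatedI[of 0 1 _ "sqrt 2 / 2"]) (unfold h(1), use h in \<open>auto simp: algebra_simps\<close>)
  moreover
  have "separated ?t1 ?t4" by (rule separatedI[of 1 "-1" _ 1]) (unfold h(1), use h in \<open>auto simp: algebra_simps\<close>)
  moreover
  have "separated ?t1 ?t5" by (rule separatedI[of 0 1 _ "sqrt 2 / 2"]) (unfold h(1), use h in \<open>auto simp: algebra_simps\<close>)
  moreover
  have "separated ?t2 ?t3" by (rule separatedI[of "-1" 0 _ "-1 - sqrt 2 / 2"]) (unfold h(1), use h in \<open>auto simp: algebra_simps\<close>)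
  moreover
  have "separated ?t2 ?t4" by (rule separatedI[of "-1" "-1" _ "-1 - sqrt 2"]) (unfold h(1), use h in \<open>auto simp: algebra_simps\<close>)
  moreover
  have "separated ?t2 ?t5" by (rule separatedI[of 1 1 _ "2 + sqrt 2"]) (unfold h(1), use h in \<open>auto simp: algebra_simps\<close>)
  moreover
  have "separated ?t3 ?t4" by (rule separatedI[of 1 "-1" _ 1]) (unfold h(1), use h in \<open>auto simp: algebra_simps\<close>)
  moreover
  have "separated ?t3 ?t5" by (rule separatedI[of 1 0 _ "1 + sqrt 2 / 2"]) (unfold h(1), use h in \<open>auto simp: algebra_simps\<close>)
  moreover
  have "separated ?t4 ?t5" by (rule separatedI[of 1 1 _ "1 + sqrt 2"]) (unfold h(1), use h in \<open>auto simp: algebra_simps\<close>)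
  moreover

  ultimately show ?thesis
    unfolding half_square_pieces_def by (intro pairwise_separated_insert) simp_all
qed

lemma inflate_interior_disjoint:
  assumes "prototile t"
  shows "pairwise (\<lambda>t t'. interior (region t) \<inter> interior (region t') = {}) (inflate t)"
proof -
  have *: "pairwise (\<lambda>t t'. interior (region t) \<inter> interior (region t') = {}) (map_tile (place p b c) ` K)"
    if "cross2 b c \<noteq> 0" "pairwise separated K" for p b c K
  proof (rule pairwiseI)
    fix t t' assume "t \<in> map_tile (place p b c) ` K" "t' \<in> map_tile (place p b c) ` K" "t \<noteq> t'"
    then obtain k k' where "k \<in> K" "k' \<in> K" "t = map_tile (place p b c) k" "t' = map_tile (place p b c) k'"
      "k \<noteq> k'" by blast
    then show "interior (region t) \<inter> interior (region t') = {}"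
      using separated_interior[OF that(1)] that(2) by (simp add: pairwise_def)
  qed
  show ?thesis
    using assms
  proof (cases rule: prototile_cases)
    case (rhombus A b c)
    have "cross2 b c \<noteq> 0" using cross2_prototile[of b c] rhombus by auto
    then show ?thesis using * rhombus_pieces_separated rhombus inflate_rhombus by metis
  next
    case (half_square A b c)
    have "cross2 b c \<noteq> 0" using cross2_prototile[of b c] half_square by auto
    then show ?thesis using * half_square_pieces_separated half_square inflate_half_square by metis
  qed
qed

lemma inflate_prototile:
  assumes "prototile t" "t' \<in> inflate t"
  shows "prototile t'"
proof -
  obtain h where h: "sqrt 2 = h + h" "1/2 < h" "h < 1" "h * h = 1/2"
    by (rule half_sqrt2)
  have hx: "h * (h * x) = x / 2" for x using h(4) by (simp add: mult.assoc[symmetric])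
  have cos45: "cos (pi / 4) = h" using h(1) by (simp add: cos_45)
  note expand = dist_norm norm_eq_1 inner_add_left inner_add_right inner_diff_left inner_diff_right
  show ?thesis
    using assms(1)
  proof (cases rule: prototile_cases)
    case (rhombus A b c)
    have bc: "b \<bullet> c = h" "c \<bullet> b = h" using rhombus h(1) by (simp_all add: inner_commute)
    obtain k where k: "k \<in> rhombus_pieces" "t' = map_tile (place (silver *\<^sub>R A) b c) k"
      using assms(2) rhombus(1) by (auto simp: inflate_rhombus)
    then show ?thesis unfolding rhombus_pieces_def h(1)
      by (elim insertE emptyE; simp only: tile.map prototile.simps cos45 place_def prod.case expand)
        (simp_all add: rhombus(2,3) bc inner_add_left inner_add_right inner_diff_left inner_diff_right algebra_simps h(4) hx)
  next
    case (half_square A b c)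
    have bc: "b \<bullet> c = 0" "c \<bullet> b = 0" using half_square by (simp_all add: inner_commute)
    obtain k where k: "k \<in> half_square_pieces" "t' = map_tile (place (silver *\<^sub>R A) b c) k"
      using assms(2) half_square(1) by (auto simp: inflate_half_square)
    then show ?thesis unfolding half_square_pieces_def h(1)
      by (elim insertE emptyE; simp only: tile.map prototile.simps cos45 place_def prod.case expand)
        (simp_all add: half_square(2,3) bc inner_add_left inner_add_right inner_diff_left inner_diff_right algebra_simps h(4) hx)
  qed
qed

lemma region_rhombus: "region (Rhombus A (A + b) (A + b + c) (A + c)) = pgram A b c"
  by (simp add: region_def pgram_hull)

lemma region_half_square:
  "region (Half_Square V (V + b) (V + b + c)) = {V + x *\<^sub>R b + y *\<^sub>R c | x y. 0 \<le> y \<and> y \<le> x \<and> x \<le> 1}"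
proof -
  have "region (Half_Square V (V + b) (V + b + c)) = convex hull {V + b, V, V + b + c}"
    by (simp add: region_def insert_commute)
  also have "\<dots> = {V + b + u *\<^sub>R (- b) + v *\<^sub>R c | u v. 0 \<le> u \<and> 0 \<le> v \<and> u + v \<le> 1}"
    by (simp add: convex_hull_3_alt)
  also have "\<dots> = {V + x *\<^sub>R b + y *\<^sub>R c | x y. 0 \<le> y \<and> y \<le> x \<and> x \<le> 1}"
  proof (intro set_eqI iffI; clarify)
    fix u v :: real assume "0 \<le> u" "0 \<le> v" "u + v \<le> 1"
    then show "\<exists>x y. V + b + u *\<^sub>R (- b) + v *\<^sub>R c = V + x *\<^sub>R b + y *\<^sub>R c \<and> 0 \<le> y \<and> y \<le> x \<and> x \<le> 1"
      by (intro exI[of _ "1 - u"] exI[of _ v]) (auto simp: algebra_simps)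
  next
    fix x y :: real assume "0 \<le> y" "y \<le> x" "x \<le> 1"
    then show "\<exists>u v. V + x *\<^sub>R b + y *\<^sub>R c = V + b + u *\<^sub>R (- b) + v *\<^sub>R c \<and> 0 \<le> u \<and> 0 \<le> v \<and> u + v \<le> 1"
      by (intro exI[of _ "1 - x"] exI[of _ y]) (auto simp: algebra_simps)
  qed
  finally show ?thesis .
qed

lemma convex_scaled_region: "convex ((\<lambda>z. r *\<^sub>R z) ` region t)"
  by (simp add: region_def convex_scaling)

text \<open>The enlarged tile is convex, so it suffices that the vertices of the pieces have
  coordinates in the enlarged square, respectively triangle.\<close>

lemma inflate_region:
  assumes "prototile t" "t' \<in> inflate t"
  shows "region t' \<subseteq> (\<lambda>z. silver *\<^sub>R z) ` region t"
proof -
  obtain h where h: "sqrt 2 = h + h" "1/2 < h" "h < 1" "h * h = 1/2"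
    by (rule half_sqrt2)
  show ?thesis
    using assms(1)
  proof (cases rule: prototile_cases)
    case (rhombus A b c)
    have in_R: "place (silver *\<^sub>R A) b c (x, y) \<in> (\<lambda>z. silver *\<^sub>R z) ` region t"
      if "0 \<le> x" "x \<le> silver" "0 \<le> y" "y \<le> silver" for x y
    proof (rule image_eqI)
      show "place (silver *\<^sub>R A) b c (x, y) = silver *\<^sub>R (A + (x / silver) *\<^sub>R b + (y / silver) *\<^sub>R c)"
        using silver_pos by (simp add: place_def algebra_simps)
      show "A + (x / silver) *\<^sub>R b + (y / silver) *\<^sub>R c \<in> region t"
        using that silver_pos unfolding rhombus(1) region_rhombus pgram_def by (intro CollectI exI conjI) (rule refl, simp_all)
    qed
    obtain k where k: "k \<in> rhombus_pieces" "t' = map_tile (place (silver *\<^sub>R A) b c) k"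
      using assms(2) rhombus(1) by (auto simp: inflate_rhombus)
    have "\<forall>(x, y)\<in>set_tile k. 0 \<le> x \<and> x \<le> silver \<and> 0 \<le> y \<and> y \<le> silver"
      using k(1) h unfolding rhombus_pieces_def silver_def h(1) by auto
    then have "place (silver *\<^sub>R A) b c ` set_tile k \<subseteq> (\<lambda>z. silver *\<^sub>R z) ` region t" using in_R by auto
    then show ?thesis unfolding k(2) region_map_tile by (rule hull_minimal) (rule convex_scaled_region)
  next
    case (half_square A b c)
    have in_R: "place (silver *\<^sub>R A) b c (x, y) \<in> (\<lambda>z. silver *\<^sub>R z) ` region t"
      if "0 \<le> y" "y \<le> x" "x \<le> silver" for x y
    proof (rule image_eqI)
      show "place (silver *\<^sub>R A) b c (x, y) = silver *\<^sub>R (A + (x / silver) *\<^sub>R b + (y / silver) *\<^sub>R c)"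
        using silver_pos by (simp add: place_def algebra_simps)
      show "A + (x / silver) *\<^sub>R b + (y / silver) *\<^sub>R c \<in> region t"
        using that silver_pos unfolding half_square(1) region_half_square
        by (intro CollectI exI conjI) (rule refl, simp_all add: divide_right_mono)
    qed
    obtain k where k: "k \<in> half_square_pieces" "t' = map_tile (place (silver *\<^sub>R A) b c) k"
      using assms(2) half_square(1) by (auto simp: inflate_half_square)
    have "\<forall>(x, y)\<in>set_tile k. 0 \<le> y \<and> y \<le> x \<and> x \<le> silver"
      using k(1) h unfolding half_square_pieces_def silver_def h(1) by auto
    then have "place (silver *\<^sub>R A) b c ` set_tile k \<subseteq> (\<lambda>z. silver *\<^sub>R z) ` region t" using in_R by auto
    then show ?thesis unfolding k(2) region_map_tile by (rule hull_minimal) (rule convex_scaled_region)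
  qed
qed

section \<open>Iterates of the substitution\<close>

lemma substitute_eq: "substitute P = (\<Union>t\<in>P. inflate t)"
  by (simp add: substitute_def inflate_def)

lemma in_substitute_iff: "t \<in> substitute P \<longleftrightarrow> (\<exists>t'\<in>P. t \<in> inflate t')"
  by (simp add: substitute_eq)

lemma funpow_substitute: "(substitute ^^ n) P = (\<Union>t\<in>P. (substitute ^^ n) {t})"
proof (induction n)
  case (Suc n)
  have "(substitute ^^ Suc n) P = substitute (\<Union>t\<in>P. (substitute ^^ n) {t})" using Suc by simp
  also have "\<dots> = (\<Union>t\<in>P. (substitute ^^ Suc n) {t})" unfolding substitute_eq by simp
  finally show ?case .
qed simp

lemma substitute_mono: "P \<subseteq> Q \<Longrightarrow> substitute P \<subseteq> substitute Q"
  unfolding substitute_eq by blast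

lemma funpow_substitute_mono: "P \<subseteq> Q \<Longrightarrow> (substitute ^^ n) P \<subseteq> (substitute ^^ n) Q"
  by (induction n) (simp_all add: substitute_mono)

lemma funpow_substitute_prototile:
  assumes "prototile t" "t' \<in> (substitute ^^ n) {t}"
  shows "prototile t'"
  using assms(2) by (induction n arbitrary: t') (use assms(1) in \<open>auto simp: in_substitute_iff intro: inflate_prototile\<close>)

lemma funpow_substitute_region:
  assumes "prototile t" "t' \<in> (substitute ^^ n) {t}"
  shows "region t' \<subseteq> (\<lambda>z. silver ^ n *\<^sub>R z) ` region t"
  using assms(2)
proof (induction n arbitrary: t')
  case (Suc n)
  then obtain t'' where t'': "t'' \<in> (substitute ^^ n) {t}" "t' \<in> inflate t''"
    by (auto simp: in_substitute_iff)
  have "region t' \<subseteq> (\<lambda>z. silver *\<^sub>R z) ` region t''"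
    using inflate_region funpow_substitute_prototile[OF assms(1) t''(1)] t''(2) by blast
  also have "\<dots> \<subseteq> (\<lambda>z. silver *\<^sub>R z) ` (\<lambda>z. silver ^ n *\<^sub>R z) ` region t"
    using Suc.IH[OF t''(1)] by (rule image_mono)
  also have "\<dots> = (\<lambda>z. silver ^ Suc n *\<^sub>R z) ` region t" by (simp add: image_image)
  finally show ?case .
qed simp

lemma interior_scaled:
  fixes S :: "complex set"
  assumes "r \<noteq> 0"
  shows "interior ((\<lambda>z. r *\<^sub>R z) ` S) = (\<lambda>z. r *\<^sub>R z) ` interior S"
  using assms by (intro interior_injective_linear_image) (auto simp: inj_on_def)

text \<open>Two tiles of one parent are separated within its dissection. Tiles of different parents
  lie in the enlarged parents, whose interiors are disjoint by induction.\<close>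

lemma funpow_substitute_disjoint:
  assumes "prototile t"
  shows "pairwise (\<lambda>t t'. interior (region t) \<inter> interior (region t') = {}) ((substitute ^^ n) {t})"
proof (induction n)
  case (Suc n)
  show ?case
  proof (rule pairwiseI)
    fix p q assume pq: "p \<in> (substitute ^^ Suc n) {t}" "q \<in> (substitute ^^ Suc n) {t}" "p \<noteq> q"
    obtain p' q' where p': "p' \<in> (substitute ^^ n) {t}" "p \<in> inflate p'"
      and q': "q' \<in> (substitute ^^ n) {t}" "q \<in> inflate q'"
      using pq by (auto simp: in_substitute_iff)
    have proto: "prototile p'" "prototile q'"
      using funpow_substitute_prototile[OF assms] p' q' by blast+
    show "interior (region p) \<inter> interior (region q) = {}"
    proof (cases "p' = q'")
      case True
      then show ?thesis using inflate_interior_disjoint[OF proto(1)] p' q' pq(3) by (auto simp: pairwise_def)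
    next
      case False
      then have "interior (region p') \<inter> interior (region q') = {}" using Suc p' q' by (auto simp: pairwise_def)
      then have "(\<lambda>z. silver *\<^sub>R z) ` interior (region p') \<inter> (\<lambda>z. silver *\<^sub>R z) ` interior (region q') = {}"
        using silver_pos by auto
      moreover have "interior (region p) \<subseteq> (\<lambda>z. silver *\<^sub>R z) ` interior (region p')"
        "interior (region q) \<subseteq> (\<lambda>z. silver *\<^sub>R z) ` interior (region q')"
        using interior_mono[OF inflate_region[OF proto(1) p'(2)]] interior_mono[OF inflate_region[OF proto(2) q'(2)]]
          interior_scaled[of silver] silver_pos by auto
      ultimately show ?thesis by blast
    qed
  qed
qed simp

text \<open>What the substitution puts into an acute corner \<open>x\<close> of an enlarged tile.\<close>

definition sector :: "complex tile set \<Rightarrow> complex \<Rightarrow> complex \<Rightarrow> complex \<Rightarrow> bool" where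
  "sector Q x u v \<longleftrightarrow>
     Rhombus x (x + u) (x + u + v) (x + v) \<in> Q \<and>
     Half_Square (x + silver *\<^sub>R u) (x + u + v) (x + u) \<in> Q \<and>
     Half_Square (x + silver *\<^sub>R v) (x + u + v) (x + v) \<in> Q"

lemma rhombus_substitute:
  assumes "Rhombus A (A + b) (A + b + c) (A + c) \<in> Q"
  shows "map_tile (place (silver *\<^sub>R A) b c) ` rhombus_pieces \<subseteq> substitute Q"
  using assms unfolding substitute_eq by (auto simp: inflate_rhombus[symmetric])

lemma half_square_substitute:
  assumes "Half_Square V (V + b) (V + b + c) \<in> Q"
  shows "map_tile (place (silver *\<^sub>R V) b c) ` half_square_pieces \<subseteq> substitute Q"
  using assms unfolding substitute_eq by (auto simp: inflate_half_square[symmetric])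

lemma sector_at_acute:
  assumes "Rhombus A (A + b) (A + b + c) (A + c) \<in> Q"
  shows "sector (substitute Q) (silver *\<^sub>R A) b c"
  using rhombus_substitute[OF assms]
  by (simp add: sector_def rhombus_pieces_def place_def silver_def)

lemma sector_at_opposite_acute:
  assumes "Rhombus A (A + b) (A + b + c) (A + c) \<in> Q"
  shows "sector (substitute Q) (silver *\<^sub>R (A + b + c)) (- b) (- c)"
  using rhombus_substitute[OF assms]
  by (simp add: sector_def rhombus_pieces_def place_def silver_def algebra_simps)

text \<open>The vector \<open>m\<close> is the unit vector along the hypotenuse. The vertex order of
  a half-square matters here: the corner at the last vertex receives a half-square instead of a
  rhombus.\<close>

lemma sector_at_first:
  assumes "Half_Square V (V + b) (V + b + c) \<in> Q" "sqrt 2 *\<^sub>R m = b + c"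
  shows "sector (substitute Q) (silver *\<^sub>R V) b m"
proof -
  obtain h where h: "sqrt 2 = h + h" "1/2 < h" "h < 1" "h * h = 1/2"
    by (rule half_sqrt2)
  have "h *\<^sub>R (sqrt 2 *\<^sub>R m) = h *\<^sub>R (b + c)" using assms(2) by simp
  moreover have "h * (2 * h) = 1" using h(4) by simp
  ultimately have m: "m = h *\<^sub>R b + h *\<^sub>R c" unfolding h(1) by (simp add: scaleR_add_right distrib_left)
  have sm: "silver *\<^sub>R m = m + b + c" unfolding silver_def using assms(2) by (simp add: scaleR_add_left)
  show ?thesis
    using half_square_substitute[OF assms(1)] unfolding sector_def sm
    by (simp add: half_square_pieces_def place_def) (simp add: silver_def m h(1) algebra_simps)
qed

text \<open>The right angle between \<open>-b\<close> and \<open>c\<close> is bisected by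
  \<open>m\<close>. One half is filled by an acute rhombus corner, the other by the first vertex of
  a half-square, so both can produce sectors at the next step.\<close>

lemma pieces_at_right_angle:
  assumes "Half_Square V (V + b) (V + b + c) \<in> Q" "sqrt 2 *\<^sub>R m = c - b" "sqrt 2 *\<^sub>R l = - b - c"
    and y: "y = silver *\<^sub>R (V + b)"
  shows "Rhombus y (y + c) (y + c + m) (y + m) \<in> substitute Q"
    "Half_Square y (y + m) (y + m + l) \<in> substitute Q"
proof -
  obtain h where h: "sqrt 2 = h + h" "1/2 < h" "h < 1" "h * h = 1/2"
    by (rule half_sqrt2)
  have "h *\<^sub>R (sqrt 2 *\<^sub>R m) = h *\<^sub>R (c - b)" "h *\<^sub>R (sqrt 2 *\<^sub>R l) = h *\<^sub>R (- b - c)" using assms(2,3) by simp_all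
  moreover have "h * (2 * h) = 1" using h(4) by simp
  ultimately have ml: "m = h *\<^sub>R c - h *\<^sub>R b" "l = - (h *\<^sub>R b) - h *\<^sub>R c"
    unfolding h(1) by (simp_all add: scaleR_diff_right distrib_left)
  let ?p = "place (silver *\<^sub>R V) b c"
  have eqs: "y = ?p (1 + sqrt 2, 0)" "y + c = ?p (1 + sqrt 2, 1)" "y + m = ?p (1 + sqrt 2 / 2, sqrt 2 / 2)"
      "y + c + m = ?p (1 + sqrt 2 / 2, 1 + sqrt 2 / 2)" "y + m + l = ?p (1, 0)"
    by (simp_all add: place_def y silver_def ml h(1) complex_eq_iff algebra_simps)
  show "Rhombus y (y + c) (y + c + m) (y + m) \<in> substitute Q"
    "Half_Square y (y + m) (y + m + l) \<in> substitute Q"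
    unfolding eqs(4,5) unfolding eqs(2,3) unfolding eqs(1)
    using half_square_substitute[OF assms(1)] by (simp_all add: half_square_pieces_def)
qed

text \<open>The directions \<open>f\<^sub>1\<close> and \<open>f\<^sub>2\<close> cut the obtuse
  angle between \<open>c\<close> and \<open>-b\<close> into three angles of 45 degrees: a rhombus in
  the middle and the first vertex of a half-square on either side. The vectors
  \<open>g\<^sub>1\<close>, \<open>g\<^sub>2\<close> run along the second legs.\<close>

lemma pieces_at_obtuse:
  assumes "Rhombus A (A + b) (A + b + c) (A + c) \<in> Q"
    and f: "f\<^sub>1 = c - sqrt 2 *\<^sub>R b" "f\<^sub>2 = sqrt 2 *\<^sub>R c - b" and y: "y = silver *\<^sub>R (A + b)"
    and g: "f\<^sub>1 + g\<^sub>1 = - sqrt 2 *\<^sub>R b" "f\<^sub>2 + g\<^sub>2 = sqrt 2 *\<^sub>R c"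
  shows "Rhombus y (y + f\<^sub>1) (y + f\<^sub>1 + f\<^sub>2) (y + f\<^sub>2) \<in> substitute Q"
    "Half_Square y (y + f\<^sub>1) (y + f\<^sub>1 + g\<^sub>1) \<in> substitute Q"
    "Half_Square y (y + f\<^sub>2) (y + f\<^sub>2 + g\<^sub>2) \<in> substitute Q"
proof -
  let ?p = "place (silver *\<^sub>R A) b c"
  have eqs: "y = ?p (1 + sqrt 2, 0)" "y + f\<^sub>1 = ?p (1, 1)" "y + f\<^sub>2 = ?p (sqrt 2, sqrt 2)"
      "y + f\<^sub>1 + f\<^sub>2 = ?p (0, 1 + sqrt 2)"
    by (simp_all add: place_def y f silver_def algebra_simps)
  have "y + f\<^sub>1 + g\<^sub>1 = y - sqrt 2 *\<^sub>R b" "y + f\<^sub>2 + g\<^sub>2 = y + sqrt 2 *\<^sub>R c"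
    using g by (simp_all add: add.assoc)
  then have eqs': "y + f\<^sub>1 + g\<^sub>1 = ?p (1, 0)" "y + f\<^sub>2 + g\<^sub>2 = ?p (1 + sqrt 2, sqrt 2)"
    by (simp_all add: place_def y silver_def algebra_simps)
  show "Rhombus y (y + f\<^sub>1) (y + f\<^sub>1 + f\<^sub>2) (y + f\<^sub>2) \<in> substitute Q"
    "Half_Square y (y + f\<^sub>1) (y + f\<^sub>1 + g\<^sub>1) \<in> substitute Q"
    "Half_Square y (y + f\<^sub>2) (y + f\<^sub>2 + g\<^sub>2) \<in> substitute Q"
    unfolding eqs' unfolding eqs(4) unfolding eqs(2,3) unfolding eqs(1)
    using rhombus_substitute[OF assms(1)] by (simp_all add: rhombus_pieces_def)
qed

text \<open>The relations between eight directions at steps of 45 degrees, with sqrt 2 as 2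
  cos(pi/4). They hold for either sense of rotation, so mirror images need no separate
  treatment.\<close>

definition octagonal :: "(nat \<Rightarrow> complex) \<Rightarrow> bool" where
  "octagonal D \<longleftrightarrow> (\<forall>k. D (k + 4) = - D k \<and> D k + D (k + 2) = sqrt 2 *\<^sub>R D (k + 1))"

text \<open>\<open>sector\<close> depends on the order of its two directions because tiles carry
  ordered vertices, and which order arises depends on the piece; hence the disjunction.\<close>

definition star :: "complex tile set \<Rightarrow> complex \<Rightarrow> (nat \<Rightarrow> complex) \<Rightarrow> bool" where
  "star Q x D \<longleftrightarrow> (\<forall>k. sector Q x (D k) (D (k + 1)) \<or> sector Q x (D (k + 1)) (D k))"

lemma octagonal_values:
  assumes "octagonal D"
  shows "D 2 = sqrt 2 *\<^sub>R D 1 - D 0" "D 3 = D 1 - sqrt 2 *\<^sub>R D 0" "D 4 = - D 0" "D 5 = - D 1"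
    "D 6 = D 0 - sqrt 2 *\<^sub>R D 1" "D 7 = sqrt 2 *\<^sub>R D 0 - D 1" "D (k + 8) = D k"
proof -
  have neg: "D (k + 4) = - D k" for k using assms by (simp add: octagonal_def)
  have rec: "D k + D (k + 2) = sqrt 2 *\<^sub>R D (k + 1)" for k using assms unfolding octagonal_def by blast
  have "0 + 2 = (2::nat)" "0 + 1 = (1::nat)" "1 + 2 = (3::nat)" "1 + 1 = (2::nat)" by simp_all
  then have r: "D 0 + D 2 = sqrt 2 *\<^sub>R D 1" "D 1 + D 3 = sqrt 2 *\<^sub>R D 2"
    using rec[of 0] rec[of 1] by metis+
  show 2: "D 2 = sqrt 2 *\<^sub>R D 1 - D 0" using r(1) by (simp add: eq_diff_eq add.commute)
  have "D 3 = sqrt 2 *\<^sub>R D 2 - D 1" using r(2) by (simp add: eq_diff_eq add.commute)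
  then show 3: "D 3 = D 1 - sqrt 2 *\<^sub>R D 0" unfolding 2 by (simp add: complex_eq_iff algebra_simps)
  show "D 4 = - D 0" using neg[of 0] by simp
  show "D 5 = - D 1" using neg[of 1] by simp
  show "D 6 = D 0 - sqrt 2 *\<^sub>R D 1" using neg[of 2] 2 by simp
  show "D 7 = sqrt 2 *\<^sub>R D 0 - D 1" using neg[of 3] 3 by simp
  have "D (k + 8) = D (k + 4 + 4)" by (simp add: add.assoc)
  also have "\<dots> = D k" unfolding neg by simp
  finally show "D (k + 8) = D k" .
qed

text \<open>Around the image of the vertex \<open>A + (b + c) / silver\<close>, the first substitution step produces
  the angles 45, 90, 135 and 90 degrees, the second one splits them into eight acute angles, and the
  third one puts a rhombus into each of those.\<close>

lemma star_in_rhombus: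
  assumes R: "Rhombus A (A + D 0) (A + D 0 + D 1) (A + D 1) \<in> Q" and D: "octagonal D"
  obtains x where "star ((substitute ^^ 3) Q) x D"
proof -
  define b c where "b = D 0" and "c = D 1"
  note vals = octagonal_values[OF D, folded b_def c_def]
  have D2: "sqrt 2 *\<^sub>R c - b = D 2" and D3: "c - sqrt 2 *\<^sub>R b = D 3" and D4: "- b = D 4" and D5: "- c = D 5"
    and D6: "b - sqrt 2 *\<^sub>R c = D 6" and D7: "sqrt 2 *\<^sub>R b - c = D 7"
    using vals by simp_all
  define A\<^sub>1 where "A\<^sub>1 = silver *\<^sub>R A"
  \<comment> \<open>The points \<open>e\<close>, \<open>y\<close> and \<open>x\<close> are the
    images of the chosen vertex after one, two and three steps.\<close>
  define e where "e = A\<^sub>1 + b + c"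
  define y where "y = silver *\<^sub>R e"
  define x where "x = silver *\<^sub>R y"
  define Q\<^sub>1 where "Q\<^sub>1 = substitute Q"
  define Q\<^sub>2 where "Q\<^sub>2 = substitute Q\<^sub>1"
  define Q\<^sub>3 where "Q\<^sub>3 = substitute Q\<^sub>2"
  define B where "B = A\<^sub>1 + silver *\<^sub>R b"
  define F where "F = A\<^sub>1 + silver *\<^sub>R c"
  have sec: "sector Q\<^sub>1 A\<^sub>1 b c"
    unfolding Q\<^sub>1_def A\<^sub>1_def by (rule sector_at_acute) (use R in \<open>simp add: b_def c_def\<close>)
  have e_eq: "e = B + D 3" "e = F + D 6"
    by (simp_all add: e_def B_def F_def silver_def algebra_simps flip: D3 D6)
  \<comment> \<open>The tiles around \<open>e\<close>: \<open>r1\<close> contributes its acute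
    corner, \<open>r3\<close> an obtuse corner, \<open>t1\<close> and \<open>t2\<close> their right
    angles.\<close>
  have r1: "Rhombus A\<^sub>1 (A\<^sub>1 + b) (A\<^sub>1 + b + c) (A\<^sub>1 + c) \<in> Q\<^sub>1" using sec by (simp add: sector_def)
  have r3: "Rhombus B (B + D 3) (B + D 3 + D 2) (B + D 2) \<in> Q\<^sub>1"
  proof -
    have "Rhombus A (A + b) (A + b + c) (A + c) \<in> Q" using R by (simp add: b_def c_def)
    from rhombus_substitute[OF this] show ?thesis
      by (simp add: rhombus_pieces_def place_def flip: Q\<^sub>1_def A\<^sub>1_def)
        (simp add: B_def silver_def algebra_simps flip: D2 D3)
  qed
  have "A\<^sub>1 + b = e + - c" "A\<^sub>1 + c = e + - b" by (simp_all add: e_def)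
  then have t1: "Half_Square B (B + D 3) (B + D 3 + - c) \<in> Q\<^sub>1"
    and t2: "Half_Square F (F + D 6) (F + D 6 + - b) \<in> Q\<^sub>1"
    using sec unfolding sector_def B_def[symmetric] F_def[symmetric] e_def[symmetric]
    by (simp_all only: e_eq(1)[symmetric] e_eq(2)[symmetric])
  have yB: "y = silver *\<^sub>R (B + D 3)" and yF: "y = silver *\<^sub>R (F + D 6)" using e_eq by (simp_all add: y_def)
  have s1: "sector Q\<^sub>2 y (D 4) (D 5)"
    using sector_at_opposite_acute[OF r1] by (simp add: Q\<^sub>2_def y_def e_def vals)
  have o: "Rhombus y (y + b) (y + b + c) (y + c) \<in> Q\<^sub>2"
    "Half_Square y (y + b) (y + b + D 6) \<in> Q\<^sub>2" "Half_Square y (y + c) (y + c + D 3) \<in> Q\<^sub>2"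
    unfolding Q\<^sub>2_def
    by (rule pieces_at_obtuse[where f\<^sub>1 = b and f\<^sub>2 = c and g\<^sub>1 = "D 6" and g\<^sub>2 = "D 3", OF r3 _ _ yB]; simp add: complex_eq_iff algebra_simps flip: D2 D3 D6)+
  have p1: "Rhombus y (y + - c) (y + - c + D 6) (y + D 6) \<in> Q\<^sub>2" "Half_Square y (y + D 6) (y + D 6 + b) \<in> Q\<^sub>2"
    unfolding Q\<^sub>2_def
    by (rule pieces_at_right_angle[where m = "D 6" and l = b, OF t1 _ _ yB]; simp add: complex_eq_iff algebra_simps flip: D3 D6)+
  have p2: "Rhombus y (y + - b) (y + - b + D 3) (y + D 3) \<in> Q\<^sub>2" "Half_Square y (y + D 3) (y + D 3 + c) \<in> Q\<^sub>2"
    unfolding Q\<^sub>2_def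
    by (rule pieces_at_right_angle[where m = "D 3" and l = c, OF t2 _ _ yF]; simp add: complex_eq_iff algebra_simps flip: D3 D6)+
  have r45: "Rhombus y (y + D 4) (y + D 4 + D 5) (y + D 5) \<in> Q\<^sub>2" using s1 by (simp add: sector_def)
  \<comment> \<open>The eight angles at \<open>y\<close> are four acute rhombus corners and four
    first vertices of half-squares; both kinds receive a sector in the third step.\<close>
  have acute: "sector Q\<^sub>3 x b c" "sector Q\<^sub>3 x (D 4) (D 5)" "sector Q\<^sub>3 x (D 5) (D 6)" "sector Q\<^sub>3 x (D 4) (D 3)"
    unfolding Q\<^sub>3_def x_def
    using sector_at_acute[OF o(1)] sector_at_acute[OF r45] sector_at_acute[OF p1(1)] sector_at_acute[OF p2(1)]
    by (simp_all add: D4 D5)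
  have halves: "sector Q\<^sub>3 x b (D 7)" "sector Q\<^sub>3 x c (D 2)" "sector Q\<^sub>3 x (D 6) (D 7)" "sector Q\<^sub>3 x (D 3) (D 2)"
    unfolding Q\<^sub>3_def x_def
    by (rule sector_at_first[OF o(2)] sector_at_first[OF o(3)] sector_at_first[OF p1(2)] sector_at_first[OF p2(2)];
        simp add: complex_eq_iff algebra_simps flip: D2 D3 D6 D7)+
  have periodic: "D k = D (k mod 8)" for k
  proof (induction k rule: less_induct)
    case (less k)
    show ?case
    proof (cases "k < 8")
      case False
      then have "D k = D (k - 8)" using vals(7)[of "k - 8"] by simp
      then show ?thesis using less[of "k - 8"] False by (simp add: le_mod_geq)
    qed simp
  qed
  have "D 8 = b" using vals(7)[of 0] by (simp add: b_def)
  have "star Q\<^sub>3 x D"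
    unfolding star_def
  proof
    fix k :: nat
    define j where "j = k mod 8"
    have "D (k + 1) = D (j + 1)" using periodic[of "k + 1"] periodic[of "j + 1"]
      by (simp add: j_def mod_simps)
    moreover have "j \<in> {0, 1, 2, 3, 4, 5, 6, 7}" unfolding j_def by (simp; presburger)
    ultimately show "sector Q\<^sub>3 x (D k) (D (k + 1)) \<or> sector Q\<^sub>3 x (D (k + 1)) (D k)"
      using acute halves periodic[of k] \<open>D 8 = b\<close> unfolding j_def[symmetric] b_def c_def
      by (elim insertE) (simp_all add: numeral_eq_Suc)
  qed
  then show ?thesis using that by (simp add: Q\<^sub>1_def Q\<^sub>2_def Q\<^sub>3_def numeral_3_eq_3)
qed

section \<open>Tilings associated with the substitution\<close>

lemma mult_cnj_cmod: "z * cnj z = of_real ((cmod z)\<^sup>2)"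
  by (simp add: complex_norm_square del: of_real_power)

lemma pgram_image: "pgram a b c = (\<lambda>(x, y). a + x *\<^sub>R b + y *\<^sub>R c) ` ({0..1} \<times> {0..1})"
  by (fastforce simp: pgram_def image_iff Bex_def)

lemma pgram_dist:
  assumes "x \<in> pgram a b c" "y \<in> pgram a b c" "b \<bullet> b = 1" "c \<bullet> c = 1"
  shows "dist x y \<le> 2"
proof -
  obtain p q where x: "x = a + p *\<^sub>R b + q *\<^sub>R c" "0 \<le> p" "p \<le> 1" "0 \<le> q" "q \<le> 1"
    using assms(1) unfolding pgram_def by blast
  obtain p' q' where y: "y = a + p' *\<^sub>R b + q' *\<^sub>R c" "0 \<le> p'" "p' \<le> 1" "0 \<le> q'" "q' \<le> 1"
    using assms(2) unfolding pgram_def by blast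
  have "norm b = 1" "norm c = 1" using assms(3,4) by (simp_all add: norm_eq_1)
  have "x - y = (p - p') *\<^sub>R b + (q - q') *\<^sub>R c" unfolding x y by (simp add: algebra_simps)
  then have "dist x y \<le> norm ((p - p') *\<^sub>R b) + norm ((q - q') *\<^sub>R c)"
    using norm_triangle_ineq[of "(p - p') *\<^sub>R b" "(q - q') *\<^sub>R c"] by (simp only: dist_norm)
  also have "\<dots> \<le> 2" using x y \<open>norm b = 1\<close> \<open>norm c = 1\<close> by simp
  finally show ?thesis .
qed

lemma region_half_square_subset: "region (Half_Square V (V + b) (V + b + c)) \<subseteq> pgram V b c"
proof
  fix z assume "z \<in> region (Half_Square V (V + b) (V + b + c))"
  then obtain x y where "z = V + x *\<^sub>R b + y *\<^sub>R c" "0 \<le> y" "y \<le> x" "x \<le> 1"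
    unfolding region_half_square by blast
  then show "z \<in> pgram V b c"
    unfolding pgram_def by (intro CollectI exI[of _ x] exI[of _ y]) simp
qed

lemma region_dist:
  assumes "prototile t" "x \<in> region t" "y \<in> region t"
  shows "dist x y \<le> 2"
  using assms(1)
proof (cases rule: prototile_cases)
  case (rhombus A b c)
  then show ?thesis using pgram_dist assms(2,3) by (simp add: region_rhombus)
next
  case (half_square V b c)
  then show ?thesis using pgram_dist assms(2,3) region_half_square_subset by blast
qed

text \<open>By Cramer's rule a displacement of length at most 1/8 changes each coordinate by at most
  (1/8) / (1/2).\<close>

lemma ball_subset_coords:
  assumes "1/2 \<le> \<bar>cross2 b c\<bar>" "cmod b = 1" "cmod c = 1"
    and "z \<in> ball (V + x\<^sub>0 *\<^sub>R b + y\<^sub>0 *\<^sub>R c) (1/8)"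
  obtains x y where "z = V + x *\<^sub>R b + y *\<^sub>R c" "\<bar>x - x\<^sub>0\<bar> \<le> 1/4" "\<bar>y - y\<^sub>0\<bar> \<le> 1/4"
proof -
  define d where "d = z - (V + x\<^sub>0 *\<^sub>R b + y\<^sub>0 *\<^sub>R c)"
  have d: "cmod d \<le> 1/8" using assms(4) by (simp add: d_def dist_norm norm_minus_commute)
  have nz: "cross2 b c \<noteq> 0" using assms(1) by auto
  define p q where "p = cross2 d c / cross2 b c" and "q = cross2 b d / cross2 b c"
  have "d = p *\<^sub>R b + q *\<^sub>R c" unfolding p_def q_def by (rule cross2_coords[OF nz])
  then have z: "z = V + (x\<^sub>0 + p) *\<^sub>R b + (y\<^sub>0 + q) *\<^sub>R c" unfolding d_def by (simp add: algebra_simps)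
  have "\<bar>cross2 d c\<bar> \<le> 1/8" "\<bar>cross2 b d\<bar> \<le> 1/8"
    using abs_cross2_le[of d c] abs_cross2_le[of b d] d assms(2,3) by simp_all
  then have "\<bar>p\<bar> \<le> (1/8) / (1/2)" "\<bar>q\<bar> \<le> (1/8) / (1/2)"
    unfolding p_def q_def abs_divide using assms(1) by (intro frac_le; simp)+
  then show ?thesis using that[OF z] by simp
qed

text \<open>The centres have coordinates (1/2, 1/2) and (3/4, 1/4); from there both coordinates may
  vary by 1/4 without leaving the square, respectively the triangle.\<close>

lemma region_contains_ball:
  assumes "prototile t"
  obtains z where "ball z (1/8) \<subseteq> region t"
  using assms
proof (cases rule: prototile_cases)
  case (rhombus A b c)
  have unit: "cmod b = 1" "cmod c = 1" using rhombus by (simp_all add: norm_eq_1)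
  have k: "1/2 \<le> \<bar>cross2 b c\<bar>" using cross2_prototile rhombus by blast
  have "ball (A + (1/2) *\<^sub>R b + (1/2) *\<^sub>R c) (1/8) \<subseteq> region t"
  proof
    fix z assume "z \<in> ball (A + (1/2) *\<^sub>R b + (1/2) *\<^sub>R c) (1/8)"
    then obtain x y where z: "z = A + x *\<^sub>R b + y *\<^sub>R c" "\<bar>x - 1/2\<bar> \<le> 1/4" "\<bar>y - 1/2\<bar> \<le> 1/4"
      using ball_subset_coords[OF k unit] by blast
    then have "0 \<le> x \<and> x \<le> 1 \<and> 0 \<le> y \<and> y \<le> 1" by linarith
    then show "z \<in> region t" unfolding rhombus(1) region_rhombus pgram_def using z(1) by blast
  qed
  then show ?thesis by (rule that)
next
  case (half_square V b c)
  have unit: "cmod b = 1" "cmod c = 1" using half_square by (simp_all add: norm_eq_1)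
  have k: "1/2 \<le> \<bar>cross2 b c\<bar>" using cross2_prototile half_square by blast
  have "ball (V + (3/4) *\<^sub>R b + (1/4) *\<^sub>R c) (1/8) \<subseteq> region t"
  proof
    fix z assume "z \<in> ball (V + (3/4) *\<^sub>R b + (1/4) *\<^sub>R c) (1/8)"
    then obtain x y where z: "z = V + x *\<^sub>R b + y *\<^sub>R c" "\<bar>x - 3/4\<bar> \<le> 1/4" "\<bar>y - 1/4\<bar> \<le> 1/4"
      using ball_subset_coords[OF k unit] by blast
    then have "0 \<le> y \<and> y \<le> x \<and> x \<le> 1" by linarith
    then show "z \<in> region t" unfolding half_square(1) region_half_square using z(1) by blast
  qed
  then show ?thesis by (rule that)
qed

lemma interior_region_nonempty:
  assumes "prototile t"
  shows "interior (region t) \<noteq> {}"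
proof -
  obtain z where "ball z (1/8) \<subseteq> region t" using region_contains_ball[OF assms] .
  then have "ball z (1/8) \<subseteq> interior (region t)" by (simp add: interior_maximal)
  then show ?thesis using centre_in_ball[of z "1/8"] by fastforce
qed

lemma convex_region: "convex (region t)"
  by (simp add: region_def)

text \<open>Comparison of areas. It is done for finite subfamilies first, so that finiteness of the
  index set comes out as well.\<close>

lemma packing_bound:
  fixes z :: "'i \<Rightarrow> complex"
  assumes "0 < \<rho>" "0 \<le> r"
    and sub: "\<And>i. i \<in> I \<Longrightarrow> ball (z i) \<rho> \<subseteq> cball g r"
    and disj: "\<And>i j. i \<in> I \<Longrightarrow> j \<in> I \<Longrightarrow> i \<noteq> j \<Longrightarrow> ball (z i) \<rho> \<inter> ball (z j) \<rho> = {}"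
  shows "finite I" "real (card I) \<le> (r / \<rho>)\<^sup>2"
proof -
  let ?c = "measure lborel (ball (0::complex) 1)"
  have pos: "?c > 0" by (rule content_ball_pos) simp
  have ball_content: "measure lborel (ball c d) = d\<^sup>2 * ?c" if "0 \<le> d" for c :: complex and d
    using content_ball_conv_unit_ball[OF that, of c] by (simp only: DIM_complex)
  have *: "real (card F) \<le> (r / \<rho>)\<^sup>2" if F: "F \<subseteq> I" "finite F" for F
  proof -
    have disjF: "pairwise (\<lambda>i j. disjnt (ball (z i) \<rho>) (ball (z j) \<rho>)) F"
      unfolding pairwise_def disjnt_def using disj F by blast
    have "real (card F) * (\<rho>\<^sup>2 * ?c) = (\<Sum>i\<in>F. measure lborel (ball (z i) \<rho>))"
      by (simp only: ball_content[OF less_imp_le[OF assms(1)]] sum_constant)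
    also have "\<dots> = measure lborel (\<Union>i\<in>F. ball (z i) \<rho>)"
      by (rule measure_UNION'[symmetric])
        (use F disjF emeasure_lborel_ball_finite in \<open>auto simp: fmeasurable_def\<close>)
    also have "\<dots> \<le> measure lborel (cball g r)"
      by (rule measure_mono_fmeasurable) (use F sub emeasure_lborel_cball_finite in \<open>auto simp: fmeasurable_def\<close>)
    also have "\<dots> = r\<^sup>2 * ?c"
      by (simp only: content_cball_conv_ball ball_content[OF assms(2)])
    finally show ?thesis using pos assms(1) by (simp add: power_divide field_simps)
  qed
  have "\<And>F. F \<subseteq> I \<Longrightarrow> finite F \<Longrightarrow> card F \<le> nat \<lfloor>(r / \<rho>)\<^sup>2\<rfloor>"
    using * by (simp add: le_nat_floor)
  then show "finite I" using finite_if_finite_subsets_card_bdd by blast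
  then show "real (card I) \<le> (r / \<rho>)\<^sup>2" using * by blast
qed

lemma interior_disjoint_packing:
  fixes f :: "'i \<Rightarrow> complex set"
  assumes "0 \<le> r"
    and sub: "\<And>i. i \<in> I \<Longrightarrow> f i \<subseteq> cball g r"
    and ball: "\<And>i. i \<in> I \<Longrightarrow> \<exists>z. ball z (1/8) \<subseteq> f i"
    and disj: "\<And>i j. i \<in> I \<Longrightarrow> j \<in> I \<Longrightarrow> i \<noteq> j \<Longrightarrow> interior (f i) \<inter> interior (f j) = {}"
  shows "finite I" "real (card I) \<le> (8 * r)\<^sup>2"
proof -
  obtain z where z: "\<And>i. i \<in> I \<Longrightarrow> ball (z i) (1/8) \<subseteq> f i" using ball by metis
  then have z': "ball (z i) (1/8) \<subseteq> interior (f i)" if "i \<in> I" for i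
    using that by (simp add: interior_maximal)
  have s: "ball (z i) (1/8) \<subseteq> cball g r" if "i \<in> I" for i using z sub that by blast
  have d: "ball (z i) (1/8) \<inter> ball (z j) (1/8) = {}" if "i \<in> I" "j \<in> I" "i \<noteq> j" for i j
    using z' disj that by blast
  show "finite I" using packing_bound(1)[of "1/8" r I z g] s d assms(1) by simp
  show "real (card I) \<le> (8 * r)\<^sup>2" using packing_bound(2)[of "1/8" r I z g] s d assms(1) by (simp add: mult.commute)
qed

text \<open>Otherwise the open set would be covered by finitely many boundaries of convex sets,
  which are null sets. This turns coverings into overlaps of interiors.\<close>

lemma open_meets_interior:
  fixes U :: "complex set"
  assumes "open U" "U \<noteq> {}" "finite K" "U \<subseteq> (\<Union>t\<in>K. f t)" "\<And>t. t \<in> K \<Longrightarrow> convex (f t)"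
  shows "\<exists>t\<in>K. U \<inter> interior (f t) \<noteq> {}"
proof (rule ccontr)
  assume "\<not> ?thesis"
  then have none: "U \<inter> interior (f t) = {}" if "t \<in> K" for t using that by blast
  have "U \<subseteq> (\<Union>t\<in>K. frontier (f t))"
  proof
    fix z assume "z \<in> U"
    then obtain t where "t \<in> K" "z \<in> f t" using assms(4) by blast
    moreover have "z \<notin> interior (f t)" using none[OF \<open>t \<in> K\<close>] \<open>z \<in> U\<close> by blast
    ultimately show "z \<in> (\<Union>t\<in>K. frontier (f t))" using closure_subset by (auto simp: frontier_def)
  qed
  moreover have "negligible (\<Union>t\<in>K. frontier (f t))"
    using assms(3,5) by (intro negligible_Union) (auto intro: negligible_convex_frontier)
  ultimately have "negligible U" using negligible_subset by blast
  then show False using open_not_negligible assms(1,2) by blast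
qed

section \<open>Gluing half-squares\<close>

lemma same_tile_set: "same_tile t t' \<Longrightarrow> set_tile t = set_tile t'"
  by (cases t; cases t') auto

text \<open>In an isosceles triangle the reflection of the apex in the base coincides with the
  reflection in the midpoint of the base. This is why a glued pair is a parallelogram.\<close>

lemma mirror_isosceles:
  assumes "cmod (S - V) = cmod (W - S)" "V \<noteq> W"
  shows "mirror V W S = V + W - S"
proof -
  define b c where "b = S - V" and "c = W - S"
  have bc: "W - V = b + c" by (simp add: b_def c_def)
  have "b + c \<noteq> 0" using assms(2) bc by auto
  have "b * cnj b = c * cnj c"
    using assms(1) by (simp only: mult_cnj_cmod b_def c_def)
  then have "(b + c) * cnj b = c * cnj (b + c)" by (simp add: algebra_simps)
  then have "(b + c) * cnj (b / (b + c)) = c"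
    using \<open>b + c \<noteq> 0\<close> by (simp add: nonzero_divide_eq_eq complex_cnj_add[symmetric] del: complex_cnj_add)
  then show ?thesis unfolding mirror_def bc by (simp add: b_def c_def)
qed

lemma mirror_half_square:
  assumes "prototile (Half_Square V S W)"
  shows "mirror V W S = V + W - S"
proof (rule mirror_isosceles)
  show "cmod (S - V) = cmod (W - S)" using assms by (simp add: dist_norm norm_minus_commute)
  show "V \<noteq> W"
  proof
    assume "V = W"
    then have "(V - S) \<bullet> (V - S) = 0" using assms by simp
    then show False using assms by simp
  qed
qed

text \<open>In coordinates based at \<open>S\<close> the hypotenuse is the line x + y = 1, and the
  second triangle is the image of the first under (x, y) -> (1 - y, 1 - x).\<close>

lemma union_half_squares:
  "region (Half_Square V S W) \<union> region (Half_Square V (V + W - S) W) = pgram S (V - S) (W - S)"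
proof -
  have 1: "region (Half_Square V S W) = {S + x *\<^sub>R (V - S) + y *\<^sub>R (W - S) | x y. 0 \<le> x \<and> 0 \<le> y \<and> x + y \<le> 1}" for S
  proof -
    have "region (Half_Square V S W) = convex hull {S, V, W}" by (simp add: region_def insert_commute)
    then show ?thesis by (simp only: convex_hull_3_alt)
  qed
  show ?thesis
  proof (intro set_eqI iffI)
    fix z assume "z \<in> region (Half_Square V S W) \<union> region (Half_Square V (V + W - S) W)"
    then show "z \<in> pgram S (V - S) (W - S)"
    proof
      assume "z \<in> region (Half_Square V S W)"
      then obtain x y where "z = S + x *\<^sub>R (V - S) + y *\<^sub>R (W - S)" "0 \<le> x" "0 \<le> y" "x + y \<le> 1"
        unfolding 1 by blast
      then show ?thesis unfolding pgram_def by (intro CollectI exI[of _ x] exI[of _ y]) simp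
    next
      assume "z \<in> region (Half_Square V (V + W - S) W)"
      then obtain x y where "z = (V + W - S) + x *\<^sub>R (V - (V + W - S)) + y *\<^sub>R (W - (V + W - S))"
          "0 \<le> x" "0 \<le> y" "x + y \<le> 1"
        unfolding 1 by blast
      then show ?thesis unfolding pgram_def
        by (intro CollectI exI[of _ "1 - y"] exI[of _ "1 - x"]) (simp add: algebra_simps)
    qed
  next
    fix z assume "z \<in> pgram S (V - S) (W - S)"
    then obtain x y where z: "z = S + x *\<^sub>R (V - S) + y *\<^sub>R (W - S)" "0 \<le> x" "x \<le> 1" "0 \<le> y" "y \<le> 1"
      unfolding pgram_def by blast
    show "z \<in> region (Half_Square V S W) \<union> region (Half_Square V (V + W - S) W)"
    proof (cases "x + y \<le> 1")
      case True
      then show ?thesis unfolding 1 using z by blast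
    next
      case False
      have "z \<in> region (Half_Square V (V + W - S) W)"
        unfolding 1 using z False
        by (intro CollectI exI[of _ "1 - y"] exI[of _ "1 - x"]) (simp add: algebra_simps)
      then show ?thesis by blast
    qed
  qed
qed

text \<open>The glued tile to which a piece belongs, computed from the piece alone. Two glued tiles
  with a common piece are therefore equal.\<close>

fun block :: "complex tile \<Rightarrow> complex set" where
  "block (Rhombus A B C D) = region (Rhombus A B C D)"
| "block (Half_Square V S W) = pgram S (V - S) (W - S)"

lemma glue_half_squares_cases:
  assumes T: "is_tiling \<T>" and v: "v \<in> glue_half_squares \<T>"
  obtains K where "K \<subseteq> \<T>" "finite K" "K \<noteq> {}" "v = (\<Union>t\<in>K. region t)" "\<And>t. t \<in> K \<Longrightarrow> v = block t"
proof -
  consider A B C D where "v = region (Rhombus A B C D)" "Rhombus A B C D \<in> \<T>"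
    | V S W where "v = region (Half_Square V S W) \<union> region (Half_Square V (mirror V W S) W)"
      "Half_Square V S W \<in> \<T>" "Half_Square V (mirror V W S) W \<in> \<T>"
    using v unfolding glue_half_squares_def by blast
  then show thesis
  proof cases
    case 1
    then show ?thesis using that[of "{Rhombus A B C D}"] by auto
  next
    case 2
    have m: "mirror V W S = V + W - S"
      by (rule mirror_half_square) (use T 2 in \<open>auto simp: is_tiling_def\<close>)
    have "pgram S (V - S) (W - S) = pgram (V + W - S) (V - (V + W - S)) (W - (V + W - S))"
      using union_half_squares[of V S W] union_half_squares[of V "V + W - S" W] by (simp add: Un_commute)
    then have "v = block (Half_Square V (V + W - S) W)" "v = block (Half_Square V S W)"
      using 2(1) union_half_squares[of V S W] unfolding m block.simps by simp_all
    then show ?thesis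
      using that[of "{Half_Square V S W, Half_Square V (V + W - S) W}"] 2 unfolding m by blast
  qed
qed

lemma block_pgram:
  assumes "prototile t"
  obtains a b c where "block t = pgram a b c" "cmod b = 1" "cmod c = 1" "cross2 b c \<noteq> 0"
  using assms
proof (cases rule: prototile_cases)
  case (rhombus A b c)
  then show ?thesis using that[of A b c] cross2_prototile[of b c] by (auto simp: region_rhombus norm_eq_1)
next
  case (half_square V b c)
  then have "block t = pgram (V + b) (- b) c" by simp
  then show ?thesis using that[of "V + b" "- b" c] half_square cross2_prototile[of b c] by (auto simp: norm_eq_1)
qed

lemma glued_tile_pgram:
  assumes T: "is_tiling \<T>" and v: "v \<in> glue_half_squares \<T>"
  obtains a b c where "v = pgram a b c" "cmod b = 1" "cmod c = 1" "cross2 b c \<noteq> 0"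
proof -
  obtain K where K: "K \<subseteq> \<T>" "K \<noteq> {}" "\<And>t. t \<in> K \<Longrightarrow> v = block t" using glue_half_squares_cases[OF assms] by metis
  then obtain t where "t \<in> \<T>" "v = block t" by blast
  then show ?thesis using block_pgram[of t] T that unfolding is_tiling_def by metis
qed

text \<open>Inside the overlap some piece of \<open>v\<close> and some piece of \<open>w\<close>
  have overlapping interiors. In the tiling they are the same piece, and \<open>block\<close>
  recovers the glued tile from it.\<close>

lemma glued_tiles_disjoint:
  assumes T: "is_tiling \<T>" and v: "v \<in> glue_half_squares \<T>" and w: "w \<in> glue_half_squares \<T>"
    and meet: "interior v \<inter> interior w \<noteq> {}"
  shows "v = w"
proof -
  obtain K where K: "K \<subseteq> \<T>" "finite K" "v = (\<Union>t\<in>K. region t)" "\<And>t. t \<in> K \<Longrightarrow> v = block t"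
    using glue_half_squares_cases[OF T v] by metis
  obtain L where L: "L \<subseteq> \<T>" "finite L" "w = (\<Union>t\<in>L. region t)" "\<And>t. t \<in> L \<Longrightarrow> w = block t"
    using glue_half_squares_cases[OF T w] by metis
  let ?U = "interior v \<inter> interior w"
  have "?U \<subseteq> (\<Union>t\<in>K. region t)" using K(3) interior_subset by blast
  then obtain t where t: "t \<in> K" "?U \<inter> interior (region t) \<noteq> {}"
    using open_meets_interior[of ?U K region] meet K(2) convex_region by (metis open_Int open_interior)
  let ?U' = "?U \<inter> interior (region t)"
  have "?U' \<subseteq> (\<Union>t\<in>L. region t)" using L(3) interior_subset by blast
  then obtain t' where t': "t' \<in> L" "?U' \<inter> interior (region t') \<noteq> {}"
    using open_meets_interior[of ?U' L region] t L(2) convex_region by (metis open_Int open_interior)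
  have "interior (region t) \<inter> interior (region t') \<noteq> {}" using t'(2) by blast
  then have "t = t'" using T t(1) t'(1) K(1) L(1) unfolding is_tiling_def pairwise_def by blast
  then show ?thesis using K(4)[OF t(1)] L(4)[OF t'(1)] by simp
qed

lemma tiles_near_finite:
  assumes T: "is_tiling \<T>"
  shows "finite {t \<in> \<T>. region t \<inter> cball g r \<noteq> {}}"
proof (cases "r \<ge> 0")
  case True
  show ?thesis
  proof (rule interior_disjoint_packing(1)[where f = region and g = g and r = "r + 2"])
    show "0 \<le> r + 2" using True by simp
  next
    fix t assume "t \<in> {t \<in> \<T>. region t \<inter> cball g r \<noteq> {}}"
    then obtain y where t: "t \<in> \<T>" "y \<in> region t" "dist g y \<le> r" by auto
    show "region t \<subseteq> cball g (r + 2)"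
    proof
      fix x assume "x \<in> region t"
      then have "dist y x \<le> 2" using region_dist t T by (auto simp: is_tiling_def)
      then show "x \<in> cball g (r + 2)" using t(3) dist_triangle[of g x y] by simp
    qed
    show "\<exists>z. ball z (1/8) \<subseteq> region t" using region_contains_ball t(1) T unfolding is_tiling_def by metis
  next
    fix t t' assume "t \<in> {t \<in> \<T>. region t \<inter> cball g r \<noteq> {}}" "t' \<in> {t \<in> \<T>. region t \<inter> cball g r \<noteq> {}}" "t \<noteq> t'"
    then show "interior (region t) \<inter> interior (region t') = {}"
      using T by (auto simp: is_tiling_def pairwise_def)
  qed
qed auto

section \<open>Stars in a tiling\<close>

lemma octagonal_powers:
  assumes "b \<bullet> b = 1" "c \<bullet> c = 1" "b \<bullet> c = sqrt 2 / 2"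
  obtains w where "cmod w = 1" "c = b * w" "\<And>u. octagonal (\<lambda>k. u * w ^ k)"
proof (rule that[of "c / b"])
  \<comment> \<open>The rotation by 45 degrees in one sense or the other, depending on the
    orientation of the rhombus; a primitive eighth root of unity.\<close>
  define w where "w = c / b"
  have bc: "cmod b = 1" "cmod c = 1" using assms by (simp_all add: norm_eq_1)
  then have "b \<noteq> 0" by auto
  show "cmod (c / b) = 1" using bc by (simp add: norm_divide)
  show "c = b * (c / b)" using \<open>b \<noteq> 0\<close> by simp
  have w1: "w * cnj w = 1" using bc by (simp add: w_def mult_cnj_cmod norm_divide)
  have "inverse b = cnj b" using bc \<open>b \<noteq> 0\<close> mult_cnj_cmod[of b] by (simp add: inverse_unique)
  then have "w = cnj b * c" by (simp add: w_def divide_inverse)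
  then have "Re w = sqrt 2 / 2" using assms(3) by (simp add: inner_complex_def)
  then have "w + cnj w = of_real (sqrt 2)" by (simp add: complex_eq_iff)
  then have "w * w + w * cnj w = of_real (sqrt 2) * w" by (metis distrib_left mult.commute)
  then have w2: "w * w = of_real (sqrt 2) * w - 1" using w1 by (simp add: algebra_simps)
  define r where "r = complex_of_real (sqrt 2)"
  have r2: "r * r = 2" unfolding r_def by (metis of_real_mult of_real_numeral sqrt2_bounds(3))
  have "w ^ 4 = (w * w) * (w * w)" by (simp add: power4_eq_xxxx)
  also have "\<dots> = (r * w - 1) * (r * w - 1)" by (simp only: w2 r_def)
  also have "\<dots> = (r * r) * (w * w) - 2 * (r * w) + 1" by (simp add: algebra_simps)
  also have "\<dots> = 2 * (r * w - 1) - 2 * (r * w) + 1" unfolding r2 by (simp only: w2 r_def)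
  also have "\<dots> = -1" by simp
  finally have w4: "w ^ 4 = -1" .
  show "octagonal (\<lambda>k. u * (c / b) ^ k)" for u
    unfolding octagonal_def w_def[symmetric]
  proof (intro allI conjI)
    fix k
    show "u * w ^ (k + 4) = - (u * w ^ k)" by (simp add: power_add w4)
    have "u * w ^ k + u * w ^ (k + 2) = u * w ^ k * (1 + w * w)" by (simp add: power_add power2_eq_square algebra_simps)
    also have "\<dots> = sqrt 2 *\<^sub>R (u * w ^ (k + 1))" unfolding w2 by (simp add: scaleR_conv_of_real algebra_simps)
    finally show "u * w ^ k + u * w ^ (k + 2) = sqrt 2 *\<^sub>R (u * w ^ (k + 1))" .
  qed
qed

text \<open>The squares sit in the notches of the star: each has a corner at the outer end of the
  edge shared by two consecutive rhombi.\<close>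

definition glued_star :: "complex set set \<Rightarrow> complex \<Rightarrow> (nat \<Rightarrow> complex) \<Rightarrow> bool" where
  "glued_star X x D \<longleftrightarrow> (\<forall>k. pgram x (D k) (D (k + 1)) \<in> X \<and> pgram (x + D (k + 1)) (D k) (D (k + 2)) \<in> X)"

text \<open>One step leads from any tile to a rhombus and three more to a star, which explains the
  fourth iterate.\<close>

lemma rhombus_in_inflate:
  assumes "prototile t"
  obtains A b c where "Rhombus A (A + b) (A + b + c) (A + c) \<in> inflate t"
    "b \<bullet> b = 1" "c \<bullet> c = 1" "b \<bullet> c = sqrt 2 / 2"
proof -
  have "\<exists>A B C D. Rhombus A B C D \<in> inflate t"
    using assms
    by (cases rule: prototile_cases)
      (auto simp: inflate_rhombus inflate_half_square rhombus_pieces_def half_square_pieces_def)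
  then obtain A B C D where *: "Rhombus A B C D \<in> inflate t" by blast
  then have "prototile (Rhombus A B C D)" using inflate_prototile assms by blast
  then show ?thesis by (cases rule: prototile_cases) (use * that in auto)
qed

lemma star_near:
  assumes T: "is_tiling \<T>" and assoc: "associated_with_substitution \<T>"
  obtains x u w where "cmod u = 1" "cmod w = 1" "octagonal (\<lambda>k. u * w ^ k)"
    "glued_star (glue_half_squares \<T>) x (\<lambda>k. u * w ^ k)" "dist g x \<le> 1000"
proof -
  define P where "P = {t \<in> \<T>. region t \<inter> cball g 1000 \<noteq> {}}"
  have "finite P" unfolding P_def by (rule tiles_near_finite[OF T])
  moreover have PT: "P \<subseteq> \<T>" by (auto simp: P_def)
  ultimately obtain t n where t: "prototile t" and "occurs_in P ((substitute ^^ n) {t})"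
    using assoc unfolding associated_with_substitution_def by blast
  then obtain a b where a: "cmod a = 1"
    and "\<forall>p\<in>P. \<exists>q\<in>(substitute ^^ n) {t}. same_tile (map_tile (\<lambda>z. a * z + b) p) q"
    unfolding occurs_in_def by blast
  then obtain f where f: "\<And>p. p \<in> P \<Longrightarrow> f p \<in> (substitute ^^ n) {t}"
    "\<And>p. p \<in> P \<Longrightarrow> same_tile (map_tile (\<lambda>z. a * z + b) p) (f p)" by metis
  \<comment> \<open>The rigid motion carrying the patch into the iterate, and its inverse; the
    inverse of the unit number \<open>a\<close> is its conjugate.\<close>
  define \<phi> where "\<phi> z = a * z + b" for z
  define \<psi> where "\<psi> z = cnj a * (z - b)" for z
  have aa: "cnj a * a = 1" using a mult_cnj_cmod[of a] by (simp add: mult.commute)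
  have aa': "a * cnj a = 1" using aa by (simp add: mult.commute)
  have \<psi>\<phi>: "\<psi> (\<phi> z) = z" and \<phi>\<psi>: "\<phi> (\<psi> z) = z" for z
    unfolding \<phi>_def \<psi>_def using aa aa' by (simp_all add: mult.assoc[symmetric])
  have dist\<phi>: "dist (\<phi> z) (\<phi> y) = dist z y" for z y
    using a by (simp add: \<phi>_def dist_norm norm_mult flip: right_diff_distrib)
  have lin: "\<phi> ` (convex hull S) = convex hull (\<phi> ` S)" for S
  proof -
    have "linear ((*) a)" by (simp add: bounded_linear_mult_right bounded_linear.linear)
    then have "(+) b ` (*) a ` (convex hull S) = convex hull ((+) b ` (*) a ` S)"
      by (simp add: convex_hull_linear_image convex_hull_translation)
    moreover have "\<phi> = (\<lambda>z. b + z) \<circ> (*) a" by (auto simp: \<phi>_def)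
    ultimately show ?thesis by (simp only: image_comp)
  qed
  have reg: "region (f p) = \<phi> ` region p" if "p \<in> P" for p
    using same_tile_set[OF f(2)[OF that]] unfolding region_def lin by (simp add: tile.set_map \<phi>_def)
  have cover: "cball (\<phi> g) 1000 \<subseteq> (\<Union>p\<in>P. region (f p))"
  proof
    fix z assume z: "z \<in> cball (\<phi> g) 1000"
    then have "\<psi> z \<in> cball g 1000" using dist\<phi>[of g "\<psi> z"] by (simp add: \<phi>\<psi>)
    moreover obtain p where "p \<in> \<T>" "\<psi> z \<in> region p" using T unfolding is_tiling_def by blast
    ultimately have "p \<in> P" by (auto simp: P_def)
    moreover have "z \<in> \<phi> ` region p" using \<open>\<psi> z \<in> region p\<close> \<phi>\<psi>[of z] by (metis image_eqI)
    ultimately show "z \<in> (\<Union>p\<in>P. region (f p))" using reg by blast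
  qed
  have scaled_dist: "dist x y \<le> 2 * silver ^ m"
    if "prototile t'" "x \<in> (\<lambda>z. silver ^ m *\<^sub>R z) ` region t'" "y \<in> (\<lambda>z. silver ^ m *\<^sub>R z) ` region t'" for t' m x y
    using that region_dist[OF that(1)] silver_pos
    by (auto simp: dist_norm abs_mult simp flip: scaleR_diff_right)
  \<comment> \<open>Lower iterates have diameter at most 2 * 3^3 = 54 and cannot contain a disc of
    radius 1000.\<close>
  have "4 \<le> n"
  proof (rule ccontr)
    assume "\<not> 4 \<le> n"
    then have "n \<le> 3" by simp
    have "silver ^ n \<le> silver ^ 3" using \<open>n \<le> 3\<close> by (rule power_increasing) (simp add: silver_def)
    also have "\<dots> \<le> 3 ^ 3" using silver_pos silver_less_3 by (intro power_mono) auto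
    finally have sn: "silver ^ n \<le> 27" by simp
    have "cball (\<phi> g) 1000 \<subseteq> cball (\<phi> g) 54"
    proof
      fix z assume z: "z \<in> cball (\<phi> g) 1000"
      have in_t: "z \<in> (\<lambda>z. silver ^ n *\<^sub>R z) ` region t" if "z \<in> cball (\<phi> g) 1000" for z
        using cover that f(1) funpow_substitute_region[OF t] by blast
      have "dist (\<phi> g) z \<le> 2 * silver ^ n"
        by (rule scaled_dist[OF t in_t in_t]) (use z in auto)
      then show "z \<in> cball (\<phi> g) 54" using sn by simp
    qed
    then show False by (simp add: cball_subset_cball_iff)
  qed
  then obtain m where n: "n = 4 + m" using le_iff_add by blast
  have split: "(substitute ^^ n) {t} = (\<Union>t'\<in>(substitute ^^ m) {t}. (substitute ^^ 4) {t'})"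
    unfolding n funpow_add comp_def by (rule funpow_substitute)
  have "\<phi> g \<in> cball (\<phi> g) 1000" by simp
  then obtain p\<^sub>0 where p\<^sub>0: "p\<^sub>0 \<in> P" "\<phi> g \<in> region (f p\<^sub>0)" using cover by blast
  then obtain t' where t': "t' \<in> (substitute ^^ m) {t}" "f p\<^sub>0 \<in> (substitute ^^ 4) {t'}"
    using f(1)[OF p\<^sub>0(1)] split by blast
  have proto': "prototile t'" by (rule funpow_substitute_prototile[OF t t'(1)])
  \<comment> \<open>The bound is 2 * 3^4, so the whole fourth iterate of \<open>t'\<close> stays in
    the disc covered by the images of the patch.\<close>
  have near: "dist (\<phi> g) z \<le> 162" if "q \<in> (substitute ^^ 4) {t'}" "z \<in> region q" for q z
  proof -
    have "silver ^ 4 \<le> 3 ^ 4" using silver_pos silver_less_3 by (intro power_mono) auto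
    moreover have "dist (\<phi> g) z \<le> 2 * silver ^ 4"
      using funpow_substitute_region[OF proto'] t'(2) p\<^sub>0(2) that by (intro scaled_dist[OF proto']) blast+
    ultimately show ?thesis by simp
  qed
  \<comment> \<open>Being covered by images of the patch, \<open>q\<close> overlaps one of them;
    both are tiles of the same iterate, so they are equal.\<close>
  have found: "\<exists>p\<in>P. f p = q" if q: "q \<in> (substitute ^^ 4) {t'}" for q
  proof -
    have qn: "q \<in> (substitute ^^ n) {t}" using q t'(1) split by blast
    have "interior (region q) \<subseteq> (\<Union>p\<in>P. region (f p))"
    proof
      fix z assume "z \<in> interior (region q)"
      then have "dist (\<phi> g) z \<le> 162" using near[OF q] interior_subset by blast
      then have "z \<in> cball (\<phi> g) 1000" by simp
      then show "z \<in> (\<Union>p\<in>P. region (f p))" using cover by blast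
    qed
    then obtain p where "p \<in> P" "interior (region q) \<inter> interior (region (f p)) \<noteq> {}"
      using open_meets_interior[of "interior (region q)" P "\<lambda>p. region (f p)"] \<open>finite P\<close>
        interior_region_nonempty[OF funpow_substitute_prototile[OF t qn]] convex_region by (metis open_interior)
    then show ?thesis using funpow_substitute_disjoint[OF t, of n] f(1) qn unfolding pairwise_def by metis
  qed
  obtain A b' c' where R: "Rhombus A (A + b') (A + b' + c') (A + c') \<in> inflate t'"
    and bc: "b' \<bullet> b' = 1" "c' \<bullet> c' = 1" "b' \<bullet> c' = sqrt 2 / 2"
    using rhombus_in_inflate[OF proto'] .
  obtain w where w: "cmod w = 1" "c' = b' * w" "\<And>u. octagonal (\<lambda>k. u * w ^ k)"
    using octagonal_powers[OF bc] by blast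
  define D where "D k = b' * w ^ k" for k
  have oct: "octagonal D" using w(3)[of b'] by (simp add: D_def[abs_def])
  have "Rhombus A (A + D 0) (A + D 0 + D 1) (A + D 1) \<in> {Rhombus A (A + b') (A + b' + c') (A + c')}"
    by (simp add: D_def w(2))
  from star_in_rhombus[OF this oct] obtain y
    where y: "star ((substitute ^^ 3) {Rhombus A (A + b') (A + b' + c') (A + c')}) y D" .
  have "{Rhombus A (A + b') (A + b' + c') (A + c')} \<subseteq> substitute {t'}"
    using R by (simp add: substitute_eq)
  then have "(substitute ^^ 3) {Rhombus A (A + b') (A + b' + c') (A + c')} \<subseteq> (substitute ^^ 3) (substitute {t'})"
    by (rule funpow_substitute_mono)
  also have "(substitute ^^ 3) (substitute {t'}) = (substitute ^^ 4) {t'}"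
    by (simp add: numeral_eq_Suc funpow_swap1)
  finally have star_sub: "(substitute ^^ 3) {Rhombus A (A + b') (A + b' + c') (A + c')} \<subseteq> (substitute ^^ 4) {t'}" .
  define Q where "Q = (substitute ^^ 4) {t'}"
  have sectors: "sector Q y (D k) (D (k + 1)) \<or> sector Q y (D (k + 1)) (D k)" for k
    using y star_sub unfolding star_def sector_def Q_def by blast
  define x where "x = \<psi> y"
  define D' where "D' k = (cnj a * b') * w ^ k" for k
  have \<psi>_add: "\<psi> (p + q) = \<psi> p + cnj a * q" for p q by (simp add: \<psi>_def algebra_simps)
  have D'D: "cnj a * D k = D' k" for k by (simp add: D_def D'_def)
  have half: "Half_Square (\<psi> V) (\<psi> S) (\<psi> W) \<in> \<T>" if in_Q: "Half_Square V S W \<in> Q" for V S W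
  proof -
    obtain p where p: "p \<in> P" "f p = Half_Square V S W" using found in_Q by (auto simp: Q_def)
    then have "same_tile (map_tile \<phi> p) (Half_Square V S W)" using f(2)[OF p(1)] by (simp add: \<phi>_def[abs_def])
    then have "p = Half_Square (\<psi> V) (\<psi> S) (\<psi> W)" by (cases p) (auto simp: \<psi>\<phi>)
    then show ?thesis using p(1) PT by blast
  qed
  \<comment> \<open>\<open>same_tile\<close> determines a rhombus only up to relabelling, so the
    claim is about its region; half-squares come back with their vertex order.\<close>
  have rhomb: "\<psi> ` region (Rhombus A B C E) \<in> glue_half_squares \<T>" if in_Q: "Rhombus A B C E \<in> Q" for A B C E
  proof -
    obtain p where p: "p \<in> P" "f p = Rhombus A B C E" using found in_Q by (auto simp: Q_def)
    then have "same_tile (map_tile \<phi> p) (Rhombus A B C E)" using f(2)[OF p(1)] by (simp add: \<phi>_def[abs_def])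
    then obtain A' B' C' E' where p': "p = Rhombus A' B' C' E'" by (cases p) auto
    have "\<psi> ` region (Rhombus A B C E) = region p"
      using reg[OF p(1)] p(2) by (simp add: image_image \<psi>\<phi>)
    moreover have "Rhombus A' B' C' E' \<in> \<T>" using p' p(1) PT by blast
    ultimately show ?thesis unfolding p' glue_half_squares_def
      by (intro UnI1 CollectI exI[of _ A'] exI[of _ B'] exI[of _ C'] exI[of _ E'] conjI)
  qed
  have \<psi>_pgram: "\<psi> ` pgram p b c = pgram (\<psi> p) (cnj a * b) (cnj a * c)" for p b c
  proof -
    have "\<psi> (p + r *\<^sub>R b + s *\<^sub>R c) = \<psi> p + r *\<^sub>R (cnj a * b) + s *\<^sub>R (cnj a * c)" for r s
      by (simp add: \<psi>_def algebra_simps)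
    then show ?thesis unfolding pgram_image image_image by (intro image_cong) auto
  qed
  have x_dist: "dist g x \<le> 1000"
  proof -
    have "\<exists>q\<in>Q. y \<in> region q"
    proof -
      obtain u v where "Rhombus y (y + u) (y + u + v) (y + v) \<in> Q"
        using sectors[of 0] unfolding sector_def by blast
      then show ?thesis by (rule bexI[rotated]) (simp add: region_def hull_inc)
    qed
    then have "dist (\<phi> g) y \<le> 162" using near unfolding Q_def by blast
    then show ?thesis using dist\<phi>[of g x] by (simp add: x_def \<phi>\<psi>)
  qed
  \<comment> \<open>Exchanging the two directions of a sector exchanges its half-squares and keeps
    the region of its rhombus, so both alternatives give the same tiles.\<close>
  have tiles: "pgram x (D' k) (D' (k + 1)) \<in> glue_half_squares \<T> \<and>
    Half_Square (x + silver *\<^sub>R D' k) (x + D' k + D' (k + 1)) (x + D' k) \<in> \<T> \<and>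
    Half_Square (x + silver *\<^sub>R D' (k + 1)) (x + D' k + D' (k + 1)) (x + D' (k + 1)) \<in> \<T>" for k
  proof -
    have "pgram x (cnj a * u) (cnj a * v) \<in> glue_half_squares \<T> \<and>
      Half_Square (x + silver *\<^sub>R (cnj a * u)) (x + cnj a * u + cnj a * v) (x + cnj a * u) \<in> \<T> \<and>
      Half_Square (x + silver *\<^sub>R (cnj a * v)) (x + cnj a * u + cnj a * v) (x + cnj a * v) \<in> \<T>"
      if sec: "sector Q y u v" for u v
    proof -
      have "\<psi> ` region (Rhombus y (y + u) (y + u + v) (y + v)) \<in> glue_half_squares \<T>"
        "Half_Square (\<psi> (y + silver *\<^sub>R u)) (\<psi> (y + u + v)) (\<psi> (y + u)) \<in> \<T>"
        "Half_Square (\<psi> (y + silver *\<^sub>R v)) (\<psi> (y + u + v)) (\<psi> (y + v)) \<in> \<T>"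
        using sec unfolding sector_def by (auto intro: half rhomb)
      then show ?thesis unfolding region_rhombus \<psi>_pgram x_def by (simp add: \<psi>_add)
    qed
    from sectors[of k] this[of "D k" "D (k + 1)"] this[of "D (k + 1)" "D k"] show ?thesis
      by (auto simp: D'D pgram_swap add_ac)
  qed
  have "glued_star (glue_half_squares \<T>) x D'"
    unfolding glued_star_def
  proof (intro allI conjI)
    fix k
    show "pgram x (D' k) (D' (k + 1)) \<in> glue_half_squares \<T>" using tiles by blast
    define e where "e = D' (k + 1)"
    have rec: "D' k + D' (k + 2) = sqrt 2 *\<^sub>R e"
      using w(3)[of "cnj a * b'"] unfolding octagonal_def D'_def e_def by blast
    \<comment> \<open>The hypotenuse \<open>V W\<close> lies on the ray in direction
      \<open>e\<close>. The half-squares of the two sectors next to this ray share it and are mirror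
      images.\<close>
    define V S W where "V = x + silver *\<^sub>R e" and "S = x + e + D' k" and "W = x + e"
    have "V + W - S = x + e + D' (k + 2)"
      unfolding V_def S_def W_def silver_def using rec by (simp add: algebra_simps)
    moreover have h: "Half_Square V S W \<in> \<T>" "Half_Square V (x + e + D' (k + 2)) W \<in> \<T>"
      using tiles[of k] tiles[of "k + 1"] by (simp_all add: V_def S_def W_def e_def add_ac)
    ultimately have "mirror V W S = x + e + D' (k + 2)"
      using mirror_half_square T unfolding is_tiling_def by metis
    moreover from this have "region (Half_Square V S W) \<union> region (Half_Square V (mirror V W S) W) \<in> glue_half_squares \<T>"
      using h unfolding glue_half_squares_def
      by (intro UnI2 CollectI exI[of _ V] exI[of _ S] exI[of _ W] conjI refl) simp_all
    moreover have "region (Half_Square V S W) \<union> region (Half_Square V (mirror V W S) W) = pgram S (V - S) (W - S)"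
      using union_half_squares[of V S W] \<open>mirror V W S = _\<close> \<open>V + W - S = _\<close> by simp
    moreover have "pgram S (V - S) (W - S) = pgram (x + e) (D' k) (D' (k + 2))"
    proof -
      have vsw: "V - S = D' (k + 2)" "W - S = - D' k" "S = x + e + D' k"
        unfolding V_def S_def W_def silver_def using rec by (simp_all add: algebra_simps)
      have "pgram S (V - S) (W - S) = pgram (x + e + D' k) (- D' k) (D' (k + 2))"
        unfolding vsw(1,2) unfolding vsw(3) by (rule pgram_swap)
      also have "\<dots> = pgram (x + e) (D' k) (D' (k + 2))" by (rule pgram_rebase[symmetric])
      finally show ?thesis .
    qed
    ultimately show "pgram (x + D' (k + 1)) (D' k) (D' (k + 2)) \<in> glue_half_squares \<T>"
      by (simp add: e_def)
  qed
  moreover have "cmod (cnj a * b') = 1" using a bc(1)[folded norm_eq_1] by (simp add: norm_mult)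
  ultimately show ?thesis using that[of "cnj a * b'" w x] w x_dist by (simp add: D'_def[abs_def])
qed

section \<open>Eigenfunctions supported on stars\<close>

text \<open>A tent of height 1 at \<open>E\<close> lies below the indicator of a short interval, so
  the increment of the distribution function over that interval is at least \<delta>. Continuity at
  \<open>E\<close> would make it smaller.\<close>

lemma mass_bound_imp_not_continuous_cdf:
  fixes \<nu> :: "real measure"
  assumes \<nu>: "real_distribution \<nu>" and \<delta>: "\<delta> > 0"
    and mass: "\<And>f::real \<Rightarrow> real. continuous_on UNIV f \<Longrightarrow> (f \<longlongrightarrow> 0) at_infinity \<Longrightarrow> (\<And>x. f x \<ge> 0) \<Longrightarrow>
      f E * \<delta> \<le> (\<integral>x. f x \<partial>\<nu>)"
  shows "\<not> continuous_on UNIV (cdf \<nu>)"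
proof
  assume "continuous_on UNIV (cdf \<nu>)"
  then have "isCont (cdf \<nu>) E" by (simp add: continuous_on_eq_continuous_at)
  then obtain d where d: "d > 0" "\<And>y. dist y E < d \<Longrightarrow> dist (cdf \<nu> y) (cdf \<nu> E) < \<delta> / 2"
    using \<delta> unfolding continuous_at_eps_delta by (metis half_gt_zero)
  interpret real_distribution \<nu> by (rule \<nu>)
  define e where "e = d / 2"
  have e: "e > 0" "e < d" using d by (simp_all add: e_def)
  define f where "f x = max 0 (1 - \<bar>x - E\<bar> / e)" for x
  have cont: "continuous_on UNIV f" unfolding f_def by (intro continuous_intros) (use e in auto)
  have f0: "f x = 0" if "x \<notin> {E - e<..E + e}" for x
  proof -
    have "e \<le> \<bar>x - E\<bar>" using that by auto
    then show ?thesis using e by (simp add: f_def)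
  qed
  have "eventually (\<lambda>x. f x = 0) at_infinity"
    unfolding eventually_at_infinity
    by (rule exI[of _ "\<bar>E\<bar> + e + 1"]) (auto intro!: f0)
  then have "(f \<longlongrightarrow> 0) at_infinity" by (rule tendsto_eventually)
  then have "f E * \<delta> \<le> (\<integral>x. f x \<partial>\<nu>)" by (rule mass[OF cont]) (simp add: f_def)
  also have "\<dots> \<le> (\<integral>x. indicator {E - e<..E + e} x \<partial>\<nu>)"
  proof (rule integral_mono)
    have "f x \<le> 1" "f x \<ge> 0" for x using e by (simp_all add: f_def)
    moreover have "f \<in> borel_measurable borel" using cont by (rule borel_measurable_continuous_onI)
    ultimately show "integrable \<nu> f" by (intro integrable_const_bound[of _ 1]) auto
    show "f x \<le> indicator {E - e<..E + e} x" for x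
      using f0[of x] \<open>f x \<le> 1\<close> by (auto simp: indicator_def)
  qed (simp add: integrable_indicator_iff emeasure_eq_measure)
  also have "\<dots> = measure \<nu> {E - e<..E + e}" by simp
  also have "\<dots> = cdf \<nu> (E + e) - cdf \<nu> (E - e)" using e by (intro cdf_diff_eq[symmetric]) auto
  also have "\<dots> < \<delta>"
    using d(2)[of "E + e"] d(2)[of "E - e"] e by (auto simp: dist_real_def abs_if split: if_splits)
  finally show False by (simp add: f_def)
qed

lemma orthonormal_family:
  assumes V: "finite V" and I: "finite I" and U: "lin_closed U" "U \<subseteq> ell2 V"
    and f: "\<And>i. i \<in> I \<Longrightarrow> f i \<in> U" "\<And>i. i \<in> I \<Longrightarrow> \<exists>v. f i v \<noteq> 0"
    and disj: "\<And>i j v. i \<in> I \<Longrightarrow> j \<in> I \<Longrightarrow> i \<noteq> j \<Longrightarrow> f i v = 0 \<or> f j v = 0"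
  obtains S where "orthonormal_in V S" "S \<subseteq> U" "card S = card I"
proof -
  have "\<exists>a. ell2_inner V (\<lambda>v. a * f i v) (\<lambda>v. a * f i v) = 1" if i: "i \<in> I" for i
  proof -
    obtain v where "f i v \<noteq> 0" using f(2)[OF i] by blast
    moreover have "f i \<in> ell2 V" using f(1)[OF i] U(2) by blast
    ultimately show ?thesis using ell2_normalize[OF V] by blast
  qed
  then obtain a where a: "\<And>i. i \<in> I \<Longrightarrow> ell2_inner V (\<lambda>v. a i * f i v) (\<lambda>v. a i * f i v) = 1" by metis
  define g where "g i = (\<lambda>v. a i * f i v)" for i
  have one: "ell2_inner V (g i) (g i) = 1" if "i \<in> I" for i using a[OF that] by (simp add: g_def)
  have zero: "ell2_inner V (g i) (g j) = 0" if "i \<in> I" "j \<in> I" "i \<noteq> j" for i j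
    unfolding ell2_inner_def g_def using disj[OF that] by (intro sum.neutral) force
  have inj: "inj_on g I"
    by (rule inj_onI) (metis one zero zero_neq_one)
  show ?thesis
  proof (rule that[of "g ` I"])
    show "orthonormal_in V (g ` I)"
      unfolding orthonormal_in_def using one zero inj by (auto simp: inj_on_def)
    show "g ` I \<subseteq> U" unfolding g_def using lin_closed_scale[OF U(1)] f(1) by blast
    show "card (g ` I) = card I" by (rule card_image[OF inj])
  qed
qed

lemma tile_adjacent_sym: "tile_adjacent u v \<Longrightarrow> tile_adjacent v u"
  by (auto simp: tile_adjacent_def)

text \<open>The common edge is visible; \<open>tile_adjacent\<close> also demands distinct tiles,
  and the vertex \<open>p + c\<^sub>1\<close> lies beyond the edge as seen from the second
  one.\<close>

lemma tile_adjacent_opposite_pgrams: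
  assumes "cross2 d c\<^sub>1 * cross2 d c\<^sub>2 < 0"
  shows "tile_adjacent (pgram p d c\<^sub>1) (pgram p d c\<^sub>2)"
proof -
  have nz: "cross2 d c\<^sub>1 \<noteq> 0" "cross2 d c\<^sub>2 \<noteq> 0" using assms by auto
  have "p + c\<^sub>1 \<in> pgram p d c\<^sub>1" unfolding pgram_hull by (simp add: hull_inc)
  moreover have "p + c\<^sub>1 \<notin> pgram p d c\<^sub>2"
    using assms nz unfolding pgram_cross2[OF nz(2)] by (auto simp: zero_le_divide_iff mult_less_0_iff)
  ultimately have "pgram p d c\<^sub>1 \<noteq> pgram p d c\<^sub>2" by blast
  then show ?thesis
    unfolding tile_adjacent_def using closed_segment_edge_of_pgram nz by blast
qed

text \<open>All indices are modulo 8, and the square \<open>Sq k\<close> lies between \<open>Rh k\<close> and \<open>Rh (k + 1)\<close>.\<close>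

locale octagon =
  fixes x u w :: complex
  assumes norm_u: "cmod u = 1" and norm_w: "cmod w = 1" and oct: "octagonal (\<lambda>k. u * w ^ k)"
begin

definition d :: "nat \<Rightarrow> complex" where "d k = u * w ^ k"
definition Rh :: "nat \<Rightarrow> complex set" where "Rh k = pgram x (d k) (d (k + 1))"
definition Sq :: "nat \<Rightarrow> complex set" where "Sq k = pgram (x + d (k + 1)) (d k) (d (k + 2))"

lemma octagonal_d: "octagonal d"
  using oct by (simp add: d_def[abs_def])

lemma d_rec: "d k + d (k + 2) = sqrt 2 *\<^sub>R d (k + 1)"
  using octagonal_d unfolding octagonal_def by blast

lemma u_nz: "u \<noteq> 0" using norm_u by auto

lemma norm_d: "d k \<bullet> d k = 1"
  unfolding norm_eq_1[symmetric] by (simp add: d_def norm_mult norm_power norm_u norm_w)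

lemma d_inner_2: "d k \<bullet> d (k + 2) = 0" "d (k + 2) \<bullet> d k = 0"
proof -
  have "(d k + d (k + 2)) \<bullet> (d k + d (k + 2)) = (sqrt 2 *\<^sub>R d (k + 1)) \<bullet> (sqrt 2 *\<^sub>R d (k + 1))"
    by (simp only: d_rec)
  then show "d k \<bullet> d (k + 2) = 0"
    using norm_d[of k] norm_d[of "k + 2"] norm_d[of "k + 1"]
    by (simp add: inner_add_left inner_add_right inner_commute)
  then show "d (k + 2) \<bullet> d k = 0" by (simp only: inner_commute)
qed

lemma d_inner_1: "d k \<bullet> d (k + 1) = sqrt 2 / 2" "d (k + 1) \<bullet> d k = sqrt 2 / 2"
proof -
  have "d k \<bullet> (d k + d (k + 2)) = d k \<bullet> (sqrt 2 *\<^sub>R d (k + 1))" by (simp only: d_rec)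
  then have "1 = sqrt 2 * (d k \<bullet> d (k + 1))" using norm_d[of k] d_inner_2 by (simp add: inner_add_right)
  then have "sqrt 2 * 1 = sqrt 2 * (sqrt 2 * (d k \<bullet> d (k + 1)))" by (simp only:)
  then show "d k \<bullet> d (k + 1) = sqrt 2 / 2" by (simp add: mult.assoc[symmetric])
  then show "d (k + 1) \<bullet> d k = sqrt 2 / 2" by (simp only: inner_commute)
qed

lemma d_inner_1_Suc: "d (k + 1) \<bullet> d (k + 2) = sqrt 2 / 2" "d (k + 2) \<bullet> d (k + 1) = sqrt 2 / 2"
  using d_inner_1[of "k + 1"] by (simp_all add: add.assoc numeral_2_eq_2)

lemma cross2_d_1: "cross2 (d (k + 1)) (d (k + 2)) = cross2 (d k) (d (k + 1))"
proof -
  have "d (k + 2) = sqrt 2 *\<^sub>R d (k + 1) - d k" using d_rec[of k] by (simp add: eq_diff_eq add.commute)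
  then show ?thesis using cross2_commute[of "d (k + 1)" "d k"] by simp
qed

lemma cross2_d_2: "cross2 (d k) (d (k + 2)) = sqrt 2 * cross2 (d k) (d (k + 1))"
proof -
  have "d (k + 2) = sqrt 2 *\<^sub>R d (k + 1) - d k" using d_rec[of k] by (simp add: eq_diff_eq add.commute)
  then show ?thesis by simp
qed

lemma cross2_d_nz: "cross2 (d k) (d (k + 1)) \<noteq> 0"
  using cross2_prototile[of "d k" "d (k + 1)"] norm_d d_inner_1 by auto

lemma w4: "w ^ 4 = -1"
proof -
  have "u * w ^ (0 + 4) = - (u * w ^ 0)" using oct unfolding octagonal_def by blast
  then have "u * (w ^ 4 + 1) = 0" by (simp add: distrib_left)
  then show ?thesis using u_nz by (simp add: eq_neg_iff_add_eq_0)
qed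

lemma w_powers: "(w ^ k) ^ 4 = (-1) ^ k"
  using w4 by (metis mult.commute power_mult)

lemma w_nz: "w \<noteq> 0" using norm_w by auto

lemma d_eq_iff: "d j = d k \<longleftrightarrow> w ^ j = w ^ k"
  using u_nz by (simp add: d_def)

lemma d_shift: "d (j + n) = d (k + n) \<longleftrightarrow> d j = d k"
  unfolding d_eq_iff using w_nz by (simp add: power_add)

text \<open>The fourth power of \<open>w ^ k\<close> is the sign attached to \<open>k\<close>. Hence
  the sign depends only on the direction, which makes \<open>alternating\<close> consistent around
  the star.\<close>

lemma d_eq_parity: "d j = d k \<Longrightarrow> (-1::complex) ^ j = (-1) ^ k"
  unfolding d_eq_iff by (metis w_powers)

lemma d_neq_1: "d k \<noteq> d (k + 1)"
  using d_eq_parity[of k "k + 1"] by auto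

lemma d_neq_2: "d k \<noteq> d (k + 2)"
  using d_inner_2(1)[of k] norm_d[of k] by auto

lemma Rh_cong: "d j = d k \<Longrightarrow> Rh j = Rh k"
  unfolding Rh_def using d_shift[of j 1 k] by simp

lemma d_period: "d (k + 8) = d k"
  using octagonal_values(7)[OF octagonal_d] .

text \<open>The vertex opposite to \<open>x\<close> is the only point of the rhombus at maximal
  distance from \<open>x\<close>, with square 2 + sqrt 2, and it determines the direction.\<close>

lemma Rh_eq_iff: "Rh j = Rh k \<longleftrightarrow> d j = d k"
proof
  assume eq: "Rh j = Rh k"
  have "x + 1 *\<^sub>R d j + 1 *\<^sub>R d (j + 1) \<in> Rh j"
    unfolding Rh_def pgram_def by (intro CollectI exI conjI) (rule refl, simp_all)
  then obtain \<alpha> \<beta> where ab: "d j + d (j + 1) = \<alpha> *\<^sub>R d k + \<beta> *\<^sub>R d (k + 1)"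
      "0 \<le> \<alpha>" "\<alpha> \<le> 1" "0 \<le> \<beta>" "\<beta> \<le> 1"
    unfolding eq unfolding Rh_def pgram_def by (auto simp: add.assoc)
  have "(d j + d (j + 1)) \<bullet> (d j + d (j + 1)) = 2 + sqrt 2"
    by (simp only: inner_add_left inner_add_right norm_d d_inner_1)
  moreover have "(\<alpha> *\<^sub>R d k + \<beta> *\<^sub>R d (k + 1)) \<bullet> (\<alpha> *\<^sub>R d k + \<beta> *\<^sub>R d (k + 1)) = \<alpha> * \<alpha> + \<beta> * \<beta> + sqrt 2 * (\<alpha> * \<beta>)"
    by (simp only: inner_add_left inner_add_right norm_d d_inner_1 inner_scaleR_left inner_scaleR_right)
      (simp add: algebra_simps)
  ultimately have sum: "\<alpha> * \<alpha> + \<beta> * \<beta> + sqrt 2 * (\<alpha> * \<beta>) = 2 + sqrt 2" using ab(1) by simp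
  have le: "\<alpha> * \<alpha> \<le> \<alpha>" "\<beta> * \<beta> \<le> \<beta>" "\<alpha> * \<beta> \<le> 1"
    using ab by (simp_all add: mult_left_le mult_le_one)
  then have "sqrt 2 * (\<alpha> * \<beta>) \<le> sqrt 2" by simp
  then have "\<alpha> = 1 \<and> \<beta> = 1" using sum le ab by linarith
  then have "u * (w ^ j * (1 + w)) = u * (w ^ k * (1 + w))" using ab(1) by (simp add: d_def algebra_simps)
  moreover have "1 + w \<noteq> 0"
  proof
    assume "1 + w = 0"
    then have "w = -1" by (simp add: add_eq_0_iff)
    then show False using w4 by simp
  qed
  ultimately show "d j = d k" using u_nz by (simp add: d_eq_iff)
qed (rule Rh_cong)

text \<open>Again the vertex farthest from \<open>x\<close> is recognised by its distance, with
  square 3 + 2 sqrt 2; it lies on the ray in direction \<open>d (k + 1)\<close>.\<close>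

lemma Sq_eq_iff: "Sq j = Sq k \<longleftrightarrow> d j = d k"
proof
  assume eq: "Sq j = Sq k"
  have "(x + d (j + 1)) + 1 *\<^sub>R d j + 1 *\<^sub>R d (j + 2) \<in> Sq j"
    unfolding Sq_def pgram_def by (intro CollectI exI conjI) (rule refl, simp_all)
  then obtain \<alpha> \<beta> where "(x + d (j + 1)) + 1 *\<^sub>R d j + 1 *\<^sub>R d (j + 2) = (x + d (k + 1)) + \<alpha> *\<^sub>R d k + \<beta> *\<^sub>R d (k + 2)"
      and ab: "0 \<le> \<alpha>" "\<alpha> \<le> 1" "0 \<le> \<beta>" "\<beta> \<le> 1"
    unfolding eq unfolding Sq_def pgram_def by blast
  then have eq1: "d (j + 1) + d j + d (j + 2) = d (k + 1) + \<alpha> *\<^sub>R d k + \<beta> *\<^sub>R d (k + 2)"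
    by (simp add: add.assoc)
  have n: "(d (i + 1) + a *\<^sub>R d i + b *\<^sub>R d (i + 2)) \<bullet> (d (i + 1) + a *\<^sub>R d i + b *\<^sub>R d (i + 2))
      = 1 + a * a + b * b + sqrt 2 * (a + b)" for i a b
    by (simp only: inner_add_left inner_add_right norm_d d_inner_1 d_inner_1_Suc d_inner_2 inner_scaleR_left inner_scaleR_right)
      (simp add: algebra_simps)
  have "1 + \<alpha> * \<alpha> + \<beta> * \<beta> + sqrt 2 * (\<alpha> + \<beta>) = 3 + sqrt 2 * 2"
    using n[of j 1 1] n[of k \<alpha> \<beta>] eq1 by simp
  moreover have "\<alpha> * \<alpha> \<le> \<alpha>" "\<beta> * \<beta> \<le> \<beta>" using ab by (simp_all add: mult_left_le)
  moreover have "sqrt 2 * (\<alpha> + \<beta>) \<le> sqrt 2 * 2" using ab by simp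
  ultimately have "\<alpha> = 1 \<and> \<beta> = 1" using ab by linarith
  then have "d (j + 1) + (d j + d (j + 2)) = d (k + 1) + (d k + d (k + 2))" using eq1 by (simp add: algebra_simps)
  then have "(1 + sqrt 2) *\<^sub>R d (j + 1) = (1 + sqrt 2) *\<^sub>R d (k + 1)" unfolding d_rec by (simp add: scaleR_add_left)
  moreover have "1 + sqrt 2 \<noteq> 0" using sqrt2_bounds by linarith
  ultimately have "d (j + 1) = d (k + 1)" using scaleR_left_imp_eq by blast
  then show "d j = d k" by (simp only: d_shift)
next
  assume "d j = d k"
  then show "Sq j = Sq k" unfolding Sq_def using d_shift[of j 1 k] d_shift[of j 2 k] by simp
qed

text \<open>Every rhombus contains \<open>x\<close>, whereas the points of \<open>Sq k\<close> are
  at least 1 away from \<open>x\<close> in direction \<open>d (k + 1)\<close>.\<close>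

lemma Rh_neq_Sq: "Rh j \<noteq> Sq k"
proof
  assume eq: "Rh j = Sq k"
  have "x \<in> Rh j" unfolding Rh_def pgram_hull by (simp add: hull_inc)
  then obtain \<alpha> \<beta> where "x = (x + d (k + 1)) + \<alpha> *\<^sub>R d k + \<beta> *\<^sub>R d (k + 2)" and ab: "0 \<le> \<alpha>" "0 \<le> \<beta>"
    unfolding eq unfolding Sq_def pgram_def by blast
  then have "d (k + 1) \<bullet> (d (k + 1) + \<alpha> *\<^sub>R d k + \<beta> *\<^sub>R d (k + 2)) = 0" by (simp add: add.assoc)
  then have "1 + \<alpha> * (sqrt 2 / 2) + \<beta> * (sqrt 2 / 2) = 0"
    by (simp only: inner_add_right norm_d d_inner_1 d_inner_1_Suc inner_scaleR_right)
  moreover have "0 \<le> \<alpha> * (sqrt 2 / 2)" "0 \<le> \<beta> * (sqrt 2 / 2)" using ab by simp_all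
  ultimately show False by linarith
qed

text \<open>One description for each edge, with that edge first. The next two lemmas describe the
  tile across the same edge in the same form and compare the sides.\<close>

lemma Rh_representations:
  "Rh (k + 1) = pgram x (d (k + 1)) (d (k + 2))"
  "Rh (k + 1) = pgram x (d (k + 2)) (d (k + 1))"
  "Rh (k + 1) = pgram (x + d (k + 1)) (d (k + 2)) (- d (k + 1))"
  "Rh (k + 1) = pgram (x + d (k + 2)) (d (k + 1)) (- d (k + 2))"
  unfolding Rh_def
  using pgram_rebase[of x "d (k + 1)" "d (k + 2)"] pgram_rebase[of x "d (k + 2)" "d (k + 1)"]
  by (simp_all add: pgram_swap)

lemma neighbour_representations:
  "Rh k = pgram x (d (k + 1)) (d k)" "Rh (k + 2) = pgram x (d (k + 2)) (d (k + 3))"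
  "Sq k = pgram (x + d (k + 1)) (d (k + 2)) (d k)" "Sq (k + 1) = pgram (x + d (k + 2)) (d (k + 1)) (d (k + 3))"
  unfolding Rh_def Sq_def by (simp_all add: pgram_swap numeral_2_eq_2 numeral_3_eq_3)

lemma opposite_sides:
  "cross2 (d (k + 1)) (d (k + 2)) * cross2 (d (k + 1)) (d k) < 0"
  "cross2 (d (k + 2)) (d (k + 1)) * cross2 (d (k + 2)) (d (k + 3)) < 0"
  "cross2 (d (k + 2)) (- d (k + 1)) * cross2 (d (k + 2)) (d k) < 0"
  "cross2 (d (k + 1)) (- d (k + 2)) * cross2 (d (k + 1)) (d (k + 3)) < 0"
proof -
  define \<kappa> where "\<kappa> = cross2 (d k) (d (k + 1))"
  have \<kappa>: "\<kappa> * \<kappa> > 0" using cross2_d_nz[of k] unfolding \<kappa>_def by (metis not_real_square_gt_zero)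
  have 12: "cross2 (d (k + 1)) (d (k + 2)) = \<kappa>" using cross2_d_1[of k] by (simp add: \<kappa>_def)
  have 23: "cross2 (d (k + 2)) (d (k + 3)) = \<kappa>"
    using cross2_d_1[of "k + 1"] 12 by (simp add: numeral_2_eq_2 numeral_3_eq_3)
  have 02: "cross2 (d k) (d (k + 2)) = sqrt 2 * \<kappa>" using cross2_d_2[of k] by (simp add: \<kappa>_def)
  have 13: "cross2 (d (k + 1)) (d (k + 3)) = sqrt 2 * \<kappa>"
    using cross2_d_2[of "k + 1"] 12 by (simp add: numeral_2_eq_2 numeral_3_eq_3)
  have r: "cross2 (d (k + 1)) (d k) = - \<kappa>" "cross2 (d (k + 2)) (d (k + 1)) = - \<kappa>"
    "cross2 (d (k + 2)) (d k) = - (sqrt 2 * \<kappa>)"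
    using cross2_commute \<kappa>_def 12 02 by metis+
  show "cross2 (d (k + 1)) (d (k + 2)) * cross2 (d (k + 1)) (d k) < 0"
    "cross2 (d (k + 2)) (d (k + 1)) * cross2 (d (k + 2)) (d (k + 3)) < 0"
    "cross2 (d (k + 2)) (- d (k + 1)) * cross2 (d (k + 2)) (d k) < 0"
    "cross2 (d (k + 1)) (- d (k + 2)) * cross2 (d (k + 1)) (d (k + 3)) < 0"
    unfolding cross2_simps 12 23 13 r using \<kappa> by (simp_all add: mult.left_commute[of \<kappa> "sqrt 2"])
qed

lemma neighbours_adjacent:
  "tile_adjacent (Rh k) (Rh (k + 1))" "tile_adjacent (Rh (k + 2)) (Rh (k + 1))"
  "tile_adjacent (Sq k) (Rh (k + 1))" "tile_adjacent (Sq (k + 1)) (Rh (k + 1))"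
proof -
  show "tile_adjacent (Rh k) (Rh (k + 1))"
    unfolding neighbour_representations(1)[of k] Rh_representations(1)[of k]
    by (rule tile_adjacent_sym[OF tile_adjacent_opposite_pgrams[OF opposite_sides(1)]])
  show "tile_adjacent (Rh (k + 2)) (Rh (k + 1))"
    unfolding neighbour_representations(2)[of k] Rh_representations(2)[of k]
    by (rule tile_adjacent_sym[OF tile_adjacent_opposite_pgrams[OF opposite_sides(2)]])
  show "tile_adjacent (Sq k) (Rh (k + 1))"
    unfolding neighbour_representations(3)[of k] Rh_representations(3)[of k]
    by (rule tile_adjacent_sym[OF tile_adjacent_opposite_pgrams[OF opposite_sides(3)]])
  show "tile_adjacent (Sq (k + 1)) (Rh (k + 1))"
    unfolding neighbour_representations(4)[of k] Rh_representations(4)[of k]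
    by (rule tile_adjacent_sym[OF tile_adjacent_opposite_pgrams[OF opposite_sides(4)]])
qed

lemma adjacent_to_Rh:
  assumes T: "is_tiling \<T>" and star: "glued_star (glue_half_squares \<T>) x d"
    and v: "v \<in> glue_half_squares \<T>" and adj: "tile_adjacent v (Rh (k + 1))"
  shows "v \<in> {Rh k, Rh (k + 2), Sq k, Sq (k + 1)}"
proof -
  let ?X = "glue_half_squares \<T>"
  have in_X: "Rh j \<in> ?X" "Sq j \<in> ?X" for j using star unfolding glued_star_def Rh_def Sq_def by blast+
  obtain a b c where abc: "v = pgram a b c" "cross2 b c \<noteq> 0" using glued_tile_pgram[OF T v] by metis
  obtain e where e: "e edge_of v" "e edge_of Rh (k + 1)" and ne: "v \<noteq> Rh (k + 1)"
    using adj unfolding tile_adjacent_def by blast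
  \<comment> \<open>A tile sharing the edge overlaps one of the two known tiles along it, and glued
    tiles with overlapping interiors coincide.\<close>
  have third: "v = pgram p q c\<^sub>1 \<or> v = pgram p q c\<^sub>2"
    if "e = closed_segment p (p + q)" "cross2 q c\<^sub>1 * cross2 q c\<^sub>2 < 0" "pgram p q c\<^sub>1 \<in> ?X" "pgram p q c\<^sub>2 \<in> ?X"
    for p q c\<^sub>1 c\<^sub>2
    using edge_of_third_pgram[OF abc(2), of p q a c\<^sub>1 c\<^sub>2] that e(1) glued_tiles_disjoint[OF T v] unfolding abc(1) by blast
  have "cross2 (d (k + 1)) (d (k + 2)) \<noteq> 0" using opposite_sides(1)[of k] by auto
  then consider "e = closed_segment x (x + d (k + 1))" | "e = closed_segment x (x + d (k + 2))"
    | "e = closed_segment (x + d (k + 1)) (x + d (k + 1) + d (k + 2))"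
    | "e = closed_segment (x + d (k + 2)) (x + d (k + 2) + d (k + 1))"
    using edge_of_pgram_cases[of "d (k + 1)" "d (k + 2)" e x] e(2) unfolding Rh_representations(1)
    by (auto simp: add_ac)
  then show ?thesis
  proof cases
    case 1
    from third[OF this opposite_sides(1)] show ?thesis
      using in_X ne unfolding neighbour_representations(1)[symmetric] Rh_representations(1)[symmetric] by blast
  next
    case 2
    from third[OF this opposite_sides(2)] show ?thesis
      using in_X ne unfolding neighbour_representations(2)[symmetric] Rh_representations(2)[symmetric] by blast
  next
    case 3
    from third[OF this opposite_sides(3)] show ?thesis
      using in_X ne unfolding neighbour_representations(3)[symmetric] Rh_representations(3)[symmetric] by blast
  next
    case 4
    from third[OF this opposite_sides(4)] show ?thesis
      using in_X ne unfolding neighbour_representations(4)[symmetric] Rh_representations(4)[symmetric] by blast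
  qed
qed

text \<open>By \<open>Rh_eq_iff\<close> and \<open>d_eq_parity\<close> all indices of a rhombus give
  the same sign, so the choice of \<open>k\<close> is harmless.\<close>

definition alternating :: "complex set \<Rightarrow> complex" where
  "alternating v = (if v \<in> range Rh then (-1) ^ (SOME k. v = Rh k) else 0)"

lemma alternating_Rh: "alternating (Rh k) = (-1) ^ k"
proof -
  have "Rh k = Rh (SOME j. Rh k = Rh j)" by (rule someI) (rule refl)
  then have "d k = d (SOME j. Rh k = Rh j)" by (simp only: Rh_eq_iff)
  from d_eq_parity[OF this] show ?thesis unfolding alternating_def by simp
qed

lemma alternating_Sq: "alternating (Sq k) = 0"
  unfolding alternating_def using Rh_neq_Sq by fastforce

lemma Rh_period: "Rh k = Rh (k + 7 + 1)"
proof -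
  have "k + 7 + 1 = k + 8" by simp
  then have "d (k + 7 + 1) = d k" by (simp only: d_period)
  then show ?thesis by (rule Rh_cong[symmetric])
qed

text \<open>Indices are natural numbers, so the predecessor is reached by seven steps forward. The
  lemmas on neighbours need the form \<open>k + 1\<close>.\<close>

lemma range_Rh:
  assumes "v \<in> range Rh"
  obtains k where "v = Rh (k + 1)"
proof -
  obtain j where "v = Rh j" using assms by blast
  also have "\<dots> = Rh (j + 7 + 1)" by (rule Rh_period)
  finally show ?thesis by (rule that)
qed

lemma laplacian_alternating:
  assumes T: "is_tiling \<T>" and star: "glued_star (glue_half_squares \<T>) x d"
    and V: "finite V" "V \<subseteq> glue_half_squares \<T>" "\<And>k. Rh k \<in> V" "\<And>k. Sq k \<in> V" and v: "v \<in> V"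
  shows "(\<Sum>y | y \<in> V \<and> tile_adjacent y v. alternating v - alternating y) = 6 * alternating v"
proof (cases "v \<in> range Rh")
  case True
  then obtain k where k: "v = Rh (k + 1)" by (rule range_Rh)
  have "{y. y \<in> V \<and> tile_adjacent y v} = {Rh k, Rh (k + 2), Sq k, Sq (k + 1)}"
  proof (intro equalityI subsetI)
    fix y assume "y \<in> {y. y \<in> V \<and> tile_adjacent y v}"
    then have "y \<in> glue_half_squares \<T>" "tile_adjacent y (Rh (k + 1))" using V(2) k by auto
    then show "y \<in> {Rh k, Rh (k + 2), Sq k, Sq (k + 1)}" by (rule adjacent_to_Rh[OF T star])
  next
    fix y assume "y \<in> {Rh k, Rh (k + 2), Sq k, Sq (k + 1)}"
    then show "y \<in> {y. y \<in> V \<and> tile_adjacent y v}"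
      using neighbours_adjacent[of k] V(3,4) unfolding k by (elim insertE emptyE) simp_all
  qed
  moreover have "Rh k \<noteq> Rh (k + 2)" "Sq k \<noteq> Sq (k + 1)"
    unfolding Rh_eq_iff Sq_eq_iff by (rule d_neq_2, rule d_neq_1)
  \<comment> \<open>With a the value at \<open>v\<close>, the differences are 2a for each rhombus
    and a for each square; distinctness ensures that all four are counted.\<close>
  ultimately show ?thesis unfolding k
    by (simp add: Rh_neq_Sq alternating_Rh alternating_Sq power_add del: add_2_eq_Suc' One_nat_def)
next
  case False
  then have v0: "alternating v = 0" by (simp add: alternating_def)
  \<comment> \<open>Read backwards, the list of neighbours of a rhombus shows that outside the star
    only the squares see its rhombi.\<close>
  have adj_iff: "v = Sq j \<or> v = Sq (j + 1)" if "tile_adjacent (Rh (j + 1)) v" for j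
    using adjacent_to_Rh[OF T star, of v j] that V(2) v False tile_adjacent_sym by blast
  have "(\<Sum>y | y \<in> V \<and> tile_adjacent y v. alternating y) = (\<Sum>y | y \<in> range Rh \<and> tile_adjacent y v. alternating y)"
    by (rule sum.mono_neutral_right) (use V in \<open>auto simp: alternating_def\<close>)
  also have "\<dots> = 0"
  proof (cases "v \<in> range Sq")
    case True
    then obtain k where k: "v = Sq k" by blast
    have "{y. y \<in> range Rh \<and> tile_adjacent y v} = {Rh k, Rh (k + 1)}"
    proof (intro equalityI subsetI)
      fix y assume "y \<in> {y. y \<in> range Rh \<and> tile_adjacent y v}"
      then have "y \<in> range Rh" and adj: "tile_adjacent y v" by auto
      from this(1) obtain j where "y = Rh (j + 1)" by (rule range_Rh)
      with adj have j: "y = Rh (j + 1)" "tile_adjacent (Rh (j + 1)) v" by simp_all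
      from adj_iff[OF j(2)] have "d k = d j \<or> d k = d (j + 1)" unfolding k Sq_eq_iff .
      then have "Rh (k + 1) = Rh (j + 1) \<or> Rh k = Rh (j + 1)" unfolding Rh_eq_iff d_shift .
      then show "y \<in> {Rh k, Rh (k + 1)}" using j(1) by auto
    next
      fix y assume "y \<in> {Rh k, Rh (k + 1)}"
      moreover have "tile_adjacent (Rh (k + 1)) v" unfolding k by (rule tile_adjacent_sym[OF neighbours_adjacent(3)])
      moreover have "tile_adjacent (Rh k) v"
      proof -
        \<comment> \<open>The adjacency of \<open>Sq k\<close> and \<open>Rh k\<close> is the fourth
          case of \<open>neighbours_adjacent\<close>, read at the cyclic predecessor
          \<open>k + 7\<close>.\<close>
        have "Sq (k + 7 + 1) = Sq k" unfolding Sq_eq_iff d_period[of k, symmetric] by (simp add: add.commute)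
        then have "tile_adjacent (Sq k) (Rh (k + 7 + 1))" using neighbours_adjacent(4)[of "k + 7"] by simp
        then show ?thesis unfolding k using Rh_period[of k] tile_adjacent_sym by simp
      qed
      ultimately show "y \<in> {y. y \<in> range Rh \<and> tile_adjacent y v}" by blast
    qed
    moreover have "Rh k \<noteq> Rh (k + 1)" unfolding Rh_eq_iff by (rule d_neq_1)
    ultimately show ?thesis by (simp add: alternating_Rh power_add del: One_nat_def)
  next
    case False
    have "y \<notin> range Rh \<or> \<not> tile_adjacent y v" for y
    proof (rule ccontr)
      assume "\<not> (y \<notin> range Rh \<or> \<not> tile_adjacent y v)"
      then have y: "y \<in> range Rh" "tile_adjacent y v" by auto
      obtain j where "y = Rh (j + 1)" using y(1) by (rule range_Rh)
      then show False using adj_iff[of j] y(2) False by auto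
    qed
    then show ?thesis by (intro sum.neutral) blast
  qed
  finally show ?thesis unfolding v0 by (simp add: sum_negf)
qed

text \<open>The rhombi and squares of the star are required to lie in \<open>V\<close>, so that the
  induced subgraph keeps every neighbour of the support.\<close>

lemma alternating_eigenfunction:
  assumes T: "is_tiling \<T>" and star: "glued_star (glue_half_squares \<T>) x d"
    and V: "finite V" "V \<subseteq> glue_half_squares \<T>" "\<And>k. Rh k \<in> V" "\<And>k. Sq k \<in> V"
  shows "alternating \<in> eigenspace V (laplacian V tile_adjacent) 6"
proof -
  have "alternating v = 0" if "v \<notin> V" for v using that V(3) by (auto simp: alternating_def)
  then show ?thesis
    unfolding eigenspace_def ell2_def laplacian_def
    using laplacian_alternating[OF assms] by auto
qed

lemma centre_in_Rh: "x \<in> Rh k"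
  unfolding Rh_def pgram_hull by (simp add: hull_inc)

lemma dist_centre_Rh: "y \<in> Rh k \<Longrightarrow> dist x y \<le> 2"
  using pgram_dist[of x x "d k" "d (k + 1)" y] centre_in_Rh[of k] norm_d by (simp add: Rh_def)

lemma near_centre_Sq: "\<exists>y\<in>Sq k. dist x y \<le> 1"
proof
  show "x + d (k + 1) \<in> Sq k" unfolding Sq_def pgram_hull by (simp add: hull_inc)
  show "dist x (x + d (k + 1)) \<le> 1" using norm_d[of "k + 1", folded norm_eq_1] by (simp add: dist_norm)
qed

end

section \<open>Counting tiles and eigenfunctions in large discs\<close>

lemma card_tiles_meeting_ball:
  assumes T: "is_tiling \<T>"
  shows "finite (tiles_meeting_ball (glue_half_squares \<T>) n)"
    "real (card (tiles_meeting_ball (glue_half_squares \<T>) n)) \<le> (8 * (real n + 2))\<^sup>2"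
proof -
  let ?X = "glue_half_squares \<T>"
  let ?V = "tiles_meeting_ball ?X n"
  have sub: "v \<subseteq> cball 0 (real n + 2)" if "v \<in> ?V" for v
  proof
    fix y assume y: "y \<in> v"
    obtain z where z: "v \<in> ?X" "z \<in> v" "z \<in> cball 0 (real n)" using \<open>v \<in> ?V\<close> by (auto simp: tiles_meeting_ball_def)
    obtain a b c where "v = pgram a b c" "cmod b = 1" "cmod c = 1" using glued_tile_pgram[OF T z(1)] by metis
    then have "dist z y \<le> 2" using pgram_dist y z(2) by (simp add: norm_eq_1)
    then show "y \<in> cball 0 (real n + 2)" using z(3) dist_triangle[of 0 y z] by simp
  qed
  have ball: "\<exists>z. ball z (1/8) \<subseteq> v" if v: "v \<in> ?V" for v
  proof -
    have "v \<in> ?X" using v by (simp add: tiles_meeting_ball_def)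
    then obtain K where K: "K \<subseteq> \<T>" "K \<noteq> {}" "v = (\<Union>t\<in>K. region t)"
      using glue_half_squares_cases[OF T] by metis
    then obtain t where t: "t \<in> K" by blast
    then have "prototile t" using K(1) T by (auto simp: is_tiling_def)
    then obtain z where "ball z (1/8) \<subseteq> region t" using region_contains_ball by blast
    then show ?thesis using t K(3) by blast
  qed
  have disj: "interior v \<inter> interior w = {}" if "v \<in> ?V" "w \<in> ?V" "v \<noteq> w" for v w
    using glued_tiles_disjoint[OF T, of v w] that by (auto simp: tiles_meeting_ball_def)
  show "finite ?V" "real (card ?V) \<le> (8 * (real n + 2))\<^sup>2"
    using interior_disjoint_packing[of "real n + 2" ?V "\<lambda>v. v" 0] sub ball disj by auto
qed

text \<open>Grid points have modulus at most 6000 m, a star is centred within 1000 of its grid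
  point, and each of its squares has a point within 1 of the centre; this accounts for the radius. A
  tile in two supports would put the grid points within 1000 + 2 + 1000 of each other, less than the
  spacing 3000.\<close>

lemma many_eigenfunctions:
  assumes T: "is_tiling \<T>" and assoc: "associated_with_substitution \<T>"
    and V: "V = tiles_meeting_ball (glue_half_squares \<T>) (6000 * m + 1002)"
  obtains S where "orthonormal_in V S" "S \<subseteq> eigenspace V (laplacian V tile_adjacent) 6" "card S = m\<^sup>2"
proof -
  let ?X = "glue_half_squares \<T>"
  let ?I = "{..<m} \<times> {..<m}"
  define g where "g = (\<lambda>(i, j). Complex (3000 * real i) (3000 * real j))"
  have "\<exists>x u w. cmod u = 1 \<and> cmod w = 1 \<and> octagonal (\<lambda>k. u * w ^ k) \<and> glued_star ?X x (\<lambda>k. u * w ^ k) \<and> dist (g i) x \<le> 1000" for i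
    using star_near[OF T assoc] by metis
  then obtain x u w where xuw: "\<And>i. cmod (u i) = 1 \<and> cmod (w i) = 1 \<and> octagonal (\<lambda>k. u i * w i ^ k) \<and>
      glued_star ?X (x i) (\<lambda>k. u i * w i ^ k) \<and> dist (g i) (x i) \<le> 1000" by metis
  define f where "f i = octagon.alternating (x i) (u i) (w i)" for i
  have oct: "octagon (u i) (w i)" for i using xuw[of i] by (simp add: octagon_def)
  have finV: "finite V" unfolding V by (rule card_tiles_meeting_ball(1)[OF T])
  have VX: "V \<subseteq> ?X" unfolding V by (auto simp: tiles_meeting_ball_def)
  have eig: "f i \<in> eigenspace V (laplacian V tile_adjacent) 6" if i: "i \<in> ?I" for i
  proof -
    interpret octagon "x i" "u i" "w i" by (rule oct)
    have star: "glued_star ?X (x i) d" using xuw[of i] by (simp add: d_def[abs_def])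
    have in_X: "Rh k \<in> ?X" "Sq k \<in> ?X" for k using star unfolding glued_star_def Rh_def Sq_def by blast+
    obtain a b where ab: "i = (a, b)" "a < m" "b < m" using i by auto
    have "cmod (g i) \<le> \<bar>3000 * real a\<bar> + \<bar>3000 * real b\<bar>"
      using cmod_le[of "g i"] by (simp add: g_def ab)
    also have "\<dots> \<le> 6000 * real m" using ab by simp
    finally have xi: "cmod (x i) \<le> 6000 * real m + 1000"
      using xuw[of i] norm_triangle_sub[of "x i" "g i"] by (simp add: dist_norm norm_minus_commute)
    have "Rh k \<in> V" for k
      using centre_in_Rh[of k] xi in_X unfolding V tiles_meeting_ball_def by auto
    moreover have "Sq k \<in> V" for k
    proof -
      obtain y where y: "y \<in> Sq k" "dist (x i) y \<le> 1" using near_centre_Sq by blast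
      then have "y \<in> cball 0 (real (6000 * m + 1002))"
        using xi dist_triangle[of 0 y "x i"] by simp
      then show ?thesis using y(1) in_X unfolding V tiles_meeting_ball_def by blast
    qed
    ultimately show ?thesis unfolding f_def using alternating_eigenfunction[OF T star finV VX] by blast
  qed
  have nz: "\<exists>v. f i v \<noteq> 0" for i
  proof -
    interpret octagon "x i" "u i" "w i" by (rule oct)
    show ?thesis unfolding f_def using alternating_Rh[of 0] by (metis power_0 zero_neq_one)
  qed
  have supp: "x i \<in> v \<and> (\<forall>y\<in>v. dist (x i) y \<le> 2)" if "f i v \<noteq> 0" for i v
  proof -
    interpret octagon "x i" "u i" "w i" by (rule oct)
    have "v \<in> range Rh" using that unfolding f_def alternating_def by (auto split: if_splits)
    then show ?thesis using centre_in_Rh dist_centre_Rh by blast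
  qed
  have disj: "f i v = 0 \<or> f j v = 0" if ij: "i \<noteq> j" for i j v
  proof (rule ccontr)
    assume "\<not> (f i v = 0 \<or> f j v = 0)"
    then have "dist (x i) (x j) \<le> 2" using supp by blast
    then have "dist (g i) (g j) \<le> 2002"
      using xuw[of i] xuw[of j] dist_triangle[of "g i" "g j" "x i"] dist_triangle[of "x i" "g j" "x j"]
      by (simp add: dist_commute)
    moreover have "dist (g i) (g j) \<ge> 3000"
    proof -
      obtain a b a' b' where ab: "i = (a, b)" "j = (a', b')" by (cases i; cases j)
      have "1 \<le> \<bar>real p - real q\<bar>" if "p \<noteq> q" for p q :: nat using that by linarith
      then have "3000 \<le> \<bar>3000 * real a - 3000 * real a'\<bar> \<or> 3000 \<le> \<bar>3000 * real b - 3000 * real b'\<bar>"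
        using ij ab by (metis (no_types, opaque_lifting) abs_mult abs_numeral mult.right_neutral mult_left_mono right_diff_distrib zero_le_numeral)
      then have "3000 \<le> \<bar>Re (g i - g j)\<bar> \<or> 3000 \<le> \<bar>Im (g i - g j)\<bar>" by (simp add: g_def ab)
      then show ?thesis unfolding dist_norm using abs_Re_le_cmod abs_Im_le_cmod order_trans by blast
    qed
    ultimately show False by simp
  qed
  have sub: "eigenspace V (laplacian V tile_adjacent) 6 \<subseteq> ell2 V" by (auto simp: eigenspace_def)
  show ?thesis
  proof (rule orthonormal_family[OF finV _ lin_closed_eigenspace sub, of ?I f])
    fix S assume "orthonormal_in V S" "S \<subseteq> eigenspace V (laplacian V tile_adjacent) 6" "card S = card ?I"
    then show thesis using that by (simp add: power2_eq_square)
  qed (use eig nz disj in auto)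
qed

theorem theorem1p3:
  fixes X :: "complex set set" and \<nu> :: "real measure"
  assumes "ammann_beenker_tiling X"
    and "density_of_states_measure X \<nu>"
  shows "\<not> continuous_on UNIV (cdf \<nu>)"
proof -
  obtain \<T> where T: "is_tiling \<T>" and assoc: "associated_with_substitution \<T>" and X: "X = glue_half_squares \<T>"
    using assms(1) unfolding ammann_beenker_tiling_def by blast
  have dist: "real_distribution \<nu>"
    and weak: "weak_star_limit (\<lambda>n. spectral_measure (tiles_meeting_ball X n) tile_adjacent) \<nu>"
    using assms(2) by (auto simp: density_of_states_measure_def)
  \<comment> \<open>For m \<ge> 1 the disc of radius 6000 m + 1002 meets at most (8 (6000 m +
    1004))^2 \<le> (60000 m)^2 tiles, against m^2 eigenfunctions.\<close>
  define \<delta> :: real where "\<delta> = 1 / 60000\<^sup>2"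
  show ?thesis
  proof (rule mass_bound_imp_not_continuous_cdf[OF dist, of \<delta> 6])
    show "\<delta> > 0" by (simp add: \<delta>_def)
    fix f :: "real \<Rightarrow> real"
    assume cont: "continuous_on UNIV f" and lim: "(f \<longlongrightarrow> 0) at_infinity" and nn: "\<And>x. 0 \<le> f x"
    \<comment> \<open>The lower bound is proved for these radii; the limit along the subsequence is
      the same.\<close>
    let ?s = "\<lambda>m. 6000 * m + 1002 :: nat"
    define I where "I n = (\<integral>x. f x \<partial>spectral_measure (tiles_meeting_ball X n) tile_adjacent)" for n
    have "I \<longlonglongrightarrow> (\<integral>x. f x \<partial>\<nu>)"
      using weak cont lim unfolding weak_star_limit_def I_def by blast
    moreover have "strict_mono ?s" by (auto simp: strict_mono_def)
    ultimately have lim_sub: "(I \<circ> ?s) \<longlonglongrightarrow> (\<integral>x. f x \<partial>\<nu>)" by (rule LIMSEQ_subseq_LIMSEQ)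
    have ge: "f 6 * \<delta> \<le> (I \<circ> ?s) m" if m: "m \<ge> 1" for m
    proof -
      define V where "V = tiles_meeting_ball (glue_half_squares \<T>) (?s m)"
      obtain S where S: "orthonormal_in V S" "S \<subseteq> eigenspace V (laplacian V tile_adjacent) 6" "card S = m\<^sup>2"
        using many_eigenfunctions[OF T assoc V_def] .
      have fin: "finite V" unfolding V_def by (rule card_tiles_meeting_ball(1)[OF T])
      have pos: "card V > 0" using orthonormal_card_le(2)[OF fin S(1)] S(3) m by (metis less_le_trans zero_less_one zero_less_power gr0I not_one_le_zero)
      have "real (card V) \<le> (8 * (real (?s m) + 2))\<^sup>2" unfolding V_def by (rule card_tiles_meeting_ball(2)[OF T])
      also have "\<dots> \<le> (60000 * real m)\<^sup>2" using m by (intro power_mono) auto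
      finally have "real (card V) \<le> 60000\<^sup>2 * (real m)\<^sup>2" by (simp add: power_mult_distrib)
      then have "\<delta> * real (card V) \<le> real (card S)" unfolding \<delta>_def S(3) by (simp add: field_simps)
      then have "\<delta> \<le> real (card S) / real (card V)" using pos by (simp add: pos_le_divide_eq)
      then have "f 6 * \<delta> \<le> f 6 * (real (card S) / real (card V))" using nn by (rule mult_left_mono)
      also have "\<dots> \<le> I (?s m)"
        using spectral_measure_integral_ge[OF fin tile_adjacent_sym S(1,2)] nn borel_measurable_continuous_onI[OF cont]
        unfolding I_def X V_def by simp
      finally show ?thesis by simp
    qed
    show "f 6 * \<delta> \<le> (\<integral>x. f x \<partial>\<nu>)"
      by (rule LIMSEQ_le_const[OF lim_sub]) (use ge in blast)
  qed
qed

end
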